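(* There is a randomized algorithm that, given a nice $k$-expression $\mu$ for a graph $G=(V,E)$, solves \textsc{Connected Dominating Set} in time $\mathcal{O}^*(5^k)$. The algorithm does not return false positives and returns false negatives with probability at most $1/2$.
   Context: $\mathcal{O}^*$ hides polynomial factors in the input size. Clique-expressions use operations introduce $\ell(v)$, disjoint union, relabel $\rho_{i\to j}$, join $\eta_{i,j}$ ($i\neq j$, adds all edges between label-$i$ and label-$j$ vertices); a $k$-expression uses only labels $1,\dots,k$ throughout. For a node $t$ of the syntax tree, $G_t$ is the graph built by the subexpression at $t$ and $V_t^\ell$ its vertices of label $\ell$. An expression is irredundant if at every join node $t=\eta_{i,j}(G_{t'})$ no edge between $V_{t'}^i$ and $V_{t'}^j$ already exists in $G_{t'}$. It is nice if it is irredundant, every join node $\eta_{i,j}(G_{t'})$ adds at least one edge and has $V_{t'}^i\neq\emptyset\neq V_{t'}^j$, and every relabel node $\rho_{i\to j}(G_{t'})$ has $V_{t'}^i\ne\emptyset\ne V_{t'}^j$. \textsc{Connected Dominating Set}: given $G=(V,E)$, costs $\mathbf{c}\colon V\to\mathbb{Z}_{>0}$ (polynomially bounded in the input size) and budget $\overline{b}\ge0$, decide whether there exists $X\subseteq V$ with $N[X]=V$, $G[X]$ connected and $\mathbf{c}(X)\le\overline{b}$. Standing assumption: $G$ is connected with at least two vertices. *)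

theory Defs
  imports
    "HOL-Probability.SPMF"
    "HOL-Computational_Algebra.Polynomial"
    "HOL-Library.Log_Nat"
begin

text \<open>A finite simple graph is given by its vertex set \<open>V\<close> and its set \<open>E\<close> of
  two-element subsets of \<open>V\<close>.\<close>

definition connected_graph :: "'v set \<Rightarrow> 'v set set \<Rightarrow> bool" where
  "connected_graph V E \<longleftrightarrow>
     V \<noteq> {} \<and> (\<forall>u\<in>V. \<forall>v\<in>V. (u, v) \<in> {(x, y). {x, y} \<in> E}\<^sup>*)"

definition induced_edges :: "'v set set \<Rightarrow> 'v set \<Rightarrow> 'v set set" where
  "induced_edges E X = {e \<in> E. e \<subseteq> X}"

definition closed_neighborhood :: "'v set set \<Rightarrow> 'v set \<Rightarrow> 'v set" where
  "closed_neighborhood E X = X \<union> {v. \<exists>u\<in>X. {u, v} \<in> E}"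

definition connected_dominating_set :: "'v set \<Rightarrow> 'v set set \<Rightarrow> 'v set \<Rightarrow> bool" where
  "connected_dominating_set V E X \<longleftrightarrow>
     X \<subseteq> V \<and> closed_neighborhood E X = V \<and> connected_graph X (induced_edges E X)"

definition CDS :: "'v set \<Rightarrow> 'v set set \<Rightarrow> ('v \<Rightarrow> nat) \<Rightarrow> nat \<Rightarrow> bool" where
  "CDS V E c b \<longleftrightarrow> (\<exists>X. connected_dominating_set V E X \<and> sum c X \<le> b)"

datatype 'v cexp =
    Introduce nat 'v
  | DUnion "'v cexp" "'v cexp"
  | Relabel nat nat "'v cexp"
  | Join nat nat "'v cexp"

primrec verts :: "'v cexp \<Rightarrow> 'v set" where
  "verts (Introduce l v) = {v}"
| "verts (DUnion s t) = verts s \<union> verts t"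
| "verts (Relabel i j t) = verts t"
| "verts (Join i j t) = verts t"

text \<open>\<open>label_class t l\<close> is the set of vertices that carry label \<open>l\<close> in the graph
  built by \<open>t\<close>.\<close>

primrec label_class :: "'v cexp \<Rightarrow> nat \<Rightarrow> 'v set" where
  "label_class (Introduce i v) l = (if l = i then {v} else {})"
| "label_class (DUnion s t) l = label_class s l \<union> label_class t l"
| "label_class (Relabel i j t) l =
     (if l = j then label_class t i \<union> label_class t j
      else if l = i then {} else label_class t l)"
| "label_class (Join i j t) l = label_class t l"

primrec edges :: "'v cexp \<Rightarrow> 'v set set" where
  "edges (Introduce l v) = {}"
| "edges (DUnion s t) = edges s \<union> edges t"
| "edges (Relabel i j t) = edges t"
| "edges (Join i j t) =
     edges t \<union> {{u, v} |u v. u \<in> label_class t i \<and> v \<in> label_class t j}"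

primrec k_expression :: "nat \<Rightarrow> 'v cexp \<Rightarrow> bool" where
  "k_expression k (Introduce l v) \<longleftrightarrow> l \<in> {1..k}"
| "k_expression k (DUnion s t) \<longleftrightarrow>
     k_expression k s \<and> k_expression k t \<and> verts s \<inter> verts t = {}"
| "k_expression k (Relabel i j t) \<longleftrightarrow> i \<in> {1..k} \<and> j \<in> {1..k} \<and> k_expression k t"
| "k_expression k (Join i j t) \<longleftrightarrow>
     i \<in> {1..k} \<and> j \<in> {1..k} \<and> i \<noteq> j \<and> k_expression k t"

primrec subexps :: "'v cexp \<Rightarrow> 'v cexp set" where
  "subexps (Introduce l v) = {Introduce l v}"
| "subexps (DUnion s t) = insert (DUnion s t) (subexps s \<union> subexps t)"
| "subexps (Relabel i j t) = insert (Relabel i j t) (subexps t)"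
| "subexps (Join i j t) = insert (Join i j t) (subexps t)"

definition irredundant :: "'v cexp \<Rightarrow> bool" where
  "irredundant \<mu> \<longleftrightarrow>
     (\<forall>i j t. Join i j t \<in> subexps \<mu> \<longrightarrow>
        (\<forall>u\<in>label_class t i. \<forall>v\<in>label_class t j. {u, v} \<notin> edges t))"

definition nice :: "'v cexp \<Rightarrow> bool" where
  "nice \<mu> \<longleftrightarrow> irredundant \<mu> \<and>
     (\<forall>i j t. Join i j t \<in> subexps \<mu> \<longrightarrow>
        edges t \<subset> edges (Join i j t) \<and> label_class t i \<noteq> {} \<and> label_class t j \<noteq> {}) \<and>
     (\<forall>i j t. Relabel i j t \<in> subexps \<mu> \<longrightarrow>
        label_class t i \<noteq> {} \<and> label_class t j \<noteq> {})"

text \<open>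
  The machine model is a random access machine with logarithmic cost, programmed with
  structured control flow. The memory maps addresses to naturals, and \<open>Mem e\<close> reads the
  cell whose address is the value of \<open>e\<close>. Every operation is charged the bit length
  of the numbers involved, including addresses; multiplication, division and modulo
  are charged the product of the bit lengths, as for the schoolbook algorithms.
  The only source of randomness is \<open>Flip\<close>, which stores a fair coin toss.
\<close>

type_synonym memory = "nat \<Rightarrow> nat"

datatype aexp =
    Const nat
  | Mem aexp
  | Add aexp aexp
  | Sub aexp aexp
  | Mul aexp aexp
  | Div aexp aexp
  | Mod aexp aexp

datatype prog =
    Skip
  | Assign aexp aexp  \<comment> \<open>address and value\<close>
  | Flip aexp
  | Seq prog prog
  | If aexp prog prog
  | While aexp prog

text \<open>One more than the number of binary digits, so that no operation is free.\<close>

definition size_nat :: "nat \<Rightarrow> nat" where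
  "size_nat n = floorlog 2 n + 1"

primrec aval :: "aexp \<Rightarrow> memory \<Rightarrow> nat" where
  "aval (Const n) m = n"
| "aval (Mem a) m = m (aval a m)"
| "aval (Add a b) m = aval a m + aval b m"
| "aval (Sub a b) m = aval a m - aval b m"
| "aval (Mul a b) m = aval a m * aval b m"
| "aval (Div a b) m = aval a m div aval b m"
| "aval (Mod a b) m = aval a m mod aval b m"

primrec acost :: "aexp \<Rightarrow> memory \<Rightarrow> nat" where
  "acost (Const n) m = size_nat n"
| "acost (Mem a) m = acost a m + size_nat (aval a m) + size_nat (m (aval a m))"
| "acost (Add a b) m = acost a m + acost b m + size_nat (aval a m) + size_nat (aval b m)"
| "acost (Sub a b) m = acost a m + acost b m + size_nat (aval a m) + size_nat (aval b m)"
| "acost (Mul a b) m = acost a m + acost b m + size_nat (aval a m) * size_nat (aval b m)"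
| "acost (Div a b) m = acost a m + acost b m + size_nat (aval a m) * size_nat (aval b m)"
| "acost (Mod a b) m = acost a m + acost b m + size_nat (aval a m) * size_nat (aval b m)"

text \<open>Guards are true when nonzero. A missing probability mass in the resulting
  subprobability distribution on final memories and costs means nontermination.\<close>

partial_function (spmf) while_spmf ::
  "aexp \<Rightarrow> (memory \<Rightarrow> (memory \<times> nat) spmf) \<Rightarrow> memory \<Rightarrow> (memory \<times> nat) spmf" where
  "while_spmf g body m =
     (if aval g m = 0 then return_spmf (m, acost g m)
      else do {
        r \<leftarrow> body m;
        r' \<leftarrow> while_spmf g body (fst r);
        return_spmf (fst r', acost g m + snd r + snd r')
      })"

primrec exec :: "prog \<Rightarrow> memory \<Rightarrow> (memory \<times> nat) spmf" where
  "exec Skip m = return_spmf (m, 1)"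
| "exec (Assign a e) m =
     return_spmf (m(aval a m := aval e m),
       acost a m + acost e m + size_nat (aval a m) + size_nat (aval e m))"
| "exec (Flip a) m = do {
     x \<leftarrow> coin_spmf;
     return_spmf (m(aval a m := of_bool x), acost a m + size_nat (aval a m) + 1)
   }"
| "exec (Seq p q) m = do {
     r \<leftarrow> exec p m;
     r' \<leftarrow> exec q (fst r);
     return_spmf (fst r', snd r + snd r')
   }"
| "exec (If g p q) m = do {
     r \<leftarrow> (if aval g m \<noteq> 0 then exec p m else exec q m);
     return_spmf (fst r, acost g m + snd r)
   }"
| "exec (While g p) m = while_spmf g (exec p) m"

text \<open>The input word is stored from address 1 on, preceded by its length; a decision
  algorithm leaves its answer in cell 0.\<close>

definition init_memory :: "nat list \<Rightarrow> memory" where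
  "init_memory xs a =
     (if a = 0 then length xs else if a \<le> length xs then xs ! (a - 1) else 0)"

definition answer :: "prog \<Rightarrow> nat list \<Rightarrow> bool spmf" where
  "answer A xs = map_spmf (\<lambda>r. fst r 0 \<noteq> 0) (exec A (init_memory xs))"

definition runs_in_time :: "prog \<Rightarrow> nat list \<Rightarrow> nat \<Rightarrow> bool" where
  "runs_in_time A xs T \<longleftrightarrow>
     lossless_spmf (exec A (init_memory xs)) \<and>
     (\<forall>r \<in> set_spmf (exec A (init_memory xs)). snd r \<le> T)"

definition word_size :: "nat list \<Rightarrow> nat" where
  "word_size xs = (\<Sum>x\<leftarrow>xs. size_nat x)"

text \<open>The expression is written in postfix order, four numbers per node; the cost of a
  vertex accompanies the node that introduces it.\<close>

primrec encode_cexp :: "(nat \<Rightarrow> nat) \<Rightarrow> nat cexp \<Rightarrow> nat list" where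
  "encode_cexp c (Introduce l v) = [0, l, v, c v]"
| "encode_cexp c (DUnion s t) = encode_cexp c s @ encode_cexp c t @ [1, 0, 0, 0]"
| "encode_cexp c (Relabel i j t) = encode_cexp c t @ [2, i, j, 0]"
| "encode_cexp c (Join i j t) = encode_cexp c t @ [3, i, j, 0]"

definition encode_instance :: "nat cexp \<Rightarrow> (nat \<Rightarrow> nat) \<Rightarrow> nat \<Rightarrow> nat list" where
  "encode_instance \<mu> c b = b # encode_cexp c \<mu>"

end

theory Submission
  imports Defs "HOL-Number_Theory.Cong"
begin

text \<open>Cut and count modulo 4. Colour each vertex 0, 1, 2 or 3, where 1 and 2 are the two sides of a
  consistent cut of \<open>X\<close>, colour 3 marks vertices outside \<open>X\<close> chosen by inclusion and exclusion to be not
  dominated, and no edge joins two distinct nonzero colours. Give a colouring the weight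
  \<open>(-1) ^ m * x ^ w(X)\<close>, where \<open>m\<close> is the number of vertices of colour 3. The colourings belonging to \<open>X\<close>
  cancel unless \<open>X\<close> is dominating, and otherwise there are 2 to the number of components of \<open>G[X]\<close>
  of them. Modulo 4, the coefficient of \<open>x ^ m\<close> is therefore twice the number of connected
  dominating sets of weight \<open>m\<close>.

  A label needs only five states: the colours allowed in its class are 0 only, 0 and one of 1, 2, 3,
  or all of them. Counting the colourings that respect a state turns disjoint union into a
  pointwise product, and a join into a sum over the principal ideals that make up the compatible
  pairs of states, which form a down-set.

  The polynomials are stored as single numbers, their values at a point \<open>P\<close> exceeding all
  coefficients. The weight of a vertex is its cost times a large number plus a random number
  below \<open>N\<close>, so that by the isolation lemma the connected dominating set of least weight is unique with
  probability at least \<open>1/2\<close>, and then its coefficient is 2 modulo 4.\<close>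

subsection \<open>Colourings and the dynamic program\<close>

text \<open>Exchanging the two sides of a cut pairs up the colourings of every nonempty set, so a
  count modulo 2 would vanish throughout. The usual remedy is to fix one vertex on one side; here
  the modulus 4 makes the remaining factor 2 visible instead. The same modulus fits the
  inclusion-exclusion: with \<open>3\<close> in place of -1, each undominated vertex contributes a
  factor \<open>1 + 3\<close>, so a set that misses a vertex counts a multiple of 4 and no signed
  arithmetic enters. The program is shaped by the logarithmic cost model. The exponential factor has
  to come from the number of table entries alone, so each entry must keep polynomially many bits;
  this is where the polynomial bound on the costs enters. Labels and the budget, in contrast, may be
  exponentially large numbers, so neither a table indexed by raw labels nor a loop up to the budget
  is affordable. Finally, the program reads the postfix word in one flat loop, while its correctness
  is an induction over the expression; the rules for running programs are chosen to bridge this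
  gap.\<close>

definition allows :: "nat \<Rightarrow> nat \<Rightarrow> bool" where
  "allows s a \<longleftrightarrow> a = 0 \<or> s = 4 \<or> a = s"

definition compat :: "nat \<Rightarrow> nat \<Rightarrow> bool" where
  "compat a b \<longleftrightarrow> a = 0 \<or> b = 0 \<or> a = b"

definition meet :: "nat \<Rightarrow> nat \<Rightarrow> nat" where
  "meet s a = (if s = a \<or> s = 4 then a else 0)"

text \<open>The compatible pairs of states form the down-set generated by \<open>(0, 4)\<close>, \<open>(4, 0)\<close> and \<open>(a, a)\<close> for
  \<open>a = 1, 2, 3\<close>. Inclusion and exclusion over the principal ideals below \<open>(s, t)\<close> gives the coefficient
  \<open>2\<close> for \<open>(0, 0)\<close> and \<open>-1\<close>, replaced by \<open>3\<close>, for \<open>(0, a)\<close> and \<open>(a, 0)\<close>.\<close>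

definition join_sum :: "(nat \<Rightarrow> nat \<Rightarrow> 'a::comm_semiring_1) \<Rightarrow> nat \<Rightarrow> nat \<Rightarrow> 'a" where
  "join_sum f s t = f 0 t + f s 0 + 2 * f 0 0 +
     (\<Sum>a\<in>{1,2,3}. f (meet s a) (meet t a) + 3 * (f 0 (meet t a) + f (meet s a) 0))"

text \<open>\<open>3\<close> stands for \<open>-1\<close> modulo 4, so that everything can be computed with naturals.\<close>

definition color_weight :: "'a::comm_semiring_1 \<Rightarrow> nat \<Rightarrow> 'a" where
  "color_weight e a = (if a = 0 then 1 else if a = 3 then 3 else e)"

text \<open>Generic in the semiring: at \<open>monom 1 1\<close> this is the generating polynomial
  that the proof analyses, at a natural number it is what the program computes.\<close>

primrec dp :: "'a::comm_semiring_1 \<Rightarrow> ('v \<Rightarrow> nat) \<Rightarrow> 'v cexp \<Rightarrow> (nat \<Rightarrow> nat) \<Rightarrow> 'a" where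
  "dp x w (Introduce l v) = (\<lambda>s. \<Sum>a\<in>{0..3}. of_bool (allows (s l) a) * color_weight (x ^ w v) a)"
| "dp x w (DUnion t u) = (\<lambda>s. dp x w t s * dp x w u s)"
| "dp x w (Relabel i j t) = (\<lambda>s. dp x w t (s(i := s j)))"
| "dp x w (Join i j t) = (\<lambda>s. join_sum (\<lambda>a b. dp x w t (s(i := a, j := b))) (s i) (s j))"

text \<open>Colour 0 outside \<open>verts t\<close> makes a colouring determined by its values on
  the vertices. Hence there are finitely many, and those of a disjoint union correspond to
  pairs.\<close>

definition colorings :: "'v cexp \<Rightarrow> (nat \<Rightarrow> nat) \<Rightarrow> ('v \<Rightarrow> nat) set" where
  "colorings t s = {f. (\<forall>v. v \<notin> verts t \<longrightarrow> f v = 0) \<and> (\<forall>v. f v \<le> 3) \<and>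
     (\<forall>u v. {u, v} \<in> edges t \<longrightarrow> compat (f u) (f v)) \<and>
     (\<forall>l. \<forall>v\<in>label_class t l. allows (s l) (f v))}"

definition coloring_weight :: "'a::comm_semiring_1 \<Rightarrow> ('v \<Rightarrow> nat) \<Rightarrow> 'v set \<Rightarrow> ('v \<Rightarrow> nat) \<Rightarrow> 'a" where
  "coloring_weight x w V f = (\<Prod>v\<in>V. color_weight (x ^ w v) (f v))"

definition coloring_sum :: "'a::comm_semiring_1 \<Rightarrow> ('v \<Rightarrow> nat) \<Rightarrow> 'v cexp \<Rightarrow> (nat \<Rightarrow> nat) \<Rightarrow> 'a" where
  "coloring_sum x w t s = (\<Sum>f\<in>colorings t s. coloring_weight x w (verts t) f)"

section \<open>Coefficientwise congruence modulo 4\<close>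

definition cong4 :: "nat poly \<Rightarrow> nat poly \<Rightarrow> bool" where
  "cong4 p q \<longleftrightarrow> (\<forall>n. [coeff p n = coeff q n] (mod 4))"

lemma cong4_refl [simp]: "cong4 p p"
  by (simp add: cong4_def)

lemma cong4_trans: "cong4 p q \<Longrightarrow> cong4 q r \<Longrightarrow> cong4 p r"
  unfolding cong4_def by (blast intro: cong_trans)

lemma cong4_add: "cong4 p q \<Longrightarrow> cong4 p' q' \<Longrightarrow> cong4 (p + p') (q + q')"
  by (simp add: cong4_def cong_add)

lemma cong4_mult: "cong4 p q \<Longrightarrow> cong4 p' q' \<Longrightarrow> cong4 (p * p') (q * q')"
  by (simp add: cong4_def coeff_mult) (auto intro!: cong_sum cong_mult)

lemma cong4_sum: "(\<And>i. i \<in> I \<Longrightarrow> cong4 (f i) (g i)) \<Longrightarrow> cong4 (sum f I) (sum g I)"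
  by (induction I rule: infinite_finite_induct) (auto intro: cong4_add)

lemma cong4_of_nat: "[a = b] (mod 4) \<Longrightarrow> cong4 (of_nat a) (of_nat b)"
  by (auto simp: cong4_def of_nat_poly coeff_pCons split: nat.splits)

lemma cong4_join_sum:
  assumes "\<And>a b. cong4 (f a b) (g a b)"
  shows "cong4 (join_sum f s t) (join_sum g s t)"
  unfolding join_sum_def by (intro cong4_add cong4_sum cong4_mult assms cong4_refl)

lemma finite_verts [simp]: "finite (verts t)"
  by (induction t) auto

lemma label_class_subset: "label_class t l \<subseteq> verts t"
proof (induction t arbitrary: l)
  case (Relabel i j t)
  then show ?case by simp
next
  case (DUnion t u)
  from DUnion[of l] show ?case by auto
qed auto

lemma edges_subset: "e \<in> edges t \<Longrightarrow> e \<subseteq> verts t"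
  by (induction t) (use label_class_subset in fastforce)+

lemma finite_colorings [simp]: "finite (colorings t s)"
proof (rule finite_subset)
  show "colorings t s \<subseteq> {f. \<forall>v. (v \<in> verts t \<longrightarrow> f v \<in> {..3}) \<and> (v \<notin> verts t \<longrightarrow> f v = 0)}"
    by (auto simp: colorings_def)
  show "finite {f. \<forall>v. (v \<in> verts t \<longrightarrow> f v \<in> {..3}) \<and> (v \<notin> verts t \<longrightarrow> f v = (0::nat))}"
    by (intro finite_set_of_finite_funs) auto
qed

lemma compat_commute: "compat a b = compat b a"
  by (auto simp: compat_def)

section \<open>Colouring sums under the four operations\<close>

lemma coloring_sum_Introduce:
  "coloring_sum x w (Introduce l v) s = dp x w (Introduce l v) s"
proof -
  have "coloring_sum x w (Introduce l v) s =
      (\<Sum>a\<in>{a\<in>{0..3}. allows (s l) a}. color_weight (x ^ w v) a)"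
    unfolding coloring_sum_def
    by (rule sum.reindex_bij_witness[where j = "\<lambda>f. f v" and i = "\<lambda>a u. if u = v then a else 0"])
      (auto simp: colorings_def coloring_weight_def allows_def fun_eq_iff split: if_splits)
  also have "\<dots> = (\<Sum>a\<in>{0..3}. if allows (s l) a then color_weight (x ^ w v) a else 0)"
    by (rule sum.inter_filter) simp
  also have "\<dots> = dp x w (Introduce l v) s"
    unfolding dp.simps by (intro sum.cong) auto
  finally show ?thesis .
qed

lemma coloring_sum_DUnion:
  assumes "verts t \<inter> verts u = {}"
  shows "coloring_sum x w (DUnion t u) s = coloring_sum x w t s * coloring_sum x w u s"
proof -
  have disj: "v \<in> verts t \<Longrightarrow> v \<notin> verts u" for v using assms by auto
  have lt: "v \<in> label_class t l \<Longrightarrow> v \<in> verts t" for v l using label_class_subset by fast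
  have lu: "v \<in> label_class u l \<Longrightarrow> v \<in> verts u" for v l using label_class_subset by fast
  have et: "{a, b} \<in> edges t \<Longrightarrow> a \<in> verts t \<and> b \<in> verts t" for a b using edges_subset[of "{a, b}" t] by auto
  have eu: "{a, b} \<in> edges u \<Longrightarrow> a \<in> verts u \<and> b \<in> verts u" for a b using edges_subset[of "{a, b}" u] by auto
  let ?i = "\<lambda>(f, g) v. if v \<in> verts t then f v else g v"
  let ?j = "\<lambda>f. (\<lambda>v. if v \<in> verts t then f v else (0::nat), \<lambda>v. if v \<in> verts u then f v else (0::nat))"
  have "coloring_sum x w (DUnion t u) s = (\<Sum>(f, g)\<in>colorings t s \<times> colorings u s.
      coloring_weight x w (verts t) f * coloring_weight x w (verts u) g)"
    unfolding coloring_sum_def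
  proof (rule sum.reindex_bij_witness[where j = ?j and i = ?i])
    fix f assume "f \<in> colorings (DUnion t u) s"
    then show "?i (?j f) = f"
      by (auto simp: colorings_def fun_eq_iff)
  next
    fix f assume "f \<in> colorings (DUnion t u) s"
    then show "?j f \<in> colorings t s \<times> colorings u s"
      using lt lu et eu by (simp add: colorings_def)
  next
    fix b assume b: "b \<in> colorings t s \<times> colorings u s"
    then obtain f g where [simp]: "b = (f, g)" by (cases b)
    have z: "v \<notin> verts t \<Longrightarrow> f v = 0" "v \<notin> verts u \<Longrightarrow> g v = 0" for v
      using b by (auto simp: colorings_def)
    show "?j (?i b) = b"
      using z disj by (auto simp: fun_eq_iff)
    have "\<forall>v. (if v \<in> verts t then f v else g v) \<le> 3"
      using b by (auto simp: colorings_def)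
    moreover have "compat (if a \<in> verts t then f a else g a) (if b \<in> verts t then f b else g b)"
      if "{a, b} \<in> edges t \<union> edges u" for a b
      using that
    proof
      assume "{a, b} \<in> edges t" then show ?thesis using et[of a b] b by (auto simp: colorings_def)
    next
      assume "{a, b} \<in> edges u" then show ?thesis using eu[of a b] disj b by (auto simp: colorings_def)
    qed
    moreover have "allows (s l) (if v \<in> verts t then f v else g v)"
      if "v \<in> label_class t l \<union> label_class u l" for v l
      using that
    proof
      assume "v \<in> label_class t l" then show ?thesis using lt[of v l] b by (auto simp: colorings_def)
    next
      assume "v \<in> label_class u l" then show ?thesis using lu[of v l] disj b by (auto simp: colorings_def)
    qed
    ultimately show "?i b \<in> colorings (DUnion t u) s"
      using z unfolding colorings_def by simp
  next
    fix f assume "f \<in> colorings (DUnion t u) s"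
    have "coloring_weight x w (verts t \<union> verts u) f =
       coloring_weight x w (verts t) f * coloring_weight x w (verts u) f"
      unfolding coloring_weight_def by (rule prod.union_disjoint) (use assms in auto)
    then show "(case ?j f of (f, g) \<Rightarrow> coloring_weight x w (verts t) f * coloring_weight x w (verts u) g) =
          coloring_weight x w (verts (DUnion t u)) f"
      by (simp add: coloring_weight_def)
  qed
  then show ?thesis
    by (simp add: coloring_sum_def sum_product sum.cartesian_product)
qed

text \<open>The new class \<open>j\<close> merges the old classes \<open>i\<close> and
  \<open>j\<close>, so both obey the state of \<open>j\<close>. For \<open>i \<noteq> j\<close> the
  new class \<open>i\<close> is empty and its state constrains nothing.\<close>

lemma colorings_Relabel: "colorings (Relabel i j t) s = colorings t (s(i := s j))"
proof -
  have "(\<forall>l. \<forall>v\<in>label_class (Relabel i j t) l. allows (s l) (f v)) \<longleftrightarrow>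
      (\<forall>l. \<forall>v\<in>label_class t l. allows ((s(i := s j)) l) (f v))" for f
    by (simp split: if_splits) blast
  then show ?thesis
    by (simp add: colorings_def)
qed

lemma allows_meet: "a \<in> {1,2,3} \<Longrightarrow> allows (meet s a) c \<longleftrightarrow> allows s c \<and> allows a c"
  by (auto simp: allows_def meet_def)

lemma allows_zero: "allows 0 c \<Longrightarrow> allows s c"
  by (auto simp: allows_def)

lemma colorings_upd:
  assumes "i \<noteq> j"
    and "\<And>c. allows a c \<Longrightarrow> allows (s i) c" "\<And>c. allows b c \<Longrightarrow> allows (s j) c"
  shows "colorings t (s(i := a, j := b)) = {f \<in> colorings t s.
     (\<forall>v\<in>label_class t i. allows a (f v)) \<and> (\<forall>v\<in>label_class t j. allows b (f v))}"
proof -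
  have "(\<forall>l. \<forall>v\<in>label_class t l. allows ((s(i := a, j := b)) l) (f v)) \<longleftrightarrow>
      (\<forall>l. \<forall>v\<in>label_class t l. allows (s l) (f v)) \<and>
      (\<forall>v\<in>label_class t i. allows a (f v)) \<and> (\<forall>v\<in>label_class t j. allows b (f v))" for f
    using assms by (auto split: if_splits)
  then show ?thesis
    by (auto simp: colorings_def)
qed

lemma sum_filter_of_bool:
  fixes f :: "'b \<Rightarrow> 'a::semiring_1"
  assumes "finite A"
  shows "(\<Sum>x\<in>{x\<in>A. P x}. f x) = (\<Sum>x\<in>A. of_bool (P x) * f x)"
proof -
  have "(\<Sum>x\<in>{x\<in>A. P x}. f x) = (\<Sum>x\<in>A. if P x then f x else 0)"
    using assms by (rule sum.inter_filter)
  also have "\<dots> = (\<Sum>x\<in>A. of_bool (P x) * f x)"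
    by (intro sum.cong) auto
  finally show ?thesis .
qed

lemma coloring_sum_upd:
  assumes "i \<noteq> j"
    and "\<And>c. allows a c \<Longrightarrow> allows (s i) c" "\<And>c. allows b c \<Longrightarrow> allows (s j) c"
  shows "coloring_sum x w t (s(i := a, j := b)) = (\<Sum>f\<in>colorings t s.
     of_bool ((\<forall>v\<in>label_class t i. allows a (f v)) \<and> (\<forall>v\<in>label_class t j. allows b (f v))) *
     coloring_weight x w (verts t) f)"
proof -
  have "colorings t (s(i := a, j := b)) = {f \<in> colorings t s.
     (\<forall>v\<in>label_class t i. allows a (f v)) \<and> (\<forall>v\<in>label_class t j. allows b (f v))}"
    by (rule colorings_upd) (use assms in auto)
  then show ?thesis
    by (simp add: coloring_sum_def sum_filter_of_bool)
qed

lemma colorings_Join: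
  "colorings (Join i j t) s = {f \<in> colorings t s.
     \<forall>u\<in>label_class t i. \<forall>v\<in>label_class t j. compat (f u) (f v)}"
proof -
  have "(\<forall>u v. {u, v} \<in> edges (Join i j t) \<longrightarrow> compat (f u) (f v)) \<longleftrightarrow>
     (\<forall>u v. {u, v} \<in> edges t \<longrightarrow> compat (f u) (f v)) \<and>
     (\<forall>u\<in>label_class t i. \<forall>v\<in>label_class t j. compat (f u) (f v))" for f
    unfolding edges.simps Un_iff mem_Collect_eq doubleton_eq_iff
    using compat_commute by metis
  then show ?thesis
    by (simp add: colorings_def) blast
qed

lemma allows_compat: "allows a c \<Longrightarrow> allows a d \<Longrightarrow> a \<noteq> 4 \<Longrightarrow> compat c d"
  by (auto simp: allows_def compat_def)

lemma allows_distinct: "allows a c \<Longrightarrow> allows b c \<Longrightarrow> a \<noteq> b \<Longrightarrow> a \<noteq> 4 \<Longrightarrow> b \<noteq> 4 \<Longrightarrow> allows 0 c"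
  by (auto simp: allows_def)

lemma allows_zero_compat: "allows 0 c \<Longrightarrow> compat c d" "allows 0 c \<Longrightarrow> compat d c"
  by (auto simp: allows_def compat_def)

text \<open>Nonzero colours facing each other across a join must coincide. If both classes contain a
  nonzero colour, that of one vertex in \<open>A\<close> is forced on all nonzero vertices of
  \<open>B\<close>, and from there back on those of \<open>A\<close>, so a single \<open>a\<close>
  serves both classes.\<close>

lemma compat_classes:
  fixes f :: "'v \<Rightarrow> nat" and A B :: "'v set"
  assumes "\<And>v. f v \<le> (3::nat)"
  defines "p \<equiv> \<lambda>a. \<forall>v\<in>A. allows a (f v)" and "q \<equiv> \<lambda>a. \<forall>v\<in>B. allows a (f v)"
  shows "(\<forall>u\<in>A. \<forall>v\<in>B. compat (f u) (f v)) \<longleftrightarrow> p 0 \<or> q 0 \<or> p 1 \<and> q 1 \<or> p 2 \<and> q 2 \<or> p 3 \<and> q 3"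
proof
  assume c: "\<forall>u\<in>A. \<forall>v\<in>B. compat (f u) (f v)"
  show "p 0 \<or> q 0 \<or> p 1 \<and> q 1 \<or> p 2 \<and> q 2 \<or> p 3 \<and> q 3"
  proof (cases "p 0 \<or> q 0")
    case False
    then obtain u v where uv: "u \<in> A" "f u \<noteq> 0" "v \<in> B" "f v \<noteq> 0"
      by (auto simp: p_def q_def allows_def)
    have q: "q (f v')" if "v' \<in> A" "f v' \<noteq> 0" for v'
      using c that unfolding q_def allows_def compat_def by metis
    moreover have "p (f u)"
      using c uv unfolding p_def allows_def compat_def by metis
    moreover note q[OF uv(1,2)]
    moreover have "f u \<in> {1,2,3}"
      using uv(2) assms(1)[of u] by auto
    ultimately show ?thesis by auto
  qed auto
next
  assume "p 0 \<or> q 0 \<or> p 1 \<and> q 1 \<or> p 2 \<and> q 2 \<or> p 3 \<and> q 3"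
  moreover have "\<forall>u\<in>A. \<forall>v\<in>B. compat (f u) (f v)" if "p a" "q a" "a \<noteq> 4" for a
    using that unfolding p_def q_def by (blast intro: allows_compat)
  moreover have "\<forall>u\<in>A. \<forall>v\<in>B. compat (f u) (f v)" if "p 0 \<or> q 0"
    using that unfolding p_def q_def by (blast intro: allows_zero_compat)
  ultimately show "\<forall>u\<in>A. \<forall>v\<in>B. compat (f u) (f v)"
    by (elim disjE conjE) simp_all
qed

text \<open>The hypotheses leave five truth patterns on each side: all true, exactly one of the
  three nonzero colours, or none. The 25 combinations are checked numerically; if everything is
  true, the sum is \<open>1 + 1 + 2 + 3 * 7 = 25\<close>, which is 1 modulo 4.\<close>

lemma join_indicator_bool:
  assumes "p0 \<longrightarrow> p1 \<and> p2 \<and> p3" "q0 \<longrightarrow> q1 \<and> q2 \<and> q3"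
    and "p1 \<and> p2 \<or> p1 \<and> p3 \<or> p2 \<and> p3 \<longrightarrow> p0" "q1 \<and> q2 \<or> q1 \<and> q3 \<or> q2 \<and> q3 \<longrightarrow> q0"
  shows "(of_bool p0 + of_bool q0 + 2 * of_bool (p0 \<and> q0) +
    ((of_bool (p1 \<and> q1) + 3 * (of_bool (p0 \<and> q1) + of_bool (p1 \<and> q0))) +
    ((of_bool (p2 \<and> q2) + 3 * (of_bool (p0 \<and> q2) + of_bool (p2 \<and> q0))) +
    (of_bool (p3 \<and> q3) + 3 * (of_bool (p0 \<and> q3) + of_bool (p3 \<and> q0)))))) mod 4 =
    (of_bool (p0 \<or> q0 \<or> p1 \<and> q1 \<or> p2 \<and> q2 \<or> p3 \<and> q3) :: nat)"
proof -
  have p: "p0 \<and> p1 \<and> p2 \<and> p3 \<or> \<not> p0 \<and> p1 \<and> \<not> p2 \<and> \<not> p3 \<or>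
      \<not> p0 \<and> \<not> p1 \<and> p2 \<and> \<not> p3 \<or> \<not> p0 \<and> \<not> p1 \<and> \<not> p2 \<and> p3 \<or>
      \<not> p0 \<and> \<not> p1 \<and> \<not> p2 \<and> \<not> p3"
    using assms(1,3) by blast
  have q: "q0 \<and> q1 \<and> q2 \<and> q3 \<or> \<not> q0 \<and> q1 \<and> \<not> q2 \<and> \<not> q3 \<or>
      \<not> q0 \<and> \<not> q1 \<and> q2 \<and> \<not> q3 \<or> \<not> q0 \<and> \<not> q1 \<and> \<not> q2 \<and> q3 \<or>
      \<not> q0 \<and> \<not> q1 \<and> \<not> q2 \<and> \<not> q3"
    using assms(2,4) by blast
  from p q show ?thesis
    by (elim disjE conjE) simp_all
qed

lemma join_indicator:
  fixes f :: "'v \<Rightarrow> nat" and A B :: "'v set"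
  assumes "\<And>v. f v \<le> (3::nat)"
  defines "p \<equiv> \<lambda>a. \<forall>v\<in>A. allows a (f v)" and "q \<equiv> \<lambda>a. \<forall>v\<in>B. allows a (f v)"
  shows "[of_bool (p 0) + of_bool (q 0) + 2 * of_bool (p 0 \<and> q 0) +
    (\<Sum>a\<in>{1,2,3}. of_bool (p a \<and> q a) + 3 * (of_bool (p 0 \<and> q a) + of_bool (p a \<and> q 0))) =
    of_bool (\<forall>u\<in>A. \<forall>v\<in>B. compat (f u) (f v))] (mod (4::nat))"
proof -
  have z: "p 0 \<Longrightarrow> p a" "q 0 \<Longrightarrow> q a" for a
    by (auto simp: p_def q_def intro: allows_zero)
  have d: "p a \<Longrightarrow> p b \<Longrightarrow> p 0" "q a \<Longrightarrow> q b \<Longrightarrow> q 0" if "a \<noteq> b" "a \<noteq> 4" "b \<noteq> 4" for a b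
    unfolding p_def q_def using allows_distinct[OF _ _ that] by blast+
  have p: "p 0 \<longrightarrow> p 1 \<and> p 2 \<and> p 3" "p 1 \<and> p 2 \<or> p 1 \<and> p 3 \<or> p 2 \<and> p 3 \<longrightarrow> p 0"
    using z(1)[of 1] z(1)[of 2] z(1)[of 3] by blast (use d(1)[of 1 2] d(1)[of 1 3] d(1)[of 2 3] in auto)
  have q: "q 0 \<longrightarrow> q 1 \<and> q 2 \<and> q 3" "q 1 \<and> q 2 \<or> q 1 \<and> q 3 \<or> q 2 \<and> q 3 \<longrightarrow> q 0"
    using z(2)[of 1] z(2)[of 2] z(2)[of 3] by blast (use d(2)[of 1 2] d(2)[of 1 3] d(2)[of 2 3] in auto)
  have sum3: "(\<Sum>a\<in>{1,2,3}. g a) = g 1 + (g 2 + g 3)" for g :: "nat \<Rightarrow> nat"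
    by simp
  have "(of_bool b :: nat) mod 4 = of_bool b" for b
    by (cases b) auto
  moreover have "(\<forall>u\<in>A. \<forall>v\<in>B. compat (f u) (f v)) \<longleftrightarrow> p 0 \<or> q 0 \<or> p 1 \<and> q 1 \<or> p 2 \<and> q 2 \<or> p 3 \<and> q 3"
    unfolding p_def q_def by (rule compat_classes[OF assms(1)])
  ultimately show ?thesis
    unfolding sum3 cong_def
    using join_indicator_bool[OF p(1) q(1) p(2) q(2)] by (simp only:)
qed

text \<open>Each table entry consulted is a sum over a subset of the colourings before the join.
  After exchanging summations, \<open>f\<close> is counted \<open>?K f\<close> times, and modulo 4
  this multiplicity is the indicator that \<open>f\<close> respects the new edges.\<close>

lemma cong4_coloring_sum_Join:
  assumes "i \<noteq> j"
  shows "cong4 (join_sum (\<lambda>a b. coloring_sum x w t (s(i := a, j := b))) (s i) (s j))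
    (coloring_sum x w (Join i j t) s)"
proof -
  define p where "p f a \<longleftrightarrow> (\<forall>v\<in>label_class t i. allows a (f v))" for f :: "'a \<Rightarrow> nat" and a
  define q where "q f a \<longleftrightarrow> (\<forall>v\<in>label_class t j. allows a (f v))" for f :: "'a \<Rightarrow> nat" and a
  define W where "W f = coloring_weight x w (verts t) f" for f
  have sat: "p f (s i)" "q f (s j)" if "f \<in> colorings t s" for f
    using that by (auto simp: p_def q_def colorings_def)
  have meet: "p f (meet (s i) a) \<longleftrightarrow> p f a" "q f (meet (s j) a) \<longleftrightarrow> q f a"
    if "f \<in> colorings t s" "a \<in> {1,2,3}" for f a
    using sat[OF that(1)] that(2) by (auto simp: p_def q_def allows_meet)
  have upd: "coloring_sum x w t (s(i := a, j := b)) = (\<Sum>f\<in>colorings t s. of_bool (p f a \<and> q f b) * W f)"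
    if "\<And>c. allows a c \<Longrightarrow> allows (s i) c" "\<And>c. allows b c \<Longrightarrow> allows (s j) c" for a b
    using coloring_sum_upd[OF assms that] by (simp add: p_def q_def W_def)
  have m: "allows (meet s' a) c \<Longrightarrow> allows s' c" for s' a c
    by (auto simp: allows_def meet_def split: if_splits)
  have e0: "coloring_sum x w t (s(i := 0, j := s j)) = (\<Sum>f\<in>colorings t s. of_bool (p f 0) * W f)"
    "coloring_sum x w t (s(i := s i, j := 0)) = (\<Sum>f\<in>colorings t s. of_bool (q f 0) * W f)"
    "coloring_sum x w t (s(i := 0, j := 0)) = (\<Sum>f\<in>colorings t s. of_bool (p f 0 \<and> q f 0) * W f)"
    by (subst upd; auto intro: allows_zero intro!: sum.cong simp: sat)+
  have e: "coloring_sum x w t (s(i := meet (s i) a, j := meet (s j) a)) =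
       (\<Sum>f\<in>colorings t s. of_bool (p f a \<and> q f a) * W f)"
    "coloring_sum x w t (s(i := 0, j := meet (s j) a)) =
       (\<Sum>f\<in>colorings t s. of_bool (p f 0 \<and> q f a) * W f)"
    "coloring_sum x w t (s(i := meet (s i) a, j := 0)) =
       (\<Sum>f\<in>colorings t s. of_bool (p f a \<and> q f 0) * W f)"
    if "a \<in> {1,2,3}" for a
    by (subst upd; use that in \<open>auto intro: allows_zero m intro!: sum.cong simp: meet\<close>)+
  let ?K = "\<lambda>f. of_bool (p f 0) + of_bool (q f 0) + 2 * of_bool (p f 0 \<and> q f 0) +
    (\<Sum>a\<in>{1,2,3}. of_bool (p f a \<and> q f a) + 3 * (of_bool (p f 0 \<and> q f a) + of_bool (p f a \<and> q f 0))) :: nat"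
  have "join_sum (\<lambda>a b. coloring_sum x w t (s(i := a, j := b))) (s i) (s j) =
      (\<Sum>f\<in>colorings t s. of_nat (?K f) * W f)"
  proof -
    have "join_sum (\<lambda>a b. coloring_sum x w t (s(i := a, j := b))) (s i) (s j) =
      (\<Sum>f\<in>colorings t s. of_bool (p f 0) * W f) + (\<Sum>f\<in>colorings t s. of_bool (q f 0) * W f) +
      2 * (\<Sum>f\<in>colorings t s. of_bool (p f 0 \<and> q f 0) * W f) +
      (\<Sum>a\<in>{1,2,3}. (\<Sum>f\<in>colorings t s. of_bool (p f a \<and> q f a) * W f) +
        3 * ((\<Sum>f\<in>colorings t s. of_bool (p f 0 \<and> q f a) * W f) +
        (\<Sum>f\<in>colorings t s. of_bool (p f a \<and> q f 0) * W f)))"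
      unfolding join_sum_def e0 by (simp only: e cong: sum.cong)
    also have "\<dots> = (\<Sum>f\<in>colorings t s. of_bool (p f 0) * W f + of_bool (q f 0) * W f +
      2 * (of_bool (p f 0 \<and> q f 0) * W f) +
      (\<Sum>a\<in>{1,2,3}. of_bool (p f a \<and> q f a) * W f +
        3 * (of_bool (p f 0 \<and> q f a) * W f + of_bool (p f a \<and> q f 0) * W f)))"
      unfolding sum.distrib sum_distrib_left sum.swap[of _ "{1,2,3}"] distrib_left by simp
    also have "\<dots> = (\<Sum>f\<in>colorings t s. of_nat (?K f) * W f)"
      by (intro sum.cong refl) (simp only: of_nat_add of_nat_mult of_nat_sum of_nat_of_bool of_nat_numeral
        distrib_right sum_distrib_right distrib_left mult.assoc)
    finally show ?thesis .
  qed
  moreover have "cong4 (\<Sum>f\<in>colorings t s. of_nat (?K f) * W f)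
      (\<Sum>f\<in>colorings t s. of_nat (of_bool (\<forall>u\<in>label_class t i. \<forall>v\<in>label_class t j. compat (f u) (f v))) * W f)"
    unfolding p_def q_def
    by (intro cong4_sum cong4_mult cong4_of_nat cong4_refl join_indicator) (auto simp: colorings_def)
  moreover have "(\<Sum>f\<in>colorings t s. of_nat (of_bool (\<forall>u\<in>label_class t i. \<forall>v\<in>label_class t j. compat (f u) (f v))) * W f)
     = coloring_sum x w (Join i j t) s"
    unfolding coloring_sum_def colorings_Join
    by (simp add: sum_filter_of_bool W_def)
  ultimately show ?thesis by simp
qed

text \<open>Only the join uses the modulus; the other three recurrences are exact.\<close>

lemma cong4_dp:
  assumes "k_expression k t"
  shows "cong4 (dp x w t s) (coloring_sum x w t s)"
  using assms
proof (induction t arbitrary: s)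
  case (Introduce l v)
  then show ?case by (simp add: coloring_sum_Introduce del: dp.simps)
next
  case (DUnion t u)
  then show ?case by (simp add: coloring_sum_DUnion cong4_mult)
next
  case (Relabel i j t)
  then show ?case by (simp add: coloring_sum_def colorings_Relabel)
next
  case (Join i j t)
  then have "cong4 (dp x w (Join i j t) s)
      (join_sum (\<lambda>a b. coloring_sum x w t (s(i := a, j := b))) (s i) (s j))"
    by (auto intro: cong4_join_sum)
  moreover have "i \<noteq> j" using Join.prems by simp
  ultimately show ?case
    using cong4_coloring_sum_Join cong4_trans by blast
qed

text \<open>Evaluation is a semiring homomorphism and the recurrence uses semiring operations only.
  So the number computed by the program is a value of the polynomial analysed in the proof.\<close>

lemma poly_dp: "poly (dp x w t s) y = dp (poly x y) w t s"
proof (induction t arbitrary: s)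
  case (Introduce l v)
  have "poly (of_bool (allows (s l) a) * color_weight (x ^ w v) a) y =
      of_bool (allows (s l) a) * color_weight (poly x y ^ w v) a" for a
    by (simp add: color_weight_def of_bool_def)
  then show ?case by (simp only: dp.simps poly_sum)
qed (simp_all add: join_sum_def)

subsection \<open>Consistent cuts\<close>

definition cuts :: "'v set set \<Rightarrow> 'v set \<Rightarrow> 'v set set" where
  "cuts E X = {L. L \<subseteq> X \<and> (\<forall>u\<in>L. \<forall>v\<in>X - L. {u, v} \<notin> E)}"

lemma finite_cuts: "finite X \<Longrightarrow> finite (cuts E X)"
  by (rule finite_subset[of _ "Pow X"]) (auto simp: cuts_def)

text \<open>No edge of \<open>E\<close> joins the component \<open>C\<close> of \<open>v\<close> to
  the rest of \<open>X\<close>, and a consistent cut keeps \<open>C\<close> on one side. Hence a cut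
  is a free choice of that side together with a cut of the remainder.\<close>

lemma card_cuts_component:
  fixes v :: 'v and E :: "'v set set"
  assumes "finite X" "v \<in> X"
  defines "C \<equiv> {u. (v, u) \<in> {(x, y). {x, y} \<in> induced_edges E X}\<^sup>*}"
  shows "card (cuts E X) = 2 * card (cuts E (X - C))"
proof -
  let ?R = "{(x, y). {x, y} \<in> induced_edges E X}"
  have vC: "v \<in> C" by (simp add: C_def)
  have C: "C \<subseteq> X"
  proof
    fix u assume "u \<in> C"
    then have "(v, u) \<in> ?R\<^sup>*" by (simp add: C_def)
    then show "u \<in> X" by (induction) (auto simp: assms(2) induced_edges_def)
  qed
  have closed: "{a, b} \<notin> E" if "a \<in> C" "b \<in> X - C" for a b
  proof
    assume "{a, b} \<in> E"
    then have "(a, b) \<in> ?R" using that C by (auto simp: induced_edges_def)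
    then have "b \<in> C" using that(1) unfolding C_def by (auto intro: rtrancl_into_rtrancl)
    then show False using that by simp
  qed
  have closed': "{b, a} \<notin> E" if "a \<in> C" "b \<in> X - C" for a b
    using closed[OF that] by (simp add: insert_commute)
  have uni: "C \<subseteq> L \<and> v \<in> L \<or> C \<inter> L = {} \<and> v \<notin> L" if L: "L \<in> cuts E X" for L
  proof -
    have "u \<in> L \<longleftrightarrow> v \<in> L" if "u \<in> C" for u
    proof -
      have "(v, u) \<in> ?R\<^sup>*" using that by (simp add: C_def)
      then show ?thesis
      proof induction
        case (step y z)
        then have "{y, z} \<in> E" "y \<in> X" "z \<in> X" by (auto simp: induced_edges_def)
        moreover from this have "{z, y} \<in> E" by (simp add: insert_commute)
        ultimately have "y \<in> L \<longleftrightarrow> z \<in> L" using L by (auto simp: cuts_def)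
        with step show ?case by simp
      qed simp
    qed
    then show ?thesis using vC by blast
  qed
  have "bij_betw (\<lambda>L. (v \<in> L, L - C)) (cuts E X) (UNIV \<times> cuts E (X - C))"
  proof (rule bij_betw_byWitness[where f' = "\<lambda>(b, L). if b then L \<union> C else L"])
    show "\<forall>L\<in>cuts E X. (case (v \<in> L, L - C) of (b, L) \<Rightarrow> if b then L \<union> C else L) = L"
    proof
      fix L assume "L \<in> cuts E X"
      from uni[OF this] show "(case (v \<in> L, L - C) of (b, L) \<Rightarrow> if b then L \<union> C else L) = L"
        by auto
    qed
    show "\<forall>z\<in>UNIV \<times> cuts E (X - C).
        (v \<in> (case z of (b, L) \<Rightarrow> if b then L \<union> C else L),
         (case z of (b, L) \<Rightarrow> if b then L \<union> C else L) - C) = z"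
      using vC by (auto simp: cuts_def)
    show "(\<lambda>L. (v \<in> L, L - C)) ` cuts E X \<subseteq> UNIV \<times> cuts E (X - C)"
    proof (intro image_subsetI SigmaI UNIV_I)
      fix L assume "L \<in> cuts E X"
      then show "L - C \<in> cuts E (X - C)" by (auto simp: cuts_def)
    qed
    show "(\<lambda>(b, L). if b then L \<union> C else L) ` (UNIV \<times> cuts E (X - C)) \<subseteq> cuts E X"
    proof (intro image_subsetI)
      fix z assume "z \<in> (UNIV :: bool set) \<times> cuts E (X - C)"
      then obtain b L where z: "z = (b, L)" "L \<in> cuts E (X - C)" by auto
      have "L \<union> C \<in> cuts E X" "L \<in> cuts E X"
        using z(2) C closed closed' unfolding cuts_def by blast+
      then show "(case z of (b, L) \<Rightarrow> if b then L \<union> C else L) \<in> cuts E X"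
        using z by simp
    qed
  qed
  from bij_betw_same_card[OF this] show ?thesis
    by (simp add: card_cartesian_product)
qed

lemma cuts_empty: "cuts E {} = {{}}"
  by (auto simp: cuts_def)

text \<open>Splitting off one component gives a factor 2. If \<open>X\<close> is connected, the
  remainder is empty and has one cut; otherwise a second component supplies another factor
  2.\<close>

lemma card_cuts_mod_4:
  assumes "finite X" "X \<noteq> {}"
  shows "[card (cuts E X) = 2 * of_bool (connected_graph X (induced_edges E X))] (mod 4)"
proof -
  define C where "C v = {u. (v, u) \<in> {(x, y). {x, y} \<in> induced_edges E X}\<^sup>*}" for v
  have C: "card (cuts E X) = 2 * card (cuts E (X - C v))" if "v \<in> X" for v
    using card_cuts_component[OF assms(1) that] by (simp add: C_def)
  show ?thesis
  proof (cases "connected_graph X (induced_edges E X)")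
    case True
    obtain v where "v \<in> X" using assms by auto
    then have "X - C v = {}" using True by (auto simp: connected_graph_def C_def)
    with C[OF \<open>v \<in> X\<close>] True show ?thesis by (simp only: cuts_empty) simp
  next
    case False
    then obtain u v where uv: "u \<in> X" "v \<in> X" "v \<notin> C u"
      using assms by (auto simp: connected_graph_def C_def)
    then have "even (card (cuts E (X - C u)))"
      using card_cuts_component[of "X - C u" v E] assms by auto
    with C[OF uv(1)] False show ?thesis by (auto simp: cong_def elim!: evenE)
  qed
qed

text \<open>The binomial theorem, as the expansion of a product of factors \<open>3 + 1\<close> over
  \<open>A\<close>.\<close>

lemma sum_Pow_power_card:
  assumes "finite A"
  shows "(\<Sum>Y\<in>Pow A. 3 ^ card Y) = (4 :: 'a::comm_semiring_1) ^ card A"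
  using prod_add[OF assms, of "\<lambda>_. 3" "\<lambda>_. 1 :: 'a"] by simp

text \<open>With every colour allowed, a colouring amounts to a triple: the set \<open>X\<close> of
  colours 1 and 2, its part \<open>L\<close> of colour 1, and the set \<open>Y\<close> of colour 3.
  Compatibility says that \<open>L\<close> is a consistent cut and that \<open>Y\<close> avoids the
  closed neighbourhood of \<open>X\<close>; summing \<open>3 ^ card Y\<close> over all such
  \<open>Y\<close> yields the power of 4.\<close>

lemma coloring_sum_cuts:
  fixes x :: "'a::comm_semiring_1"
  assumes "\<And>l. label_class t l \<noteq> {} \<Longrightarrow> s l = 4"
  defines "V \<equiv> verts t" and "E \<equiv> edges t"
  shows "coloring_sum x w t s = (\<Sum>X\<in>Pow V. x ^ sum w X *
    (of_nat (card (cuts E X)) * 4 ^ card (V - closed_neighborhood E X)))"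
proof -
  have fV: "finite V" by (simp add: V_def)
  have ev: "{a, b} \<in> E \<Longrightarrow> a \<in> V \<and> b \<in> V" for a b
    using edges_subset[of "{a, b}" t] by (auto simp: V_def E_def)
  have al: "allows (s l) c" if "v \<in> label_class t l" for v l c
    using assms(1)[of l] that by (auto simp: allows_def)
  have col: "colorings t s = {f. (\<forall>v. v \<notin> V \<longrightarrow> f v = 0) \<and> (\<forall>v. f v \<le> 3) \<and>
     (\<forall>u v. {u, v} \<in> E \<longrightarrow> compat (f u) (f v))}"
    using al by (auto simp: colorings_def V_def E_def)
  let ?T = "SIGMA X:Pow V. cuts E X \<times> Pow (V - closed_neighborhood E X)"
  let ?i = "\<lambda>(X, L, Y) v. if v \<in> L then 1 else if v \<in> X then 2 else if v \<in> Y then 3 else (0::nat)"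
  let ?j = "\<lambda>f. ({v. f v = 1 \<or> f v = 2}, {v. f v = (1::nat)}, {v. f v = 3})"
  have "coloring_sum x w t s = (\<Sum>(X, L, Y)\<in>?T. x ^ sum w X * 3 ^ card Y)"
    unfolding coloring_sum_def
  proof (rule sum.reindex_bij_witness[where i = ?i and j = ?j])
    fix f assume "f \<in> colorings t s"
    then have p: "\<And>v. v \<notin> V \<Longrightarrow> f v = 0" "\<And>v. f v \<le> 3"
       "\<And>u v. {u, v} \<in> E \<Longrightarrow> compat (f u) (f v)" by (auto simp: col)
    have c: "f v \<in> {0,1,2,3}" for v using p(2)[of v] by auto
    show "?i (?j f) = f" using c by (auto simp: fun_eq_iff)
    have V: "f v \<noteq> 0 \<Longrightarrow> v \<in> V" for v using p(1)[of v] by metis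
    have "{v. f v = 1} \<in> cuts E {v. f v = 1 \<or> f v = 2}"
      using p(3) by (force simp: cuts_def compat_def)
    moreover have "{v. f v = 3} \<subseteq> V - closed_neighborhood E {v. f v = 1 \<or> f v = 2}"
      using p(3) V by (force simp: closed_neighborhood_def compat_def)
    ultimately show "?j f \<in> ?T"
      using V by auto
    have "coloring_weight x w V f = (\<Prod>v\<in>V. (if f v = 1 \<or> f v = 2 then x ^ w v else 1) * (if f v = 3 then 3 else 1))"
      unfolding coloring_weight_def
    proof (intro prod.cong refl)
      fix v
      show "color_weight (x ^ w v) (f v) = (if f v = 1 \<or> f v = 2 then x ^ w v else 1) * (if f v = 3 then 3 else 1)"
        using c[of v] by (elim insertE) (simp_all add: color_weight_def)
    qed
    also have "\<dots> = (\<Prod>v\<in>V. (if f v = 1 \<or> f v = 2 then x ^ w v else 1)) * (\<Prod>v\<in>V. (if f v = 3 then 3 else 1))"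
      by (rule prod.distrib)
    also have "\<dots> = (\<Prod>v\<in>{v\<in>V. f v = 1 \<or> f v = 2}. x ^ w v) * (\<Prod>v\<in>{v\<in>V. f v = 3}. 3)"
      by (simp only: prod.inter_filter[OF fV])
    also have "{v\<in>V. f v = 1 \<or> f v = 2} = {v. f v = 1 \<or> f v = 2}" using V by auto
    also have "{v\<in>V. f v = 3} = {v. f v = 3}" using V by auto
    finally show "(case ?j f of (X, L, Y) \<Rightarrow> x ^ sum w X * 3 ^ card Y) = coloring_weight x w (verts t) f"
      by (simp add: V_def power_sum)
  next
    fix z assume "z \<in> ?T"
    then obtain X L Y where z: "z = (X, L, Y)" "X \<subseteq> V" "L \<in> cuts E X" "Y \<subseteq> V - closed_neighborhood E X"
      by auto
    have LX: "L \<subseteq> X" using z by (auto simp: cuts_def)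
    have YX: "Y \<inter> X = {}" using z by (auto simp: closed_neighborhood_def)
    show "?j (?i z) = z" using z LX YX by auto
    have sym: "{u, v} \<in> E \<Longrightarrow> {v, u} \<in> E" for u v by (simp add: insert_commute)
    have YE: "{u, v} \<notin> E" if "u \<in> X" "v \<in> Y" for u v
      using that z by (auto simp: closed_neighborhood_def)
    have LE: "{u, v} \<notin> E" if "u \<in> L" "v \<in> X - L" for u v
      using that z by (auto simp: cuts_def)
    have "compat (?i z u) (?i z v)" if "{u, v} \<in> E" for u v
      using that sym[OF that] YE LE LX unfolding z(1) compat_def
      by simp blast
    then show "?i z \<in> colorings t s"
      using z LX by (auto simp: col)
  qed
  also have "\<dots> = (\<Sum>X\<in>Pow V. \<Sum>(L, Y)\<in>cuts E X \<times> Pow (V - closed_neighborhood E X). x ^ sum w X * 3 ^ card Y)"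
    by (subst sum.Sigma) (auto intro!: finite_cuts simp: fV finite_subset[OF _ fV])
  also have "\<dots> = (\<Sum>X\<in>Pow V. x ^ sum w X *
    (of_nat (card (cuts E X)) * 4 ^ card (V - closed_neighborhood E X)))"
    by (simp add: sum.cartesian_product[symmetric] sum_distrib_left[symmetric] sum_Pow_power_card fV
      mult.assoc mult.left_commute)
  finally show ?thesis .
qed

lemma closed_neighborhood_subset:
  "X \<subseteq> verts t \<Longrightarrow> closed_neighborhood (edges t) X \<subseteq> verts t"
  using edges_subset[of _ t] by (auto simp: closed_neighborhood_def)

lemma coeff_dp_mod_4:
  assumes "k_expression k t" "\<And>l. label_class t l \<noteq> {} \<Longrightarrow> s l = 4"
  shows "[coeff (dp (monom 1 1) w t s) n =
    2 * card {X. connected_dominating_set (verts t) (edges t) X \<and> sum w X = n}] (mod 4)"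
proof -
  let ?V = "verts t" and ?E = "edges t" and ?x = "monom 1 1 :: nat poly"
  let ?S = "{X. connected_dominating_set ?V ?E X \<and> sum w X = n}"
  have Vne: "?V \<noteq> {}" by (induction t) auto
  have "[coeff (dp ?x w t s) n = coeff (coloring_sum ?x w t s) n] (mod 4)"
    using cong4_dp[OF assms(1)] by (simp add: cong4_def)
  also have "coeff (coloring_sum ?x w t s) n = (\<Sum>X\<in>Pow ?V. of_bool (sum w X = n) *
    (card (cuts ?E X) * 4 ^ card (?V - closed_neighborhood ?E X)))"
  proof -
    have "?x ^ m * (of_nat a * 4 ^ b) = monom (a * 4 ^ b) m" for m a b :: nat
    proof -
      have "of_nat a * 4 ^ b = (of_nat (a * 4 ^ b) :: nat poly)" by simp
      also have "\<dots> = monom (a * 4 ^ b) 0" by (simp only: of_nat_monom of_nat_id)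
      finally show ?thesis by (simp add: monom_power mult_monom)
    qed
    note * = this
    have "coloring_sum ?x w t s = (\<Sum>X\<in>Pow ?V. ?x ^ sum w X *
        (of_nat (card (cuts ?E X)) * 4 ^ card (?V - closed_neighborhood ?E X)))"
      by (rule coloring_sum_cuts) (rule assms(2))
    then show ?thesis
      by (simp only: * coeff_sum coeff_monom) (rule sum.cong, auto)
  qed
  also have "[\<dots> = (\<Sum>X\<in>Pow ?V. of_bool (sum w X = n) * (2 * of_bool (connected_dominating_set ?V ?E X) :: nat))] (mod 4)"
  proof (rule cong_sum, rule cong_mult[OF cong_refl])
    fix X assume X: "X \<in> Pow ?V"
    let ?c = "card (?V - closed_neighborhood ?E X)"
    show "[card (cuts ?E X) * 4 ^ ?c = 2 * of_bool (connected_dominating_set ?V ?E X)] (mod 4)"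
    proof (cases "closed_neighborhood ?E X = ?V")
      case True
      \<comment> \<open>The empty set has a single cut, which would spoil the factor 2; it dominates
        nothing, so it cannot occur here.\<close>
      then have "X \<noteq> {}" using Vne by (auto simp: closed_neighborhood_def)
      moreover have "finite X" using X finite_subset[of X ?V] by simp
      ultimately show ?thesis using card_cuts_mod_4[of X ?E] True X
        by (simp add: connected_dominating_set_def)
    next
      case False
      then have "?V - closed_neighborhood ?E X \<noteq> {}"
        using closed_neighborhood_subset[of X t] X by auto
      then have "?c > 0" by (simp add: card_gt_0_iff)
      then have "4 dvd card (cuts ?E X) * 4 ^ ?c" by (simp add: dvd_power)
      then show ?thesis using False by (simp add: connected_dominating_set_def cong_0_iff)
    qed
  qed
  also have "(\<Sum>X\<in>Pow ?V. of_bool (sum w X = n) * (2 * of_bool (connected_dominating_set ?V ?E X) :: nat)) =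
     (\<Sum>X\<in>Pow ?V. if connected_dominating_set ?V ?E X \<and> sum w X = n then 2 else (0 :: nat))"
    by (intro sum.cong) auto
  also have "\<dots> = 2 * card {X \<in> Pow ?V. connected_dominating_set ?V ?E X \<and> sum w X = n}"
    by (subst sum.inter_filter[symmetric]) auto
  also have "{X \<in> Pow ?V. connected_dominating_set ?V ?E X \<and> sum w X = n} = ?S"
    by (auto simp: connected_dominating_set_def)
  finally show ?thesis .
qed

subsection \<open>Digits and the isolation lemma\<close>

text \<open>Used in three bases: \<open>N\<close> for the random parts of the weights, 5 for the
  states of the labels, and \<open>P\<close> for the coefficients of an evaluated
  polynomial.\<close>

definition digit :: "nat \<Rightarrow> nat \<Rightarrow> nat \<Rightarrow> nat" where
  "digit N i Z = Z div N ^ i mod N"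

text \<open>Has the form in which the program computes table indices: remove the old digit, then add
  the new one.\<close>

definition set_digit :: "nat \<Rightarrow> nat \<Rightarrow> nat \<Rightarrow> nat \<Rightarrow> nat" where
  "set_digit N i a Z = Z - digit N i Z * N ^ i + a * N ^ i"

lemma digit_less: "0 < N \<Longrightarrow> digit N i Z < N"
  by (simp add: digit_def)

lemma digit_decomp: "Z = Z div N ^ Suc i * N ^ Suc i + digit N i Z * N ^ i + Z mod N ^ i"
proof -
  have "Z = Z div N ^ i * N ^ i + Z mod N ^ i" by (rule div_mult_mod_eq[symmetric])
  also have "Z div N ^ i = Z div N ^ i div N * N + digit N i Z" by (simp add: digit_def)
  also have "Z div N ^ i div N = Z div N ^ Suc i" by (simp only: power_Suc2 div_mult2_eq)
  finally show ?thesis by (simp add: algebra_simps)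
qed

lemma set_digit_decomp: "set_digit N i a Z = (Z div N ^ Suc i * N + a) * N ^ i + Z mod N ^ i"
proof -
  have "Z - digit N i Z * N ^ i = Z div N ^ Suc i * N ^ Suc i + Z mod N ^ i"
    by (subst (1) digit_decomp[of Z N i]) simp
  then show ?thesis by (simp add: set_digit_def algebra_simps)
qed

lemma digit_low: "j < i \<Longrightarrow> digit N j (Z mod N ^ i) = digit N j Z"
proof -
  assume "j < i"
  then obtain d where d: "i = j + Suc d" using less_iff_Suc_add by auto
  have "Z mod (M * K) div M = Z div M mod K" for M K
    by (cases "M = 0") (simp_all add: mod_mult2_eq)
  then have "Z mod N ^ i div N ^ j = Z div N ^ j mod N ^ Suc d"
    by (simp only: d power_add)
  then show ?thesis
    by (simp add: digit_def mod_mod_cancel)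
qed

lemma digit_high: "i < j \<Longrightarrow> digit N j Z = digit N (j - Suc i) (Z div N ^ Suc i)"
  by (simp add: digit_def div_mult2_eq[symmetric] power_add[symmetric] flip: power_Suc)

lemma set_digit_div:
  assumes "0 < N" "a < N"
  shows "set_digit N i a Z div N ^ i = Z div N ^ Suc i * N + a" "set_digit N i a Z div N ^ Suc i = Z div N ^ Suc i"
    and "set_digit N i a Z mod N ^ i = Z mod N ^ i"
proof -
  have l: "Z mod N ^ i < N ^ i" using assms by simp
  show 1: "set_digit N i a Z div N ^ i = Z div N ^ Suc i * N + a"
  proof -
    have "(c * M + r) div M = c" if "r < M" for c r M :: nat
      using that by simp
    from this[OF l] show ?thesis by (simp only: set_digit_decomp)
  qed
  have "set_digit N i a Z div N ^ Suc i = set_digit N i a Z div N ^ i div N"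
    by (simp only: power_Suc2 div_mult2_eq)
  then show "set_digit N i a Z div N ^ Suc i = Z div N ^ Suc i"
    unfolding 1 using assms by simp
  show "set_digit N i a Z mod N ^ i = Z mod N ^ i"
    by (simp add: set_digit_decomp)
qed

lemma digit_set_digit:
  assumes "0 < N" "a < N"
  shows "digit N j (set_digit N i a Z) = (if j = i then a else digit N j Z)"
proof -
  consider "j = i" | "j < i" | "i < j" by linarith
  then show ?thesis
  proof cases
    case 1
    then show ?thesis using set_digit_div(1)[OF assms] assms by (simp add: digit_def)
  next
    case 2
    then show ?thesis
      using digit_low[OF 2, of N "set_digit N i a Z"] digit_low[OF 2, of N Z] set_digit_div(3)[OF assms] by simp
  next
    case 3
    then show ?thesis
      using digit_high[OF 3, of N "set_digit N i a Z"] digit_high[OF 3, of N Z] set_digit_div(2)[OF assms] by simp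
  qed
qed

lemma set_digit_same: "set_digit N i (digit N i Z) Z = Z"
  using digit_decomp[of Z N i] by (simp add: set_digit_def)

lemma set_digit_set_digit:
  assumes "0 < N" "a < N"
  shows "set_digit N i b (set_digit N i a Z) = set_digit N i b Z"
  unfolding set_digit_decomp[of N i b] set_digit_div(2,3)[OF assms] ..

lemma set_digit_mono: "a \<le> digit N i Z \<Longrightarrow> set_digit N i a Z \<le> Z"
proof -
  assume "a \<le> digit N i Z"
  then have "a * N ^ i \<le> digit N i Z * N ^ i" by (rule mult_le_mono1)
  moreover have "digit N i Z * N ^ i \<le> Z"
    by (subst (2) digit_decomp[of Z N i]) linarith
  ultimately show ?thesis unfolding set_digit_def by linarith
qed

lemma set_digit_less:
  assumes "0 < N" "a < N" "Z < N ^ n" "i < n"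
  shows "set_digit N i a Z < N ^ n"
proof -
  have "N ^ n = N ^ (n - i) * N ^ i" using assms by (simp flip: power_add)
  moreover have "N ^ (n - i) = N ^ (n - Suc i) * N"
    using assms by (metis Suc_diff_Suc power_Suc2)
  ultimately have n: "N ^ n = N ^ (n - Suc i) * N ^ Suc i" by simp
  have "set_digit N i a Z div N ^ Suc i < N ^ (n - Suc i)"
    unfolding set_digit_div(2)[OF assms(1,2)]
    using assms(3) by (simp add: n less_mult_imp_div_less)
  then show ?thesis
    unfolding n using assms(1) by (simp add: div_less_iff_less_mult)
qed

section \<open>Isolation of the minimum weight set, by counting random numbers\<close>

definition min_weight :: "('v \<Rightarrow> nat) \<Rightarrow> 'v set set \<Rightarrow> 'v set \<Rightarrow> bool" where
  "min_weight w F X \<longleftrightarrow> X \<in> F \<and> (\<forall>Y\<in>F. sum w X \<le> sum w Y)"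

text \<open>Once all digits but that of \<open>v\<close> are fixed, at most one value of this digit
  lets minimum sets with and without \<open>v\<close> coexist. Hence overwriting the digit by an
  arbitrary \<open>c < N\<close> is injective on the pairs of \<open>c\<close> and a bad
  \<open>Z\<close>, which gives the factor \<open>N\<close>.\<close>

lemma isolation_vertex:
  fixes a \<rho> :: "'v \<Rightarrow> nat"
  assumes "finite V" "F \<subseteq> Pow V" "inj_on \<rho> V" "\<rho> ` V \<subseteq> {..<n}" "0 < N" "v \<in> V"
  defines "w \<equiv> \<lambda>Z u. a u + digit N (\<rho> u) Z"
  shows "N * card {Z\<in>{..<N ^ n}. \<exists>X Y. min_weight (w Z) F X \<and> min_weight (w Z) F Y \<and> v \<in> X \<and> v \<notin> Y} \<le> N ^ n"
    (is "N * card ?B \<le> _")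
proof -
  let ?f = "\<lambda>(c, Z). set_digit N (\<rho> v) c Z"
  have le: "digit N (\<rho> v) Z' \<le> digit N (\<rho> v) Z"
    if B: "Z \<in> ?B" "Z' \<in> ?B" and c: "c < N" "c' < N" and eq: "set_digit N (\<rho> v) c Z = set_digit N (\<rho> v) c' Z'"
    for c c' Z Z'
  proof (rule ccontr)
    assume less: "\<not> digit N (\<rho> v) Z' \<le> digit N (\<rho> v) Z"
    obtain X Y where XY: "min_weight (w Z) F X" "min_weight (w Z) F Y" "v \<in> X" "v \<notin> Y"
      using B(1) by auto
    obtain X' Y' where XY': "min_weight (w Z') F X'" "min_weight (w Z') F Y'" "v \<in> X'" "v \<notin> Y'"
      using B(2) by auto
    have same: "w Z u = w Z' u" if "u \<in> V" "u \<noteq> v" for u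
    proof -
      have "\<rho> u \<noteq> \<rho> v" using that assms(3,6) by (auto dest: inj_onD)
      then have "digit N (\<rho> u) Z = digit N (\<rho> u) Z'"
        using digit_set_digit[OF assms(5) c(1), of "\<rho> u" "\<rho> v" Z]
          digit_set_digit[OF assms(5) c(2), of "\<rho> u" "\<rho> v" Z'] eq by simp
      then show ?thesis by (simp add: w_def)
    qed
    have F: "U \<subseteq> V" if "min_weight w' F U" for w' U
      using that assms(2) by (auto simp: min_weight_def)
    have fin: "finite U" if "min_weight w' F U" for w' U
      using F[OF that] assms(1) finite_subset by blast
    have "sum (w Z) Y' = sum (w Z') Y'"
      using F[OF XY'(2)] XY'(4) by (intro sum.cong refl same) auto
    \<comment> \<open>Passing from \<open>Z\<close> to \<open>Z'\<close> makes \<open>X'\<close>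
      strictly heavier and leaves \<open>Y\<close> unchanged. As \<open>X'\<close> is minimal for
      \<open>Z'\<close>, it would be strictly lighter than \<open>Y\<close> under \<open>Z\<close>,
      although \<open>Y\<close> is minimal there.\<close>
    moreover have "sum (w Z) X' < sum (w Z') X'"
    proof (rule sum_strict_mono_ex1)
      show "\<forall>u\<in>X'. w Z u \<le> w Z' u"
        using same F[OF XY'(1)] less by (metis (no_types, lifting) le_eq_less_or_eq nat_le_linear
            nat_add_left_cancel_le subset_iff w_def)
      show "\<exists>u\<in>X'. w Z u < w Z' u"
        using XY'(3) less by (auto simp: w_def intro!: bexI[of _ v])
    qed (rule fin[OF XY'(1)])
    moreover have "sum (w Z') X' \<le> sum (w Z') Y"
      using XY' XY by (auto simp: min_weight_def)
    moreover have "sum (w Z) Y = sum (w Z') Y"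
      using F[OF XY(2)] XY(4) by (intro sum.cong refl same) auto
    moreover have "sum (w Z) Y \<le> sum (w Z) X'"
      using XY XY' by (auto simp: min_weight_def)
    ultimately show False by simp
  qed
  have "inj_on ?f ({..<N} \<times> ?B)"
  proof (rule inj_onI)
    fix z z' assume z: "z \<in> {..<N} \<times> ?B" "z' \<in> {..<N} \<times> ?B" "?f z = ?f z'"
    obtain c Z c' Z' where zz: "z = (c, Z)" "z' = (c', Z')" by (metis surj_pair)
    have h: "c < N" "c' < N" "set_digit N (\<rho> v) c Z = set_digit N (\<rho> v) c' Z'"
      and B: "Z \<in> ?B" "Z' \<in> ?B"
      using z unfolding zz by auto
    have "digit N (\<rho> v) Z = digit N (\<rho> v) Z'"
      using le[OF B h] le[OF B(2,1) h(2,1) h(3)[symmetric]] by simp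
    \<comment> \<open>Writing the common digit back recovers both numbers from the same overwritten
      one.\<close>
    then have "Z = Z'"
      using arg_cong[OF h(3), of "set_digit N (\<rho> v) (digit N (\<rho> v) Z)"]
      by (simp add: set_digit_set_digit[OF assms(5) h(1)] set_digit_set_digit[OF assms(5) h(2)] set_digit_same)
        (metis set_digit_same)
    moreover have "c = c'"
      using arg_cong[OF h(3), of "digit N (\<rho> v)"] digit_set_digit[OF assms(5) h(1)] digit_set_digit[OF assms(5) h(2)]
      by simp
    ultimately show "z = z'" by (simp add: zz)
  qed
  moreover have "?f ` ({..<N} \<times> ?B) \<subseteq> {..<N ^ n}"
    using assms(4-6) by (auto intro!: set_digit_less)
  ultimately have "card ({..<N} \<times> ?B) \<le> card {..<N ^ n}"
    by (rule card_inj_on_le) simp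
  then show ?thesis by (simp add: card_cartesian_product)
qed

text \<open>Union bound: two distinct minimum sets differ in a vertex that belongs to exactly one of
  them.\<close>

lemma isolation:
  fixes a \<rho> :: "'v \<Rightarrow> nat"
  assumes "finite V" "F \<subseteq> Pow V" "inj_on \<rho> V" "\<rho> ` V \<subseteq> {..<n}" "0 < N"
  defines "w \<equiv> \<lambda>Z u. a u + digit N (\<rho> u) Z"
  shows "N * card {Z\<in>{..<N ^ n}. \<exists>X Y. min_weight (w Z) F X \<and> min_weight (w Z) F Y \<and> X \<noteq> Y} \<le> card V * N ^ n"
    (is "N * card ?B \<le> _")
proof -
  let ?Bv = "\<lambda>v. {Z\<in>{..<N ^ n}. \<exists>X Y. min_weight (w Z) F X \<and> min_weight (w Z) F Y \<and> v \<in> X \<and> v \<notin> Y}"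
  have "?B \<subseteq> (\<Union>v\<in>V. ?Bv v)"
  proof
    fix Z assume "Z \<in> ?B"
    then obtain X Y where Z: "Z < N ^ n" "min_weight (w Z) F X" "min_weight (w Z) F Y" "X \<noteq> Y"
      by auto
    then have "X \<subseteq> V" "Y \<subseteq> V" using assms(2) by (auto simp: min_weight_def)
    with Z(4) obtain v where "v \<in> V" "v \<in> X \<and> v \<notin> Y \<or> v \<in> Y \<and> v \<notin> X" by blast
    then show "Z \<in> (\<Union>v\<in>V. ?Bv v)" using Z by blast
  qed
  then have "card ?B \<le> card (\<Union>v\<in>V. ?Bv v)"
    by (rule card_mono[rotated]) (use assms in auto)
  also have "\<dots> \<le> (\<Sum>v\<in>V. card (?Bv v))"
    by (rule card_UN_le) (rule assms)
  finally have "N * card ?B \<le> (\<Sum>v\<in>V. N * card (?Bv v))"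
    by (simp flip: sum_distrib_left)
  also have "\<dots> \<le> (\<Sum>v\<in>V. N ^ n)"
    unfolding w_def by (rule sum_mono, rule isolation_vertex) (use assms in auto)
  finally show ?thesis by simp
qed

text \<open>Kronecker substitution: if the base exceeds all coefficients, evaluation writes them
  side by side and they can be read off as digits.\<close>

lemma digit_poly:
  fixes p :: "nat poly"
  assumes "\<And>i. coeff p i < N"
  shows "digit N i (poly p N) = coeff p i"
  using assms
proof (induction p arbitrary: i)
  case 0
  then show ?case by (simp add: digit_def)
next
  case (pCons a p)
  have a: "a < N" using pCons.prems[of 0] by simp
  have p: "coeff p i < N" for i using pCons.prems[of "Suc i"] by simp
  have y: "(a + N * poly p N) div N = poly p N" using a by simp
  show ?case
  proof (cases i)
    case 0
    then show ?thesis using a by (simp add: digit_def)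
  next
    case (Suc j)
    have "(a + N * poly p N) div N ^ Suc j = poly p N div N ^ j"
      using y by (simp add: div_mult2_eq)
    then show ?thesis using pCons.IH[OF p, of j] Suc by (simp add: digit_def)
  qed
qed

lemma coeff_le_poly_1: "coeff p i \<le> poly (p :: nat poly) 1"
  by (induction p arbitrary: i) (auto simp: coeff_pCons split: nat.split intro: trans_le_add2)

primrec node_count :: "'v cexp \<Rightarrow> nat" where
  "node_count (Introduce l v) = 1"
| "node_count (DUnion t u) = node_count t + node_count u + 1"
| "node_count (Relabel i j t) = node_count t + 1"
| "node_count (Join i j t) = node_count t + 1"

text \<open>25 is the sum of the coefficients in \<open>join_sum\<close>, namely
  \<open>1 + 1 + 2 + 3 * (1 + 3 * 2)\<close>.\<close>

lemma join_sum_le: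
  assumes "\<And>a b. f a b \<le> (B :: nat)"
  shows "join_sum f s t \<le> 25 * B"
proof -
  have "(\<Sum>a\<in>{1,2,3}. f (meet s a) (meet t a) + 3 * (f 0 (meet t a) + f (meet s a) 0)) \<le> (\<Sum>a\<in>{1,2,3::nat}. 7 * B)"
  proof (rule sum_mono)
    fix a :: nat
    have "x + 3 * (y + z) \<le> B + 3 * (B + B)" if "x \<le> B" "y \<le> B" "z \<le> B" for x y z
      using that by (intro add_mono mult_le_mono) auto
    then have "x + 3 * (y + z) \<le> 7 * B" if "x \<le> B" "y \<le> B" "z \<le> B" for x y z
      using that by fastforce
    then show "f (meet s a) (meet t a) + 3 * (f 0 (meet t a) + f (meet s a) 0) \<le> 7 * B"
      using assms by blast
  qed
  then show ?thesis
    using assms[of 0 t] assms[of s 0] assms[of 0 0] by (simp add: join_sum_def)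
qed

text \<open>A join costs a factor 25, an introduce node at most \<open>4 * 3 = 12\<close>. At
  \<open>x = 1\<close> this bounds the coefficients, at \<open>x = P\<close> the table
  entries.\<close>

lemma dp_le:
  assumes "k_expression k t" "1 \<le> x"
  shows "dp x w t s \<le> 25 ^ node_count t * (x :: nat) ^ sum w (verts t)"
  using assms(1)
proof (induction t arbitrary: s)
  case (Introduce l v)
  have x: "1 \<le> x ^ w v" using assms(2) by simp
  have "dp x w (Introduce l v) s \<le> (\<Sum>a\<in>{0..3::nat}. 3 * x ^ w v)"
    unfolding dp.simps
  proof (rule sum_mono)
    fix a show "of_bool (allows (s l) a) * color_weight (x ^ w v) a \<le> 3 * x ^ w v"
      using x by (auto simp: color_weight_def)
  qed
  then show ?case by simp
next
  case (DUnion t u)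
  then have "dp x w t s * dp x w u s \<le>
      (25 ^ node_count t * x ^ sum w (verts t)) * (25 ^ node_count u * x ^ sum w (verts u))"
    by (intro mult_le_mono) auto
  also have "\<dots> = 25 ^ (node_count t + node_count u) * x ^ sum w (verts t \<union> verts u)"
    using DUnion.prems by (simp add: sum.union_disjoint power_add)
  finally show ?case by simp
next
  case (Relabel i j t)
  then have "dp x w t (s(i := s j)) \<le> 25 ^ node_count t * x ^ sum w (verts t)" by auto
  then show ?case by simp
next
  case (Join i j t)
  then have "dp x w (Join i j t) s \<le> 25 * (25 ^ node_count t * x ^ sum w (verts t))"
    unfolding dp.simps by (intro join_sum_le) auto
  then show ?case by simp
qed

subsection \<open>Running programs\<close>

type_synonym state_pred = "(nat \<Rightarrow> nat) \<Rightarrow> (nat \<Rightarrow> nat) \<Rightarrow> (nat \<Rightarrow> nat) \<Rightarrow> bool"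

text \<open>The input \<open>xs\<close> is followed by 16 registers \<open>rs\<close>; behind them a map \<open>lb\<close> indexed by labels and the
  stack \<open>tb\<close> of tables are interleaved, as both are unbounded.\<close>

definition mem :: "nat list \<Rightarrow> (nat \<Rightarrow> nat) \<Rightarrow> (nat \<Rightarrow> nat) \<Rightarrow> (nat \<Rightarrow> nat) \<Rightarrow> memory" where
  "mem xs rs lb tb a =
     (if a = 0 then length xs else if a \<le> length xs then xs ! (a - 1)
      else let j = a - length xs - 1 in
        if j < 16 then rs j else if even j then lb ((j - 16) div 2) else tb ((j - 17) div 2))"

definition len_e :: aexp where
  "len_e = Mem (Const 0)"

definition reg_addr :: "nat \<Rightarrow> aexp" where
  "reg_addr c = Add (Mem (Const 0)) (Const (Suc c))"

definition lab_addr :: "aexp \<Rightarrow> aexp" where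
  "lab_addr e = Add (Mem (Const 0)) (Add (Const 17) (Mul (Const 2) e))"

definition tab_addr :: "aexp \<Rightarrow> aexp" where
  "tab_addr e = Add (Mem (Const 0)) (Add (Const 18) (Mul (Const 2) e))"

definition reg :: "nat \<Rightarrow> aexp" where
  "reg c = Mem (reg_addr c)"

definition lab :: "aexp \<Rightarrow> aexp" where
  "lab e = Mem (lab_addr e)"

definition tab :: "aexp \<Rightarrow> aexp" where
  "tab e = Mem (tab_addr e)"

definition inp :: "aexp \<Rightarrow> aexp" where
  "inp e = Mem e"

definition set_reg :: "nat \<Rightarrow> aexp \<Rightarrow> prog" where
  "set_reg c e = Assign (reg_addr c) e"

definition set_lab :: "aexp \<Rightarrow> aexp \<Rightarrow> prog" where
  "set_lab a e = Assign (lab_addr a) e"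

definition set_tab :: "aexp \<Rightarrow> aexp \<Rightarrow> prog" where
  "set_tab a e = Assign (tab_addr a) e"

lemma mem_0 [simp]: "mem xs rs lb tb 0 = length xs"
  by (simp add: mem_def)

lemma aval_len_e [simp]: "aval len_e (mem xs rs lb tb) = length xs"
  by (simp add: len_e_def)

lemma aval_addr:
  "aval (reg_addr c) (mem xs rs lb tb) = length xs + Suc c"
  "aval (lab_addr e) (mem xs rs lb tb) = length xs + 17 + 2 * aval e (mem xs rs lb tb)"
  "aval (tab_addr e) (mem xs rs lb tb) = length xs + 18 + 2 * aval e (mem xs rs lb tb)"
  by (simp_all add: reg_addr_def lab_addr_def tab_addr_def)

lemma aval_reg [simp]: "c < 16 \<Longrightarrow> aval (reg c) (mem xs rs lb tb) = rs c"
  unfolding reg_def aval.simps aval_addr by (simp add: mem_def)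

lemma aval_lab [simp]: "aval (lab e) (mem xs rs lb tb) = lb (aval e (mem xs rs lb tb))"
  unfolding lab_def aval.simps aval_addr by (simp add: mem_def)

lemma aval_tab [simp]: "aval (tab e) (mem xs rs lb tb) = tb (aval e (mem xs rs lb tb))"
  unfolding tab_def aval.simps aval_addr by (simp add: mem_def)

lemma aval_inp:
  "aval e (mem xs rs lb tb) = Suc i \<Longrightarrow> i < length xs \<Longrightarrow> aval (inp e) (mem xs rs lb tb) = xs ! i"
  by (simp add: inp_def mem_def)

lemma mem_high: "mem xs rs lb tb (Suc (length xs + j)) =
    (if j < 16 then rs j else if even j then lb ((j - 16) div 2) else tb ((j - 17) div 2))"
  by (simp add: mem_def)

lemma mem_low: "a \<le> length xs \<Longrightarrow> mem xs rs lb tb a = (if a = 0 then length xs else xs ! (a - 1))"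
  by (simp add: mem_def)

lemma mem_upd:
  "c < 16 \<Longrightarrow> (mem xs rs lb tb)(length xs + Suc c := v) = mem xs (rs(c := v)) lb tb"
  "(mem xs rs lb tb)(length xs + 17 + 2 * l := v) = mem xs rs (lb(l := v)) tb"
  "(mem xs rs lb tb)(length xs + 18 + 2 * i := v) = mem xs rs lb (tb(i := v))"
proof -
  have ext: "f = g" if "\<And>a. a \<le> length xs \<Longrightarrow> f a = g a" "\<And>j. f (Suc (length xs + j)) = g (Suc (length xs + j))"
    for f g :: memory
    using that by (metis less_iff_Suc_add linorder_not_le ext)
  show "(mem xs rs lb tb)(length xs + Suc c := v) = mem xs (rs(c := v)) lb tb" if "c < 16"
    using that by (intro ext) (auto simp: mem_high mem_low)
  show "(mem xs rs lb tb)(length xs + 17 + 2 * l := v) = mem xs rs (lb(l := v)) tb"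
  proof (rule ext)
    fix j
    show "((mem xs rs lb tb)(length xs + 17 + 2 * l := v)) (Suc (length xs + j)) =
      mem xs rs (lb(l := v)) tb (Suc (length xs + j))"
    proof (cases "j = 16 + 2 * l")
      case False
      then have "even j \<Longrightarrow> 16 \<le> j \<Longrightarrow> (j - 16) div 2 \<noteq> l"
        by (auto elim!: evenE)
      then show ?thesis using False by (simp add: mem_high)
    qed (simp only: mem_high fun_upd_apply, simp)
  qed (simp add: mem_low)
  show "(mem xs rs lb tb)(length xs + 18 + 2 * i := v) = mem xs rs lb (tb(i := v))"
  proof (rule ext)
    fix j
    show "((mem xs rs lb tb)(length xs + 18 + 2 * i := v)) (Suc (length xs + j)) =
      mem xs rs lb (tb(i := v)) (Suc (length xs + j))"
    proof (cases "j = 17 + 2 * i")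
      case False
      then have "odd j \<Longrightarrow> 16 \<le> j \<Longrightarrow> (j - 17) div 2 \<noteq> i"
        by (auto elim!: oddE)
      then show ?thesis using False by (simp add: mem_high)
    qed (simp only: mem_high fun_upd_apply, simp)
  qed (simp add: mem_low)
qed

lemma init_memory_mem: "init_memory xs = mem xs (\<lambda>_. 0) (\<lambda>_. 0) (\<lambda>_. 0)"
  by (auto simp: init_memory_def mem_def fun_eq_iff Let_def)

section \<open>Bit lengths and the cost of evaluating expressions\<close>

lemma size_nat_mono: "a \<le> b \<Longrightarrow> size_nat a \<le> size_nat b"
  by (simp add: size_nat_def floorlog_mono)

lemma size_nat_pos: "1 \<le> size_nat n"
  by (simp add: size_nat_def)

lemma size_nat_le_iff: "size_nat a \<le> Suc n \<longleftrightarrow> a < 2 ^ n"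
  by (simp add: size_nat_def floorlog_le_iff)

lemma less_two_power_size: "a < 2 ^ (size_nat a - 1)"
  using size_nat_le_iff[of a "size_nat a - 1"] size_nat_pos[of a] by simp

lemma size_nat_mult: "size_nat (a * b) \<le> size_nat a + size_nat b"
proof -
  have "a * b < 2 ^ (size_nat a - 1) * 2 ^ (size_nat b - 1)"
    by (intro mult_strict_mono less_two_power_size) auto
  also have "\<dots> \<le> 2 ^ (size_nat a + size_nat b - 1)"
    unfolding power_add[symmetric] by (intro power_increasing) auto
  finally show ?thesis
    using size_nat_le_iff[of "a * b" "size_nat a + size_nat b - 1"] size_nat_pos[of a] by simp
qed

lemma size_nat_add: "size_nat (a + b) \<le> size_nat a + size_nat b"
proof -
  let ?s = "size_nat a + size_nat b - 1"
  have "a < 2 ^ (size_nat a - 1)" "b < 2 ^ (size_nat b - 1)" by (rule less_two_power_size)+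
  moreover have "2 ^ (size_nat a - 1) \<le> (2::nat) ^ (?s - 1)" "2 ^ (size_nat b - 1) \<le> (2::nat) ^ (?s - 1)"
    using size_nat_pos[of a] size_nat_pos[of b] by (intro power_increasing; simp)+
  moreover have "(2::nat) ^ ?s = 2 * 2 ^ (?s - 1)"
    using size_nat_pos[of a] size_nat_pos[of b] by (cases ?s) auto
  ultimately have "a + b < 2 ^ ?s" by linarith
  then show ?thesis
    using size_nat_le_iff[of "a + b" ?s] size_nat_pos[of a] by simp
qed

text \<open>If every cell of the memory has size at most \<open>L\<close>, the value of an expression \<open>e\<close> has size
  at most \<open>esize e * L\<close>, and its evaluation costs at most \<open>ecost e * L\<^sup>2\<close>.\<close>

primrec esize :: "aexp \<Rightarrow> nat" where
  "esize (Const n) = size_nat n"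
| "esize (Mem a) = 1"
| "esize (Add a b) = esize a + esize b"
| "esize (Sub a b) = esize a"
| "esize (Mul a b) = esize a + esize b"
| "esize (Div a b) = esize a"
| "esize (Mod a b) = esize a"

primrec ecost :: "aexp \<Rightarrow> nat" where
  "ecost (Const n) = size_nat n"
| "ecost (Mem a) = ecost a + esize a + 1"
| "ecost (Add a b) = ecost a + ecost b + esize a + esize b"
| "ecost (Sub a b) = ecost a + ecost b + esize a + esize b"
| "ecost (Mul a b) = ecost a + ecost b + esize a * esize b"
| "ecost (Div a b) = ecost a + ecost b + esize a * esize b"
| "ecost (Mod a b) = ecost a + ecost b + esize a * esize b"

lemma size_aval:
  assumes "\<And>i. size_nat (m i) \<le> L"
  shows "size_nat (aval e m) \<le> esize e * L"
proof (induction e)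
  case (Const n)
  have "1 \<le> L" using assms[of 0] size_nat_pos[of "m 0"] by linarith
  then show ?case by simp
next
  case (Mem e)
  then show ?case using assms by simp
next
  case (Add a b)
  then show ?case using size_nat_add[of "aval a m" "aval b m"] by (simp add: add_mult_distrib)
next
  case (Sub a b)
  then show ?case using size_nat_mono[of "aval a m - aval b m" "aval a m"] by simp
next
  case (Mul a b)
  then show ?case using size_nat_mult[of "aval a m" "aval b m"] by (simp add: add_mult_distrib)
next
  case (Div a b)
  then show ?case using size_nat_mono[of "aval a m div aval b m" "aval a m"] by simp
next
  case (Mod a b)
  then show ?case using size_nat_mono[of "aval a m mod aval b m" "aval a m"] by simp
qed

lemma acost_le:
  assumes "\<And>i. size_nat (m i) \<le> L"
  shows "acost e m \<le> ecost e * L\<^sup>2"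
proof -
  have L: "1 \<le> L" using assms[of 0] size_nat_pos[of "m 0"] by linarith
  have LL: "L \<le> L\<^sup>2" using L by (simp add: power2_eq_square)
  have s: "size_nat (aval e m) \<le> esize e * L\<^sup>2" for e
    by (rule le_trans[OF size_aval[of m L e, OF assms] mult_le_mono2[OF LL]])
  have p: "size_nat (aval a m) * size_nat (aval b m) \<le> (esize a * esize b) * L\<^sup>2" for a b
    using mult_le_mono[OF size_aval[of m L a, OF assms] size_aval[of m L b, OF assms]]
    by (simp add: power2_eq_square ac_simps)
  have c: "size_nat n \<le> size_nat n * L\<^sup>2" for n
    using L by simp
  show ?thesis
  proof (induction e)
    case (Const n)
    then show ?case using c by simp
  next
    case (Mem e)
    moreover have "size_nat (m (aval e m)) \<le> L\<^sup>2"
      by (rule le_trans[OF assms LL])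
    ultimately show ?case using s[of e] by (simp add: add_mult_distrib)
  next
    case (Add a b)
    then show ?case using s[of a] s[of b] by (simp add: add_mult_distrib)
  next
    case (Sub a b)
    then show ?case using s[of a] s[of b] by (simp add: add_mult_distrib)
  next
    case (Mul a b)
    then show ?case using p[of a b] by (simp add: add_mult_distrib)
  next
    case (Div a b)
    then show ?case using p[of a b] by (simp add: add_mult_distrib)
  next
    case (Mod a b)
    then show ?case using p[of a b] by (simp add: add_mult_distrib)
  qed
qed

text \<open>The constant is generous: it has to cover the expressions of one fixed program. Together
  with the 90000 granted to an address it makes up the 100000 in \<open>C\<close>.\<close>

definition cheap :: "aexp \<Rightarrow> bool" where
  "cheap e \<longleftrightarrow> ecost e + esize e \<le> 10000"

lemma ecost_addr:
  "c < 16 \<Longrightarrow> ecost (reg_addr c) + esize (reg_addr c) \<le> 90000"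
  "cheap e \<Longrightarrow> ecost (lab_addr e) + esize (lab_addr e) \<le> 90000"
  "cheap e \<Longrightarrow> ecost (tab_addr e) + esize (tab_addr e) \<le> 90000"
proof -
  have c: "c < 16 \<Longrightarrow> size_nat (Suc c) \<le> 6" using size_nat_le_iff[of "Suc c" 5] by simp
  have n: "size_nat 0 = 1" "size_nat 2 = 3" "size_nat 17 = 6" "size_nat 18 = 6"
    by (simp_all add: size_nat_def compute_floorlog)
  show "c < 16 \<Longrightarrow> ecost (reg_addr c) + esize (reg_addr c) \<le> 90000"
    using c by (simp add: reg_addr_def n)
  show "cheap e \<Longrightarrow> ecost (lab_addr e) + esize (lab_addr e) \<le> 90000"
    "cheap e \<Longrightarrow> ecost (tab_addr e) + esize (tab_addr e) \<le> 90000"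
    by (simp_all add: lab_addr_def tab_addr_def cheap_def n)
qed

text \<open>\<open>B\<close> is to bound every memory cell throughout the run. Then an elementary
  step costs at most the fixed amount \<open>C\<close>, and running times become step
  counts.\<close>

locale machine =
  fixes xs :: "nat list" and B :: nat
  assumes input_le: "length xs \<le> B" "x \<in> set xs \<Longrightarrow> x \<le> B"
begin

definition C :: nat where
  "C = 100000 * (size_nat B)\<^sup>2"

definition ok :: state_pred where
  "ok rs lb tb \<longleftrightarrow> (\<forall>c. rs c \<le> B) \<and> (\<forall>l. lb l \<le> B) \<and> (\<forall>i. tb i \<le> B)"

lemma ok_upd:
  "ok rs lb tb \<Longrightarrow> v \<le> B \<Longrightarrow> ok (rs(c := v)) lb tb"
  "ok rs lb tb \<Longrightarrow> v \<le> B \<Longrightarrow> ok rs (lb(c := v)) tb"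
  "ok rs lb tb \<Longrightarrow> v \<le> B \<Longrightarrow> ok rs lb (tb(c := v))"
  by (simp_all add: ok_def)

lemma okD: "ok rs lb tb \<Longrightarrow> rs c \<le> B" "ok rs lb tb \<Longrightarrow> lb l \<le> B" "ok rs lb tb \<Longrightarrow> tb i \<le> B"
  by (simp_all add: ok_def)

lemma size_mem: "ok rs lb tb \<Longrightarrow> size_nat (mem xs rs lb tb a) \<le> size_nat B"
  by (rule size_nat_mono) (auto simp: ok_def mem_def Let_def intro: input_le)

lemma acost_ecost: "ok rs lb tb \<Longrightarrow> acost e (mem xs rs lb tb) \<le> ecost e * (size_nat B)\<^sup>2"
  by (rule acost_le) (rule size_mem)

lemma size_esize:
  assumes "ok rs lb tb"
  shows "size_nat (aval e (mem xs rs lb tb)) \<le> esize e * (size_nat B)\<^sup>2"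
proof -
  have "size_nat (aval e (mem xs rs lb tb)) \<le> esize e * size_nat B"
    by (rule size_aval) (rule size_mem[OF assms])
  also have "\<dots> \<le> esize e * (size_nat B)\<^sup>2"
    using size_nat_pos[of B] by (intro mult_le_mono2) (simp add: power2_eq_square)
  finally show ?thesis .
qed

lemma acost_cheap:
  assumes "ok rs lb tb" "cheap e"
  shows "acost e (mem xs rs lb tb) \<le> C"
proof -
  have "ecost e * (size_nat B)\<^sup>2 \<le> 100000 * (size_nat B)\<^sup>2"
    using assms(2) by (intro mult_le_mono1) (simp add: cheap_def)
  then show ?thesis using acost_ecost[OF assms(1), of e] unfolding C_def by linarith
qed

lemma C_pos: "1 \<le> C"
  using size_nat_pos[of B] by (simp add: C_def)

lemma Assign_cost:
  assumes "ok rs lb tb" "ecost a + esize a \<le> 90000" "cheap e"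
  shows "acost a (mem xs rs lb tb) + acost e (mem xs rs lb tb) +
    size_nat (aval a (mem xs rs lb tb)) + size_nat (aval e (mem xs rs lb tb)) \<le> C"
proof -
  have "(ecost a + ecost e + esize a + esize e) * (size_nat B)\<^sup>2 \<le> 100000 * (size_nat B)\<^sup>2"
    using assms(2,3) by (intro mult_le_mono1) (simp add: cheap_def)
  then show ?thesis
    using acost_ecost[OF assms(1), of a] acost_ecost[OF assms(1), of e]
      size_esize[OF assms(1), of a] size_esize[OF assms(1), of e]
    unfolding C_def add_mult_distrib by linarith
qed

text \<open>Total correctness in the style of weakest preconditions, with cost counted in units of
  \<open>C\<close>. The outcome is a point distribution, so this speaks of the deterministic parts
  of the program; the coin tosses are treated separately.\<close>

definition run :: "prog \<Rightarrow> nat \<Rightarrow> state_pred \<Rightarrow> state_pred" where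
  "run p n Q rs lb tb \<longleftrightarrow> (\<exists>t rs' lb' tb'. t \<le> n * C \<and>
     exec p (mem xs rs lb tb) = return_spmf (mem xs rs' lb' tb', t) \<and> ok rs' lb' tb' \<and> Q rs' lb' tb')"

lemma run_conseq:
  assumes "run p n Q rs lb tb" "n \<le> n'" "\<And>rs lb tb. ok rs lb tb \<Longrightarrow> Q rs lb tb \<Longrightarrow> Q' rs lb tb"
  shows "run p n' Q' rs lb tb"
proof -
  have "n * C \<le> n' * C" using assms(2) by simp
  then show ?thesis using assms(1,3) unfolding run_def by (meson le_trans)
qed

lemma run_Skip: "ok rs lb tb \<Longrightarrow> Q rs lb tb \<Longrightarrow> run Skip 1 Q rs lb tb"
  unfolding run_def using C_pos by (intro exI[of _ 1] exI[of _ rs] exI[of _ lb] exI[of _ tb]) simp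

lemma runI:
  "exec p (mem xs rs lb tb) = return_spmf (mem xs rs' lb' tb', t) \<Longrightarrow> t \<le> n * C \<Longrightarrow> ok rs' lb' tb' \<Longrightarrow>
    Q rs' lb' tb' \<Longrightarrow> run p n Q rs lb tb"
  unfolding run_def by blast

lemma run_set_reg:
  assumes "ok rs lb tb" "c < 16" "cheap e"
    and v: "aval e (mem xs rs lb tb) = v" "v \<le> B"
    and q: "Q (rs(c := v)) lb tb"
  shows "run (set_reg c e) 1 Q rs lb tb"
proof (rule runI)
  let ?m = "mem xs rs lb tb"
  show "exec (set_reg c e) ?m = return_spmf (mem xs (rs(c := v)) lb tb, acost (reg_addr c) ?m + acost e ?m +
      size_nat (aval (reg_addr c) ?m) + size_nat (aval e ?m))"
    by (simp only: set_reg_def exec.simps aval_addr v q mem_upd(1)[OF assms(2)])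
qed (use Assign_cost[OF assms(1) ecost_addr(1)[OF assms(2)] assms(3)] ok_upd(1)[OF assms(1) v(2)] q in auto)

lemma run_set_lab:
  assumes "ok rs lb tb" "cheap a" "cheap e"
    and v: "aval e (mem xs rs lb tb) = v" "v \<le> B"
    and q: "aval a (mem xs rs lb tb) = l" "Q rs (lb(l := v)) tb"
  shows "run (set_lab a e) 1 Q rs lb tb"
proof (rule runI)
  let ?m = "mem xs rs lb tb"
  show "exec (set_lab a e) ?m = return_spmf (mem xs rs (lb(l := v)) tb, acost (lab_addr a) ?m + acost e ?m +
      size_nat (aval (lab_addr a) ?m) + size_nat (aval e ?m))"
    by (simp only: set_lab_def exec.simps aval_addr v q mem_upd(2))
qed (use Assign_cost[OF assms(1) ecost_addr(2)[OF assms(2)] assms(3)] ok_upd(2)[OF assms(1) v(2)] q in auto)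

lemma run_set_tab:
  assumes "ok rs lb tb" "cheap a" "cheap e"
    and v: "aval e (mem xs rs lb tb) = v" "v \<le> B"
    and q: "aval a (mem xs rs lb tb) = i" "Q rs lb (tb(i := v))"
  shows "run (set_tab a e) 1 Q rs lb tb"
proof (rule runI)
  let ?m = "mem xs rs lb tb"
  show "exec (set_tab a e) ?m = return_spmf (mem xs rs lb (tb(i := v)), acost (tab_addr a) ?m + acost e ?m +
      size_nat (aval (tab_addr a) ?m) + size_nat (aval e ?m))"
    by (simp only: set_tab_def exec.simps aval_addr v q mem_upd(3))
qed (use Assign_cost[OF assms(1) ecost_addr(3)[OF assms(2)] assms(3)] ok_upd(3)[OF assms(1) v(2)] q in auto)

text \<open>The postcondition of \<open>p\<close> is the triple for \<open>q\<close> itself, so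
  symbolic execution proceeds without naming intermediate assertions.\<close>

lemma run_Seq:
  assumes "run p a (\<lambda>rs lb tb. ok rs lb tb \<longrightarrow> run q b Q rs lb tb) rs lb tb"
  shows "run (Seq p q) (a + b) Q rs lb tb"
proof -
  obtain t rs1 lb1 tb1 where 1: "t \<le> a * C" "exec p (mem xs rs lb tb) = return_spmf (mem xs rs1 lb1 tb1, t)"
    and "run q b Q rs1 lb1 tb1"
    using assms unfolding run_def by blast
  then obtain u rs2 lb2 tb2 where 2: "u \<le> b * C" "exec q (mem xs rs1 lb1 tb1) = return_spmf (mem xs rs2 lb2 tb2, u)"
    "ok rs2 lb2 tb2" "Q rs2 lb2 tb2"
    unfolding run_def by blast
  then show ?thesis
    unfolding run_def using 1
    by (intro exI[of _ "t + u"] exI[of _ rs2] exI[of _ lb2] exI[of _ tb2]) (simp add: add_mult_distrib add_mono)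
qed

lemma run_set_reg_Seq:
  assumes "ok rs lb tb" "c < 16" "cheap e" "aval e (mem xs rs lb tb) = v" "v \<le> B"
    and "ok (rs(c := v)) lb tb \<Longrightarrow> run q n Q (rs(c := v)) lb tb"
  shows "run (Seq (set_reg c e) q) (Suc n) Q rs lb tb"
  using run_Seq[OF run_set_reg[OF assms(1-5), where Q = "\<lambda>rs lb tb. ok rs lb tb \<longrightarrow> run q n Q rs lb tb"]]
    assms(6) by simp

lemma run_Seq':
  assumes "run p a Q1 rs lb tb"
    and "\<And>rs lb tb. ok rs lb tb \<Longrightarrow> Q1 rs lb tb \<Longrightarrow> run q b Q rs lb tb"
  shows "run (Seq p q) (a + b) Q rs lb tb"
  by (rule run_Seq, rule run_conseq[OF assms(1)]) (use assms(2) in auto)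

lemma run_If:
  assumes "ok rs lb tb" "cheap g"
    and "aval g (mem xs rs lb tb) \<noteq> 0 \<Longrightarrow> run p a Q rs lb tb"
    and "aval g (mem xs rs lb tb) = 0 \<Longrightarrow> run q a Q rs lb tb"
  shows "run (If g p q) (Suc a) Q rs lb tb"
proof -
  let ?m = "mem xs rs lb tb"
  have "run (if aval g ?m \<noteq> 0 then p else q) a Q rs lb tb"
    using assms(3,4) by simp
  then obtain t rs' lb' tb' where t: "t \<le> a * C" "ok rs' lb' tb'" "Q rs' lb' tb'"
    "(if aval g ?m \<noteq> 0 then exec p ?m else exec q ?m) = return_spmf (mem xs rs' lb' tb', t)"
    unfolding run_def by (auto split: if_splits)
  then show ?thesis
    unfolding run_def exec.simps t(4) using acost_cheap[OF assms(1,2)]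
    by (intro exI[of _ "acost g ?m + t"] exI[of _ rs'] exI[of _ lb'] exI[of _ tb']) simp
qed

text \<open>\<open>iterate g p n Q\<close> describes some iterations of the loop \<open>While g p\<close> that need not be the last
  ones.\<close>

definition iterate :: "aexp \<Rightarrow> prog \<Rightarrow> nat \<Rightarrow> state_pred \<Rightarrow> state_pred" where
  "iterate g p n Q rs lb tb \<longleftrightarrow> (\<exists>t rs' lb' tb'. t \<le> n * C \<and>
     exec (While g p) (mem xs rs lb tb) =
       map_spmf (\<lambda>(m, u). (m, t + u)) (exec (While g p) (mem xs rs' lb' tb')) \<and> ok rs' lb' tb' \<and> Q rs' lb' tb')"

lemma iterate_refl: "ok rs lb tb \<Longrightarrow> Q rs lb tb \<Longrightarrow> iterate g p 0 Q rs lb tb"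
  unfolding iterate_def
  by (intro exI[of _ 0] exI[of _ rs] exI[of _ lb] exI[of _ tb]) (simp add: case_prod_unfold)

text \<open>Consecutive stretches of one loop compose. This lets an induction on the expression
  handle its operands one after the other although a single flat loop reads them.\<close>

lemma iterate_trans:
  assumes "iterate g p a (\<lambda>rs lb tb. ok rs lb tb \<longrightarrow> iterate g p b Q rs lb tb) rs lb tb"
  shows "iterate g p (a + b) Q rs lb tb"
proof -
  obtain t rs1 lb1 tb1 where 1: "t \<le> a * C" "exec (While g p) (mem xs rs lb tb) =
       map_spmf (\<lambda>(m, u). (m, t + u)) (exec (While g p) (mem xs rs1 lb1 tb1))"
    and "iterate g p b Q rs1 lb1 tb1"
    using assms unfolding iterate_def by blast
  then obtain u rs2 lb2 tb2 where 2: "u \<le> b * C" "exec (While g p) (mem xs rs1 lb1 tb1) =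
       map_spmf (\<lambda>(m, t). (m, u + t)) (exec (While g p) (mem xs rs2 lb2 tb2))"
    "ok rs2 lb2 tb2" "Q rs2 lb2 tb2"
    unfolding iterate_def by blast
  then show ?thesis
    unfolding iterate_def using 1
    by (intro exI[of _ "t + u"] exI[of _ rs2] exI[of _ lb2] exI[of _ tb2])
      (simp add: add_mult_distrib add_mono spmf.map_comp o_def case_prod_unfold add.assoc)
qed

lemma iterate_conseq:
  assumes "iterate g p n Q rs lb tb" "n \<le> n'" "\<And>rs lb tb. ok rs lb tb \<Longrightarrow> Q rs lb tb \<Longrightarrow> Q' rs lb tb"
  shows "iterate g p n' Q' rs lb tb"
proof -
  have "n * C \<le> n' * C" using assms(2) by simp
  then show ?thesis using assms(1,3) unfolding iterate_def by (meson le_trans)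
qed

lemma iterate_trans':
  assumes "iterate g p a Q1 rs lb tb"
    and "\<And>rs lb tb. ok rs lb tb \<Longrightarrow> Q1 rs lb tb \<Longrightarrow> iterate g p b Q rs lb tb"
  shows "iterate g p (a + b) Q rs lb tb"
  by (rule iterate_trans, rule iterate_conseq[OF assms(1)]) (use assms(2) in auto)

lemma iterate_step:
  assumes "ok rs lb tb" "cheap g" "aval g (mem xs rs lb tb) \<noteq> 0" "run p n Q rs lb tb"
  shows "iterate g p (Suc n) Q rs lb tb"
proof -
  let ?m = "mem xs rs lb tb"
  obtain t rs' lb' tb' where t: "t \<le> n * C" "exec p ?m = return_spmf (mem xs rs' lb' tb', t)"
    "ok rs' lb' tb'" "Q rs' lb' tb'"
    using assms(4) unfolding run_def by blast
  have "exec (While g p) ?m = map_spmf (\<lambda>(m, u). (m, acost g ?m + t + u)) (exec (While g p) (mem xs rs' lb' tb'))"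
    unfolding exec.simps(6)
    by (subst while_spmf.simps) (simp add: assms(3) t(2) map_spmf_conv_bind_spmf case_prod_unfold)
  then show ?thesis
    unfolding iterate_def using t acost_cheap[OF assms(1,2)]
    by (intro exI[of _ "acost g ?m + t"] exI[of _ rs'] exI[of _ lb'] exI[of _ tb']) simp
qed

lemma run_While:
  assumes "iterate g p n (\<lambda>rs lb tb. aval g (mem xs rs lb tb) = 0 \<and> Q rs lb tb) rs lb tb" "cheap g"
  shows "run (While g p) (Suc n) Q rs lb tb"
proof -
  obtain t rs' lb' tb' where t: "t \<le> n * C" "exec (While g p) (mem xs rs lb tb) =
       map_spmf (\<lambda>(m, u). (m, t + u)) (exec (While g p) (mem xs rs' lb' tb'))"
    "ok rs' lb' tb'" "Q rs' lb' tb'" "aval g (mem xs rs' lb' tb') = 0"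
    using assms(1) unfolding iterate_def by blast
  have "exec (While g p) (mem xs rs' lb' tb') = return_spmf (mem xs rs' lb' tb', acost g (mem xs rs' lb' tb'))"
    unfolding exec.simps(6) by (subst while_spmf.simps) (simp add: t)
  then show ?thesis
    unfolding run_def using t acost_cheap[OF t(3) assms(2)]
    by (intro exI[of _ "t + acost g (mem xs rs' lb' tb')"] exI[of _ rs'] exI[of _ lb'] exI[of _ tb']) simp
qed

lemma iterate_invariant:
  assumes "ok rs lb tb" "I 0 rs lb tb" "cheap g"
    and "\<And>j rs lb tb. j < k \<Longrightarrow> I j rs lb tb \<Longrightarrow> ok rs lb tb \<Longrightarrow> aval g (mem xs rs lb tb) \<noteq> 0"
    and "\<And>j rs lb tb. j < k \<Longrightarrow> I j rs lb tb \<Longrightarrow> ok rs lb tb \<Longrightarrow> run p b (I (Suc j)) rs lb tb"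
  shows "iterate g p (k * Suc b) (I k) rs lb tb"
  using assms(4,5)
proof (induction k)
  case 0
  then show ?case using assms by (simp add: iterate_refl)
next
  case (Suc k)
  have "iterate g p (k * Suc b) (I k) rs lb tb"
    by (rule Suc.IH) (use Suc.prems less_SucI in blast)+
  then have "iterate g p (k * Suc b) (\<lambda>rs lb tb. ok rs lb tb \<longrightarrow> iterate g p (Suc b) (I (Suc k)) rs lb tb) rs lb tb"
    unfolding iterate_def[of _ _ "k * Suc b"]
    using iterate_step[OF _ assms(3)] Suc.prems by (meson lessI)
  from iterate_trans[OF this] show ?case by (simp only: mult_Suc add.commute)
qed

lemma run_While_invariant:
  assumes "ok rs lb tb" "I 0 rs lb tb" "cheap g"
    and "\<And>j rs lb tb. j < k \<Longrightarrow> I j rs lb tb \<Longrightarrow> ok rs lb tb \<Longrightarrow> aval g (mem xs rs lb tb) \<noteq> 0"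
    and "\<And>j rs lb tb. j < k \<Longrightarrow> I j rs lb tb \<Longrightarrow> ok rs lb tb \<Longrightarrow> run p b (I (Suc j)) rs lb tb"
    and "\<And>rs lb tb. I k rs lb tb \<Longrightarrow> ok rs lb tb \<Longrightarrow> aval g (mem xs rs lb tb) = 0"
    and "\<And>rs lb tb. I k rs lb tb \<Longrightarrow> ok rs lb tb \<Longrightarrow> Q rs lb tb"
  shows "run (While g p) (Suc (k * Suc b)) Q rs lb tb"
proof (rule run_While)
  have "iterate g p (k * Suc b) (I k) rs lb tb"
    by (rule iterate_invariant) (use assms in auto)
  then show "iterate g p (k * Suc b) (\<lambda>rs lb tb. aval g (mem xs rs lb tb) = 0 \<and> Q rs lb tb) rs lb tb"
    unfolding iterate_def using assms(6,7) by blast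
qed (rule assms(3))

end

subsection \<open>The program\<close>

abbreviation then_prog :: "prog \<Rightarrow> prog \<Rightarrow> prog" (infixr ";;" 60) where
  "p ;; q \<equiv> Seq p q"

text \<open>Registers: 0 base of the random digits \<open>N\<close>; 1 the point \<open>P = N ^ length xs\<close> at which the
  polynomials are evaluated; 2 counter; 3 random number; 4 coin; 5 address of the current node; 6 size \<open>Q\<close> of
  a table; 7 type of the node; 8, 9 place values of its labels; 10, 11 exponent and power of \<open>P\<close>;
  12 end of the table stack; 13 state; 14, 15 its digits at the two labels.\<close>

definition find_base :: prog where
  "find_base = set_reg 0 (Const 32) ;; While (Sub len_e (reg 0)) (set_reg 0 (Add (reg 0) (reg 0)))"

definition find_point :: prog where
  "find_point = set_reg 1 (Const 1) ;; set_reg 2 len_e ;;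
     While (reg 2) (set_reg 1 (Mul (reg 1) (reg 0)) ;; set_reg 2 (Sub (reg 2) (Const 1)))"

text \<open>\<open>reg 2\<close> starts at \<open>P\<close>, a power of two, and is halved with each
  bit, so the number of bits is exactly right. Clearing the coin makes the memory afterwards a
  function of the random number alone.\<close>

definition toss :: prog where
  "toss = Flip (reg_addr 4) ;; set_reg 3 (Add (Add (reg 3) (reg 3)) (reg 4)) ;; set_reg 4 (Const 0) ;;
     set_reg 2 (Div (reg 2) (Const 2))"

definition first_label :: aexp where
  "first_label = inp (Add (reg 5) (Const 1))"

text \<open>The third number of an introduce node is not a label but the name of the vertex.\<close>

definition second_label :: aexp where
  "second_label = Mul (inp (Add (reg 5) (Const 2))) (Sub (Const 1) (Sub (Const 1) (reg 7)))"

text \<open>Place values are powers of 5, hence nonzero, so an entry 0 marks a label not seen yet.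
  \<open>reg 6\<close> is the next free place value and, after the last label, the size of a
  table.\<close>

definition insert_label :: "aexp \<Rightarrow> prog" where
  "insert_label e = If (lab e) Skip (set_lab e (reg 6) ;; set_reg 6 (Mul (Const 5) (reg 6)))"

definition nodes_left :: aexp where
  "nodes_left = Sub len_e (reg 5)"

definition label_node :: prog where
  "label_node = set_reg 7 (inp (reg 5)) ;; insert_label first_label ;; insert_label second_label ;;
     set_reg 5 (Add (reg 5) (Const 4))"

text \<open>The factor \<open>N * length xs\<close> exceeds every sum of random digits over a set of
  vertices, so the digits merely break ties between costs. Nodes that introduce no vertex have 0 in
  the fourth field, which keeps the exponent below \<open>N\<close> there.\<close>

definition digit_weight :: aexp where
  "digit_weight = Add (Mul (inp (Add (reg 5) (Const 3))) (Mul (reg 0) len_e)) (Mod (reg 3) (reg 0))"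

text \<open>A test by truncated subtraction: for a state \<open>e\<close> up to 4 and
  \<open>a\<close> among 1, 2, 3, the inner sum vanishes exactly if \<open>e\<close> is
  \<open>a\<close> or 4.\<close>

definition allows_e :: "aexp \<Rightarrow> nat \<Rightarrow> aexp" where
  "allows_e e a = Sub (Const 1) (Add (Mul (Sub e (Const a)) (Sub (Const 4) e)) (Sub (Const a) e))"

definition meet_e :: "aexp \<Rightarrow> nat \<Rightarrow> aexp" where
  "meet_e e a = Mul (Const a) (allows_e e a)"

definition target :: aexp where
  "target = Sub (reg 12) (reg 6)"

definition introduce_e :: aexp where
  "introduce_e = Add (Const 1) (Add (Mul (allows_e (reg 14) 1) (reg 11))
     (Add (Mul (allows_e (reg 14) 2) (reg 11)) (Mul (allows_e (reg 14) 3) (Const 3))))"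

text \<open>\<open>reg 12\<close> has already been lowered to the end of the first table, which is
  where the second one begins.\<close>

definition union_e :: aexp where
  "union_e = Mul (tab (Add target (reg 13))) (tab (Add (reg 12) (reg 13)))"

definition relabel_e :: aexp where
  "relabel_e = tab (Add target (Add (Sub (reg 13) (Mul (reg 14) (reg 8))) (Mul (reg 15) (reg 8))))"

definition look :: "aexp \<Rightarrow> aexp \<Rightarrow> aexp" where
  "look a b = tab (Add target (Add (Sub (Add (Sub (reg 13) (Mul (reg 14) (reg 8))) (Mul a (reg 8)))
     (Mul (reg 15) (reg 9))) (Mul b (reg 9))))"

definition join_term :: "nat \<Rightarrow> aexp" where
  "join_term a = Add (look (meet_e (reg 14) a) (meet_e (reg 15) a))
     (Mul (Const 3) (Add (look (Const 0) (meet_e (reg 15) a)) (look (meet_e (reg 14) a) (Const 0))))"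

definition join_e :: aexp where
  "join_e = Add (Add (Add (look (Const 0) (reg 15)) (look (reg 14) (Const 0)))
     (Mul (Const 2) (look (Const 0) (Const 0)))) (Add (join_term 1) (Add (join_term 2) (join_term 3)))"

definition store :: "aexp \<Rightarrow> prog" where
  "store e = set_tab (Add target (reg 13)) e"

definition update :: prog where
  "update = If (reg 7) (If (Sub (reg 7) (Const 1)) (If (Sub (reg 7) (Const 2)) (store join_e) (store relabel_e))
     (store union_e)) (store introduce_e)"

definition state_step :: prog where
  "state_step = set_reg 13 (Sub (reg 13) (Const 1)) ;;
     set_reg 14 (Mod (Div (reg 13) (reg 8)) (Const 5)) ;; set_reg 15 (Mod (Div (reg 13) (reg 9)) (Const 5)) ;;
     update"

definition power_loop :: prog where
  "power_loop = set_reg 11 (Const 1) ;; While (reg 10)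
     (set_reg 11 (Mul (reg 11) (reg 1)) ;; set_reg 10 (Sub (reg 10) (Const 1)))"

text \<open>The two factors at \<open>reg 6\<close> are the indicators of types 0 and 1: an
  introduce node pushes a table, a union pops one, relabel and join work in place.\<close>

definition move_top :: aexp where
  "move_top = Sub (Add (reg 12) (Mul (reg 6) (Sub (Const 1) (reg 7))))
     (Mul (reg 6) (Sub (Const 1) (Add (Sub (reg 7) (Const 1)) (Sub (Const 1) (reg 7)))))"

definition main_node :: prog where
  "main_node = set_reg 7 (inp (reg 5)) ;; set_reg 8 (lab first_label) ;; set_reg 9 (lab second_label) ;;
     set_reg 10 digit_weight ;; set_reg 3 (Div (reg 3) (reg 0)) ;; set_reg 5 (Add (reg 5) (Const 4)) ;;
     power_loop ;; set_reg 12 move_top ;; set_reg 13 (reg 6) ;; While (reg 13) state_step"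

definition final_step :: prog where
  "final_step = If (Mod (Mod (reg 11) (reg 1)) (Const 4)) (set_reg 7 (Const 1)) Skip ;;
     set_reg 11 (Div (reg 11) (reg 1)) ;; set_reg 10 (Sub (reg 10) (Const 1))"

definition before_toss :: prog where
  "before_toss = find_base ;; find_point ;; set_reg 2 (reg 1) ;; set_reg 3 (Const 0) ;; set_reg 4 (Const 0)"

text \<open>Nodes start at address 2, after the length and the budget. Entry \<open>Q - 1\<close> of
  the final table has all base 5 digits equal to 4, so it allows every colour everywhere. Weights
  below \<open>(b + 1) * (N * length xs)\<close> are exactly those of sets of cost at most
  \<open>b\<close>.\<close>

definition after_toss :: prog where
  "after_toss = set_reg 6 (Const 1) ;; set_reg 5 (Const 2) ;; While nodes_left label_node ;;
     set_reg 5 (Const 2) ;; set_reg 12 (Const 0) ;; While nodes_left main_node ;;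
     set_reg 11 (tab (Sub (reg 6) (Const 1))) ;;
     set_reg 10 (Mul (Add (inp (Const 1)) (Const 1)) (Mul (reg 0) len_e)) ;; set_reg 7 (Const 0) ;;
     While (Mul (reg 11) (reg 10)) final_step"

definition cds_prog :: prog where
  "cds_prog = before_toss ;; While (Sub (reg 2) (Const 1)) toss ;; after_toss ;; Assign (Const 0) (reg 7)"

lemma size_nat_simps: "size_nat 0 = 1" "size_nat (Suc 0) = 2" "size_nat (Suc (Suc 0)) = 3" "size_nat 1 = 2"
  "size_nat (numeral n) = floorlog 2 (numeral n) + 1"
  by (simp_all add: size_nat_def compute_floorlog)

lemmas cheap_simps = cheap_def reg_def reg_addr_def len_e_def lab_def lab_addr_def tab_def tab_addr_def inp_def
  size_nat_simps compute_floorlog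

lemma cheap_exprs:
  "cheap (Sub len_e (reg 0))" "cheap (Add (reg 0) (reg 0))" "cheap (Const 32)" "cheap (Const 0)" "cheap (Const 1)"
  "cheap (Const 2)" "cheap len_e"
  "cheap (Mul (reg 1) (reg 0))" "cheap (Sub (reg 2) (Const 1))"
  "cheap (reg 0)" "cheap (reg 1)" "cheap (reg 2)" "cheap (reg 6)" "cheap (reg 7)" "cheap (reg 10)" "cheap (reg 13)"
  "cheap (Add (Add (reg 3) (reg 3)) (reg 4))" "cheap (Div (reg 2) (Const 2))"
  "cheap first_label" "cheap second_label" "cheap (lab first_label)" "cheap (lab second_label)"
  "cheap (Mul (Const 5) (reg 6))" "cheap nodes_left" "cheap (inp (reg 5))" "cheap (Add (reg 5) (Const 4))"
  "cheap digit_weight" "cheap (Div (reg 3) (reg 0))"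
  "cheap (Add target (reg 13))" "cheap introduce_e" "cheap union_e" "cheap relabel_e"
  "cheap (Sub (reg 7) (Const 1))" "cheap (Sub (reg 7) (Const 2))" "cheap (Sub (reg 13) (Const 1))"
  "cheap (Mod (Div (reg 13) (reg 8)) (Const 5))" "cheap (Mod (Div (reg 13) (reg 9)) (Const 5))"
  "cheap (Mul (reg 11) (reg 1))" "cheap (Sub (reg 10) (Const 1))" "cheap move_top"
  "cheap (Mod (Mod (reg 11) (reg 1)) (Const 4))" "cheap (Div (reg 11) (reg 1))" 
  "cheap (tab (Sub (reg 6) (Const 1)))" "cheap (Mul (Add (inp (Const 1)) (Const 1)) (Mul (reg 0) len_e))"
  "cheap (Mul (reg 11) (reg 10))"
  by (simp_all add: cheap_simps first_label_def second_label_def nodes_left_def digit_weight_def target_def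
      introduce_e_def union_e_def relabel_e_def allows_e_def move_top_def)

lemmas cheap_exprs' [simp] = cheap_exprs cheap_exprs[unfolded One_nat_def]

lemma cheap_join_e [simp]: "cheap join_e"
  by (simp add: cheap_simps target_def join_e_def join_term_def look_def meet_e_def allows_e_def)

context machine
begin

lemma run_find_base:
  assumes "ok rs lb tb" "32 \<le> B" "2 * length xs \<le> B"
  shows "run find_base (3 * length xs + 5) (\<lambda>rs' lb' tb'. lb' = lb \<and> length xs \<le> rs' 0 \<and>
    (\<exists>d. rs' 0 = 32 * 2 ^ d) \<and> rs' 0 \<le> 32 + 2 * length xs) rs lb tb"
proof -
  define d where "d = (LEAST d. length xs \<le> 32 * 2 ^ d)"
  have "length xs \<le> 32 * 2 ^ length xs"
    using less_exp[of "length xs"] by linarith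
  then have d: "length xs \<le> 32 * 2 ^ d" "d \<le> length xs"
    unfolding d_def by (rule LeastI, rule Least_le)
  have less: "32 * 2 ^ j < length xs" if "j < d" for j
    using not_less_Least[of j "\<lambda>d. length xs \<le> 32 * 2 ^ d"] that by (simp add: d_def)
  \<comment> \<open>Half of the value was still below the input length, unless the value is the
    initial 32.\<close>
  have bound: "32 * 2 ^ j \<le> 32 + 2 * length xs" if "j \<le> d" for j
  proof (cases j)
    case (Suc i)
    then show ?thesis using less[of i] that by simp
  qed simp
  have bound': "32 * 2 ^ j \<le> B" if "j \<le> d" for j
  proof (cases j)
    case (Suc i)
    then show ?thesis using less[of i] that assms by simp
  qed (use assms in simp)
  have "run find_base (Suc (Suc (d * Suc 1))) (\<lambda>rs' lb' tb'. lb' = lb \<and> length xs \<le> rs' 0 \<and>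
    (\<exists>d. rs' 0 = 32 * 2 ^ d) \<and> rs' 0 \<le> 32 + 2 * length xs) rs lb tb" (is "run _ _ ?Q _ _ _")
    unfolding find_base_def
  proof (rule run_set_reg_Seq[OF assms(1), where v = 32])
    assume "ok (rs(0 := 32)) lb tb"
    then show "run (While (Sub len_e (reg 0)) (set_reg 0 (Add (reg 0) (reg 0)))) (Suc (d * Suc 1)) ?Q (rs(0 := 32)) lb tb"
    proof (rule run_While_invariant[where I = "\<lambda>j rs' lb' tb'. rs' 0 = 32 * 2 ^ j \<and> lb' = lb"])
      fix j rs' lb' tb' assume "j < d" and I: "rs' 0 = 32 * 2 ^ j \<and> lb' = lb" and ok: "ok rs' lb' tb'"
      show "aval (Sub len_e (reg 0)) (mem xs rs' lb' tb') \<noteq> 0"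
        using less[OF \<open>j < d\<close>] I by simp
      show "run (set_reg 0 (Add (reg 0) (reg 0))) 1 (\<lambda>rs' lb' tb'. rs' 0 = 32 * 2 ^ Suc j \<and> lb' = lb) rs' lb' tb'"
        by (rule run_set_reg[OF ok, where v = "32 * 2 ^ Suc j"]) (use I bound'[of "Suc j"] \<open>j < d\<close> in auto)
    qed (use d bound[of d] in auto)
  qed (use assms in auto)
  then show ?thesis
    by (rule run_conseq) (use d(2) in auto)
qed

lemma run_find_point:
  assumes "ok rs lb tb" "rs 0 ^ length xs \<le> B" "0 < rs 0" "1 \<le> B"
  shows "run find_point (3 * length xs + 3) (\<lambda>rs' lb' tb'. lb' = lb \<and> rs' 0 = rs 0 \<and> rs' 1 = rs 0 ^ length xs) rs lb tb"
proof -
  let ?N = "rs 0"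
  let ?I = "\<lambda>j rs' lb' tb'. lb' = lb \<and> rs' 0 = ?N \<and> rs' 1 = ?N ^ j \<and> rs' 2 = length xs - j"
  have le: "?N ^ j \<le> B" if "j \<le> length xs" for j
    using power_increasing[OF that, of ?N] assms by linarith
  have "run find_point (Suc (Suc (Suc (length xs * Suc 2)))) (\<lambda>rs' lb' tb'. lb' = lb \<and> rs' 0 = rs 0 \<and> rs' 1 = rs 0 ^ length xs) rs lb tb"
    (is "run _ _ ?Q _ _ _")
    unfolding find_point_def
  proof (rule run_set_reg_Seq[OF assms(1), where v = 1], goal_cases)
    case 5
    then show ?case
    proof (rule run_set_reg_Seq[where v = "length xs"], goal_cases)
      case 5
      then show ?case
    proof (rule run_While_invariant[where I = ?I])
      fix j rs' lb' tb' assume j: "j < length xs" and ok: "ok rs' lb' tb'"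
        and I: "?I j rs' lb' tb'"
      show "aval (reg 2) (mem xs rs' lb' tb') \<noteq> 0" using j I by simp
      have "length xs - Suc j \<le> B" using input_le(1) by simp
      have "run (set_reg 1 (Mul (reg 1) (reg 0)) ;; set_reg 2 (Sub (reg 2) (Const 1))) (Suc 1) (?I (Suc j)) rs' lb' tb'"
        by (rule run_set_reg_Seq[OF ok, where v = "?N ^ Suc j"]; (rule run_set_reg[where v = "length xs - Suc j"])?)
          (use I j le[of "Suc j"] ok \<open>length xs - Suc j \<le> B\<close> in \<open>auto simp: mult.commute\<close>)
      then show "run (set_reg 1 (Mul (reg 1) (reg 0)) ;; set_reg 2 (Sub (reg 2) (Const 1))) 2 (?I (Suc j)) rs' lb' tb'"
        by (simp add: numeral_2_eq_2)
    qed auto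
    qed (use input_le(1) in auto)
  qed (use assms in auto)
  then show ?thesis
    by (rule run_conseq) auto
qed

end

subsection \<open>Labels and coin tosses\<close>

lemma length_encode_cexp [simp]: "length (encode_cexp c t) = 4 * node_count t"
  by (induction t) auto

text \<open>Label 0 stands for the second label of an introduce node and for both labels of a union.
  It lies outside \<open>{1..k}\<close>, so it may take one extra base 5 digit: a table has up to
  \<open>5 * 5 ^ k\<close> entries.\<close>

primrec labels :: "'v cexp \<Rightarrow> nat set" where
  "labels (Introduce l v) = {l, 0}"
| "labels (DUnion t u) = labels t \<union> labels u \<union> {0}"
| "labels (Relabel i j t) = labels t \<union> {i, j}"
| "labels (Join i j t) = labels t \<union> {i, j}"

lemma finite_labels [simp]: "finite (labels t)"
  by (induction t) auto

lemma card_insert_le: "card (insert a A) \<le> Suc (card A)"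
  by (cases "finite A") (auto simp: card_insert_if)

lemma card_insert2_le: "card (insert a (insert b A)) \<le> card A + 2"
  using card_insert_le[of a "insert b A"] card_insert_le[of b A] by linarith

lemma card_labels: "card (labels t) \<le> 2 * node_count t"
proof (induction t)
  case (Introduce l v)
  then show ?case using card_insert2_le[of l 0 "{}"] by simp
next
  case (DUnion t u)
  then show ?case
    using card_insert_le[of 0 "labels t \<union> labels u"] card_Un_le[of "labels t" "labels u"] by simp
next
  case (Relabel i j t)
  then show ?case using card_insert2_le[of i j "labels t"] by simp
next
  case (Join i j t)
  then show ?case using card_insert2_le[of i j "labels t"] by simp
qed

lemma power5_le: "5 ^ b \<le> (B :: nat) \<Longrightarrow> a \<le> b \<Longrightarrow> 5 ^ a \<le> B"
  using power_increasing[of a b "5::nat"] by linarith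

text \<open>Labels are renumbered in the order of their occurrence: a state is a number whose base 5 digits
  belong to the labels that occur. A label may be exponential in the size of the input, and then so is
  the length of a number with \<open>k\<close> digits.\<close>

definition place_values :: "nat set \<Rightarrow> (nat \<Rightarrow> nat) \<Rightarrow> (nat \<Rightarrow> nat) \<Rightarrow> bool" where
  "place_values \<Lambda> r lb \<longleftrightarrow> finite \<Lambda> \<and> inj_on r \<Lambda> \<and> r ` \<Lambda> \<subseteq> {..<card \<Lambda>} \<and>
     (\<forall>l. lb l = (if l \<in> \<Lambda> then 5 ^ r l else 0))"

lemma place_values_insert:
  assumes "place_values \<Lambda> r lb" "l \<notin> \<Lambda>"
  shows "place_values (insert l \<Lambda>) (r(l := card \<Lambda>)) (lb(l := 5 ^ card \<Lambda>))"
proof -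
  have "inj_on (r(l := card \<Lambda>)) (insert l \<Lambda>)"
  proof (rule inj_onI)
    fix a b assume "a \<in> insert l \<Lambda>" "b \<in> insert l \<Lambda>" "(r(l := card \<Lambda>)) a = (r(l := card \<Lambda>)) b"
    then show "a = b"
      using assms unfolding place_values_def
      by (auto split: if_splits dest: inj_onD)
  qed
  moreover have "(r(l := card \<Lambda>)) ` insert l \<Lambda> \<subseteq> {..<card (insert l \<Lambda>)}"
    using assms unfolding place_values_def by (auto simp: less_Suc_eq)
  ultimately show ?thesis
    using assms unfolding place_values_def by auto
qed

context machine
begin

lemma node_fields:
  assumes "xs = pre @ [ty, f1, f2, f3] @ post" "rs 5 = Suc (length pre)"
  shows "aval (inp (reg 5)) (mem xs rs lb tb) = ty"
    and "aval first_label (mem xs rs lb tb) = f1"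
    and "rs 7 = ty \<Longrightarrow> aval second_label (mem xs rs lb tb) = (if ty = 0 then 0 else f2)"
    and "aval (inp (Add (reg 5) (Const 3))) (mem xs rs lb tb) = f3"
    and "aval nodes_left (mem xs rs lb tb) \<noteq> 0"
    and "ty \<le> B" "Suc (length pre + 4) \<le> Suc (length xs)"
proof -
  have i: "aval (inp e) (mem xs rs lb tb) = (pre @ [ty, f1, f2, f3] @ post) ! (length pre + j)"
    if "aval e (mem xs rs lb tb) = Suc (length pre + j)" "j < 4" for e j
    using aval_inp[OF that(1)] that(2) assms(1) by simp
  show "aval (inp (reg 5)) (mem xs rs lb tb) = ty"
    by (subst i[where j = 0]) (auto simp: assms(2))
  show "aval first_label (mem xs rs lb tb) = f1"
    unfolding first_label_def by (subst i[where j = 1]) (auto simp: assms(2) nth_append)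
  have "aval (inp (Add (reg 5) (Const 2))) (mem xs rs lb tb) = f2"
    by (subst i[where j = 2]) (auto simp: assms(2) nth_append numeral_2_eq_2)
  then show "rs 7 = ty \<Longrightarrow> aval second_label (mem xs rs lb tb) = (if ty = 0 then 0 else f2)"
    by (simp add: second_label_def)
  show "aval (inp (Add (reg 5) (Const 3))) (mem xs rs lb tb) = f3"
    by (subst i[where j = 3]) (auto simp: assms(2) nth_append numeral_3_eq_3)
  show "aval nodes_left (mem xs rs lb tb) \<noteq> 0" "Suc (length pre + 4) \<le> Suc (length xs)"
    by (simp_all add: nodes_left_def assms)
  show "ty \<le> B" using input_le(2)[of ty] assms(1) by simp
qed

lemma run_insert_label:
  assumes "ok rs lb tb" "cheap e" "cheap (lab e)" "aval e (mem xs rs lb tb) = l"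
    and pv: "place_values \<Lambda> r lb" "rs 6 = 5 ^ card \<Lambda>" and le: "5 ^ Suc (card \<Lambda>) \<le> B"
    and R: "\<And>r' lb'. place_values (insert l \<Lambda>) r' lb' \<Longrightarrow> R (rs(6 := 5 ^ card (insert l \<Lambda>))) lb' tb"
  shows "run (insert_label e) 3 R rs lb tb"
proof -
  have "run (insert_label e) (Suc (1 + 1)) R rs lb tb"
    unfolding insert_label_def
  proof (rule run_If[OF assms(1,3)])
    assume "aval (lab e) (mem xs rs lb tb) \<noteq> 0"
    then have l: "l \<in> \<Lambda>" using pv(1) by (auto simp: assms(4) place_values_def split: if_splits)
    then have "R rs lb tb" using R[of r lb] pv by (simp add: insert_absorb fun_upd_idem)
    then show "run Skip (1 + 1) R rs lb tb"
      by (intro run_conseq[OF run_Skip[OF assms(1)]]) auto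
  next
    assume "aval (lab e) (mem xs rs lb tb) = 0"
    then have l: "l \<notin> \<Lambda>" using pv(1) by (auto simp: assms(4) place_values_def)
    have fin: "finite \<Lambda>" using pv(1) by (simp add: place_values_def)
    have lt: "5 ^ card \<Lambda> \<le> B" using le by simp
    have R': "R (rs(6 := 5 ^ Suc (card \<Lambda>))) (lb(l := 5 ^ card \<Lambda>)) tb"
      using R[OF place_values_insert[OF pv(1) l]] l fin by simp
    show "run (set_lab e (reg 6) ;; set_reg 6 (Mul (Const 5) (reg 6))) (1 + 1) R rs lb tb"
    proof (rule run_Seq, rule run_set_lab[where v = "5 ^ card \<Lambda>" and l = l], goal_cases)
      case 7
      show ?case
      proof
        assume "ok rs (lb(l := 5 ^ card \<Lambda>)) tb"
        then show "run (set_reg 6 (Mul (Const 5) (reg 6))) 1 R rs (lb(l := 5 ^ card \<Lambda>)) tb"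
          by (rule run_set_reg[where v = "5 ^ Suc (card \<Lambda>)"]) (use le pv R' in auto)
      qed
    qed (use assms(1-4) pv lt in auto)
  qed
  then show ?thesis by (simp add: numeral_3_eq_3)
qed

definition labels_read :: "nat set \<Rightarrow> nat \<Rightarrow> (nat \<Rightarrow> nat) \<Rightarrow> (nat \<Rightarrow> nat) \<Rightarrow> (nat \<Rightarrow> nat) \<Rightarrow> (nat \<Rightarrow> nat) \<Rightarrow> bool" where
  "labels_read \<Lambda> p rs0 rs lb tb \<longleftrightarrow> (\<exists>r. place_values \<Lambda> r lb) \<and> rs 6 = 5 ^ card \<Lambda> \<and> rs 5 = Suc p \<and>
     (\<forall>c\<in>{0,1,3}. rs c = rs0 c)"

lemma iterate_label_node:
  assumes x: "xs = pre @ [ty, f1, f2, f3] @ post" and st: "labels_read \<Lambda> (length pre) rs0 rs lb tb"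
    and ok: "ok rs lb tb" and le: "5 ^ (card \<Lambda> + 2) \<le> B" "length xs < B"
  shows "iterate nodes_left label_node 9
    (labels_read (insert (if ty = 0 then 0 else f2) (insert f1 \<Lambda>)) (length pre + 4) rs0) rs lb tb" (is "iterate _ _ _ ?Q _ _ _")
proof -
  obtain r where pv: "place_values \<Lambda> r lb" "rs 6 = 5 ^ card \<Lambda>" and 5: "rs 5 = Suc (length pre)"
    and same: "\<forall>c\<in>{0,1,3}. rs c = rs0 c"
    using st by (auto simp: labels_read_def)
  have le': "5 ^ Suc (card \<Lambda>) \<le> B" "5 ^ Suc (card (insert f1 \<Lambda>)) \<le> B"
    using card_insert_le[of f1 \<Lambda>] by (intro power5_le[OF le(1)]; simp)+
  note nf = node_fields[OF x]
  have "run label_node (Suc (3 + (3 + 1))) ?Q rs lb tb"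
    unfolding label_node_def
  proof (rule run_set_reg_Seq[OF ok, where v = ty], goal_cases)
    case 5
    show ?case
    proof (rule run_Seq, rule run_insert_label[OF 5, where \<Lambda> = \<Lambda> and r = r and l = f1], goal_cases)
      case (7 r1 lb1)
      show ?case
      proof (rule impI, rule run_Seq, rule run_insert_label[where \<Lambda> = "insert f1 \<Lambda>" and r = r1 and
            l = "if ty = 0 then 0 else f2"], goal_cases)
        case (8 r2 lb2)
        show ?case
        proof (rule impI, rule run_set_reg[where v = "Suc (length pre + 4)"], goal_cases)
          case 6
          show ?case using 8 same by (auto simp: labels_read_def)
        qed (use 5 \<open>rs 5 = _\<close> nf(7)[of rs] le(2) in auto)
      qed (use nf(3) \<open>rs 5 = _\<close> le' 7 in auto)
    qed (use nf(2) \<open>rs 5 = _\<close> pv le' in auto)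
  qed (use nf(1,6) \<open>rs 5 = _\<close> in auto)
  from iterate_step[OF ok _ nf(5)[of rs, OF \<open>rs 5 = _\<close>] this] show ?thesis by simp
qed

lemma iterate_labels_append:
  assumes "iterate nodes_left label_node (9 * m) (labels_read \<Lambda> (length pre) rs0) rs lb tb"
    and "xs = pre @ [ty, i, j, 0] @ post" "ty \<noteq> 0" "5 ^ (card \<Lambda> + 2) \<le> B" "length xs < B"
  shows "iterate nodes_left label_node (9 * m + 9) (labels_read (insert j (insert i \<Lambda>)) (length pre + 4) rs0) rs lb tb"
  by (rule iterate_trans'[OF assms(1)]) (use iterate_label_node[OF assms(2) _ _ assms(4,5)] assms(3) in auto)

lemma iterate_labels_unary:
  assumes IH: "5 ^ (card \<Lambda> + 2 * node_count t) \<le> B \<Longrightarrow> iterate nodes_left label_node (9 * node_count t)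
      (labels_read (\<Lambda> \<union> labels t) (length pre + 4 * node_count t) rs0) rs lb tb"
    and x: "xs = pre @ encode_cexp c t @ [ty, i, j, 0] @ post" "ty \<noteq> 0"
    and le: "5 ^ (card \<Lambda> + 2 * (node_count t + 1)) \<le> B" "length xs < B"
  shows "iterate nodes_left label_node (9 * (node_count t + 1))
    (labels_read (\<Lambda> \<union> (labels t \<union> {i, j})) (length pre + 4 * (node_count t + 1)) rs0) rs lb tb"
proof -
  have "card (\<Lambda> \<union> labels t) \<le> card \<Lambda> + 2 * node_count t"
    using card_Un_le[of \<Lambda> "labels t"] card_labels[of t] by linarith
  then have le': "5 ^ (card \<Lambda> + 2 * node_count t) \<le> B" "5 ^ (card (\<Lambda> \<union> labels t) + 2) \<le> B"
    by (intro power5_le[OF le(1)]; simp)+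
  have "iterate nodes_left label_node (9 * node_count t + 9)
      (labels_read (insert j (insert i (\<Lambda> \<union> labels t))) (length (pre @ encode_cexp c t) + 4) rs0) rs lb tb"
    by (rule iterate_labels_append[where ty = ty and post = post]) (use IH x le le' in auto)
  moreover have "insert j (insert i (\<Lambda> \<union> labels t)) = \<Lambda> \<union> (labels t \<union> {i, j})" by auto
  ultimately show ?thesis by (simp add: ac_simps)
qed

text \<open>A subexpression is a contiguous block of the postfix word, so induction on it works once
  the position and the labels seen so far are generalised. Each node brings at most two new labels,
  whence the exponent in the hypothesis on \<open>B\<close>.\<close>

lemma iterate_labels:
  assumes "xs = pre @ encode_cexp c t @ post" "labels_read \<Lambda> (length pre) rs0 rs lb tb" "ok rs lb tb"
    and "5 ^ (card \<Lambda> + 2 * node_count t) \<le> B" "length xs < B"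
  shows "iterate nodes_left label_node (9 * node_count t)
    (labels_read (\<Lambda> \<union> labels t) (length pre + 4 * node_count t) rs0) rs lb tb"
  using assms
proof (induction t arbitrary: pre post rs lb tb \<Lambda>)
  case (Introduce l v)
  then have "iterate nodes_left label_node 9 (labels_read (insert 0 (insert l \<Lambda>)) (length pre + 4) rs0) rs lb tb"
    using iterate_label_node[of pre 0 l v "c v" post \<Lambda> rs0 rs lb tb] by simp
  moreover have "insert 0 (insert l \<Lambda>) = \<Lambda> \<union> labels (Introduce l v)" by auto
  ultimately show ?case by simp
next
  case (DUnion t u)
  have ct: "card (\<Lambda> \<union> labels t) \<le> card \<Lambda> + 2 * node_count t"
    using card_Un_le[of \<Lambda> "labels t"] card_labels[of t] by linarith
  have ctu: "card (\<Lambda> \<union> labels t \<union> labels u) \<le> card \<Lambda> + 2 * node_count t + 2 * node_count u"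
    using ct card_Un_le[of "\<Lambda> \<union> labels t" "labels u"] card_labels[of u] by linarith
  have le: "5 ^ (card \<Lambda> + 2 * node_count t) \<le> B" "5 ^ (card (\<Lambda> \<union> labels t) + 2 * node_count u) \<le> B"
    "5 ^ (card (\<Lambda> \<union> labels t \<union> labels u) + 2) \<le> B"
    using ct ctu by (intro power5_le[OF DUnion.prems(4)]; simp)+
  let ?pre = "pre @ encode_cexp c t @ encode_cexp c u"
  have "iterate nodes_left label_node (9 * node_count t + 9 * node_count u)
      (labels_read (\<Lambda> \<union> labels t \<union> labels u) (length ?pre) rs0) rs lb tb"
    by (rule iterate_trans'[OF DUnion.IH(1)[of pre "encode_cexp c u @ [1, 0, 0, 0] @ post"]])
      (use DUnion.IH(2)[of "pre @ encode_cexp c t" "[1, 0, 0, 0] @ post" "\<Lambda> \<union> labels t"] DUnion.prems le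
        in \<open>auto simp: add.assoc\<close>)
  from iterate_labels_append[of "node_count t + node_count u", unfolded distrib_left, OF this, of 1 0 0 post]
  have "iterate nodes_left label_node (9 * node_count t + 9 * node_count u + 9)
      (labels_read (insert 0 (\<Lambda> \<union> labels t \<union> labels u)) (length ?pre + 4) rs0) rs lb tb"
    using DUnion.prems le by simp
  moreover have "insert 0 (\<Lambda> \<union> labels t \<union> labels u) = \<Lambda> \<union> labels (DUnion t u)" by auto
  ultimately show ?case by (simp add: ac_simps)
next
  case (Relabel i j t)
  then show ?case
    using iterate_labels_unary[of \<Lambda> t pre rs0 rs lb tb c 2 i j post] Relabel.IH[of pre "[2, i, j, 0] @ post" \<Lambda>] by simp
next
  case (Join i j t)
  then show ?case
    using iterate_labels_unary[of \<Lambda> t pre rs0 rs lb tb c 3 i j post] Join.IH[of pre "[3, i, j, 0] @ post" \<Lambda>] by simp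
qed

end

section \<open>A uniform random number from fair coins\<close>

lemma pair_spmf_of_set: "pair_spmf (spmf_of_set A) (spmf_of_set A') = spmf_of_set (A \<times> A')"
proof (rule spmf_eqI)
  fix z :: "'a \<times> 'b"
  show "spmf (pair_spmf (spmf_of_set A) (spmf_of_set A')) z = spmf (spmf_of_set (A \<times> A')) z"
    by (cases z) (simp add: spmf_of_set card_cartesian_product indicator_def)
qed

text \<open>The first toss is the leading bit and selects the lower or the upper half of the
  range.\<close>

lemma spmf_of_set_double:
  "bind_spmf coin_spmf (\<lambda>x. map_spmf (\<lambda>y. f (of_bool x * 2 ^ n + y)) (spmf_of_set {..<2 ^ n})) =
   map_spmf f (spmf_of_set {..<2 ^ Suc n :: nat})"
proof -
  let ?g = "\<lambda>(x, y). of_bool x * 2 ^ n + y :: nat"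
  have "inj_on ?g (UNIV \<times> {..<2 ^ n})"
    by (auto simp: inj_on_def of_bool_def split: if_splits)
  then have "map_spmf ?g (spmf_of_set (UNIV \<times> {..<2 ^ n})) = spmf_of_set (?g ` (UNIV \<times> {..<2 ^ n}))"
    by (rule map_spmf_of_set_inj_on)
  also have "?g ` (UNIV \<times> {..<2 ^ n}) = {..<2 ^ Suc n}"
  proof (intro set_eqI iffI)
    fix z :: nat assume z: "z \<in> {..<2 ^ Suc n}"
    have "z = ?g (z \<ge> 2 ^ n, if z \<ge> 2 ^ n then z - 2 ^ n else z)" by simp
    moreover have "(z \<ge> 2 ^ n, if z \<ge> 2 ^ n then z - 2 ^ n else z) \<in> UNIV \<times> {..<2 ^ n}"
      using z by auto
    ultimately show "z \<in> ?g ` (UNIV \<times> {..<2 ^ n})" by (rule image_eqI)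
  qed (auto simp: of_bool_def split: if_splits)
  finally have "map_spmf f (spmf_of_set {..<2 ^ Suc n}) =
      map_spmf f (map_spmf ?g (spmf_of_set (UNIV \<times> {..<2 ^ n})))"
    by (simp only:)
  also have "\<dots> = map_spmf (\<lambda>(x, y). f (of_bool x * 2 ^ n + y)) (spmf_of_set (UNIV \<times> {..<2 ^ n}))"
    by (simp add: spmf.map_comp o_def case_prod_unfold)
  finally have "map_spmf f (spmf_of_set {..<2 ^ Suc n}) =
      map_spmf (\<lambda>(x, y). f (of_bool x * 2 ^ n + y)) (spmf_of_set (UNIV \<times> {..<2 ^ n}))" .
  then show ?thesis
    unfolding pair_spmf_of_set[symmetric] pair_spmf_alt_def
    by (simp add: map_spmf_bind_spmf o_def map_spmf_conv_bind_spmf bind_spmf_assoc)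
qed

context machine
begin

lemma toss_once:
  assumes "ok rs lb tb" "rs 2 = 2 ^ Suc n" "rs 4 = 0" "(rs 3 + 1) * 2 ^ Suc n \<le> B"
  shows "\<exists>u. (\<forall>x. u x \<le> 4 * C) \<and> exec toss (mem xs rs lb tb) =
    map_spmf (\<lambda>x. (mem xs (rs(2 := 2 ^ n, 3 := 2 * rs 3 + of_bool x)) lb tb, u x)) coin_spmf"
proof -
  have "1 * 2 ^ Suc n \<le> (rs 3 + 1) * 2 ^ Suc n" "(rs 3 + 1) * 2 \<le> (rs 3 + 1) * 2 ^ Suc n"
    by (intro mult_le_mono; simp)+
  then have B: "2 ^ n \<le> B" "2 * rs 3 + 2 \<le> B"
    using assms(4) by simp_all
  let ?rest = "set_reg 3 (Add (Add (reg 3) (reg 3)) (reg 4)) ;; set_reg 4 (Const 0) ;; set_reg 2 (Div (reg 2) (Const 2))"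
  have "run ?rest (Suc (Suc 1)) (\<lambda>rs' lb' tb'. rs' = rs(2 := 2 ^ n, 3 := 2 * rs 3 + of_bool x) \<and> lb' = lb \<and> tb' = tb)
      (rs(4 := of_bool x)) lb tb" for x
  proof (rule run_set_reg_Seq[where v = "2 * rs 3 + of_bool x"], goal_cases)
    case 6
    then show ?case
    proof (rule run_set_reg_Seq[where v = 0], goal_cases)
      case 5
      then show ?case
        by (rule run_set_reg[where v = "2 ^ n"]) (use assms(2,3) B in \<open>auto simp: fun_eq_iff\<close>)
    qed auto
  qed (use assms B in \<open>auto intro!: ok_upd\<close>)
  then have "\<forall>x. \<exists>t. t \<le> Suc (Suc 1) * C \<and> exec ?rest (mem xs (rs(4 := of_bool x)) lb tb) =
      return_spmf (mem xs (rs(2 := 2 ^ n, 3 := 2 * rs 3 + of_bool x)) lb tb, t)"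
    unfolding run_def by blast
  then obtain u where u: "\<And>x. u x \<le> Suc (Suc 1) * C" "\<And>x. exec ?rest (mem xs (rs(4 := of_bool x)) lb tb) =
      return_spmf (mem xs (rs(2 := 2 ^ n, 3 := 2 * rs 3 + of_bool x)) lb tb, u x)"
    by metis
  define ct where "ct = acost (reg_addr 4) (mem xs rs lb tb) + size_nat (aval (reg_addr 4) (mem xs rs lb tb)) + 1"
  have "ct \<le> C"
    using Assign_cost[OF assms(1) ecost_addr(1)[of 4], of "Const 1"] by (simp add: ct_def size_nat_def compute_floorlog)
  moreover have "exec toss (mem xs rs lb tb) =
    map_spmf (\<lambda>x. (mem xs (rs(2 := 2 ^ n, 3 := 2 * rs 3 + of_bool x)) lb tb, ct + u x)) coin_spmf"
  proof -
    have flip: "exec (Flip (reg_addr 4)) (mem xs rs lb tb) =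
        map_spmf (\<lambda>x. (mem xs (rs(4 := of_bool x)) lb tb, ct)) coin_spmf"
      using mem_upd(1)[of 4 xs rs lb tb] unfolding exec.simps aval_addr ct_def map_spmf_conv_bind_spmf by simp
    show ?thesis
      unfolding toss_def exec.simps(4)[of "Flip _"] flip
      by (simp only: map_spmf_conv_bind_spmf bind_spmf_assoc return_bind_spmf fst_conv snd_conv u(2))
  qed
  moreover have "ct + u x \<le> 4 * C" for x
    using u(1)[of x] \<open>ct \<le> C\<close> by simp
  ultimately show ?thesis
    by (intro exI[of _ "\<lambda>x. ct + u x"]) blast
qed

text \<open>\<open>(rs 3 + 1) * 2 ^ n\<close> does not grow when a bit is appended, and it bounds
  both the number so far and the counter. The whole loop becomes one uniform draw of
  \<open>y\<close>, with a cost that may depend on \<open>y\<close>; what follows is deterministic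
  for each \<open>y\<close>.\<close>

lemma toss_loop:
  assumes "ok rs lb tb" "rs 2 = 2 ^ n" "rs 4 = 0" "(rs 3 + 1) * 2 ^ n \<le> B"
  shows "\<exists>t. (\<forall>y<2 ^ n. t y \<le> (5 * n + 1) * C) \<and> exec (While (Sub (reg 2) (Const 1)) toss) (mem xs rs lb tb) =
    map_spmf (\<lambda>y. (mem xs (rs(2 := 1, 3 := rs 3 * 2 ^ n + y)) lb tb, t y)) (spmf_of_set {..<2 ^ n})"
  using assms
proof (induction n arbitrary: rs)
  case 0
  let ?m = "mem xs rs lb tb" and ?g = "Sub (reg 2) (Const 1)"
  have eq: "rs(2 := 1, 3 := rs 3 * 2 ^ 0 + 0) = rs" using 0 by auto
  have "exec (While ?g toss) ?m = return_spmf (?m, acost ?g ?m)"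
    unfolding exec.simps(6) by (subst while_spmf.simps) (use 0 in simp)
  also have "\<dots> = map_spmf (\<lambda>y. (mem xs (rs(2 := 1, 3 := rs 3 * 2 ^ 0 + y)) lb tb, acost ?g ?m)) (spmf_of_set {..<2 ^ 0})"
    using eq by (simp add: lessThan_Suc spmf_of_set_singleton)
  finally have "exec (While ?g toss) ?m =
    map_spmf (\<lambda>y. (mem xs (rs(2 := 1, 3 := rs 3 * 2 ^ 0 + y)) lb tb, acost ?g ?m)) (spmf_of_set {..<2 ^ 0})" .
  moreover have "acost ?g ?m \<le> (5 * 0 + 1) * C"
    using acost_cheap[OF 0(1), of ?g] by simp
  ultimately show ?case
    by (intro exI[of _ "\<lambda>_. acost ?g ?m"]) blast
next
  case (Suc n)
  let ?m = "mem xs rs lb tb" and ?g = "Sub (reg 2) (Const 1)"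
  let ?loop = "exec (While ?g toss)"
  let ?s = "\<lambda>x. rs(2 := 2 ^ n, 3 := 2 * rs 3 + of_bool x)"
  obtain u where u: "\<And>x. u x \<le> 4 * C" "exec toss ?m = map_spmf (\<lambda>x. (mem xs (?s x) lb tb, u x)) coin_spmf"
    using toss_once[OF Suc.prems] by blast
  have ex: "\<exists>t. (\<forall>y<2 ^ n. t y \<le> (5 * n + 1) * C) \<and> ?loop (mem xs (?s x) lb tb) =
    map_spmf (\<lambda>y. (mem xs ((?s x)(2 := 1, 3 := ?s x 3 * 2 ^ n + y)) lb tb, t y)) (spmf_of_set {..<2 ^ n})" for x
  proof (rule Suc.IH)
    have "(2 * rs 3 + of_bool x + 1) * 2 ^ n \<le> (rs 3 + 1) * 2 ^ Suc n"
      by (simp add: algebra_simps)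
    then have le: "(2 * rs 3 + of_bool x + 1) * 2 ^ n \<le> B" using Suc.prems(4) by linarith
    then show "(?s x 3 + 1) * 2 ^ n \<le> B" by simp
    have "2 * rs 3 + of_bool x \<le> (2 * rs 3 + of_bool x + 1) * 2 ^ n"
      using mult_le_mono[OF order_refl[of "2 * rs 3 + of_bool x + 1"], of 1 "2 ^ n"] by simp
    moreover have "2 ^ n \<le> (2 * rs 3 + of_bool x + 1) * 2 ^ n" by simp
    ultimately show "ok (?s x) lb tb" using le Suc.prems(1) by (intro ok_upd) simp_all
  qed (use Suc.prems in auto)
  from choice[OF allI[OF ex]] obtain T where
    T': "\<forall>x. (\<forall>y<2 ^ n. T x y \<le> (5 * n + 1) * C) \<and> ?loop (mem xs (?s x) lb tb) =
      map_spmf (\<lambda>y. (mem xs ((?s x)(2 := 1, 3 := ?s x 3 * 2 ^ n + y)) lb tb, T x y)) (spmf_of_set {..<2 ^ n})" ..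
  then have T: "y < 2 ^ n \<Longrightarrow> T x y \<le> (5 * n + 1) * C" "?loop (mem xs (?s x) lb tb) =
      map_spmf (\<lambda>y. (mem xs ((?s x)(2 := 1, 3 := ?s x 3 * 2 ^ n + y)) lb tb, T x y)) (spmf_of_set {..<2 ^ n})" for x y
    by blast+
  define t where "t z = acost ?g ?m + u (2 ^ n \<le> z) + T (2 ^ n \<le> z) (z mod 2 ^ n)" for z
  let ?f = "\<lambda>z. (mem xs (rs(2 := 1, 3 := rs 3 * 2 ^ Suc n + z)) lb tb, t z)"
  have g: "aval ?g ?m \<noteq> 0" using Suc.prems(2) one_less_power[of "2::nat" "Suc n"] by simp
  have "?loop ?m =
      bind_spmf coin_spmf (\<lambda>x. map_spmf (\<lambda>y. (mem xs ((?s x)(2 := 1, 3 := ?s x 3 * 2 ^ n + y)) lb tb,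
        acost ?g ?m + u x + T x y)) (spmf_of_set {..<2 ^ n}))"
    unfolding exec.simps(6)
    by (subst while_spmf.simps)
      (simp only: g if_False u(2) T(2)[unfolded exec.simps(6)] map_spmf_conv_bind_spmf bind_spmf_assoc
        return_bind_spmf fst_conv snd_conv)
  also have "\<dots> = bind_spmf coin_spmf (\<lambda>x. map_spmf (\<lambda>y. ?f (of_bool x * 2 ^ n + y)) (spmf_of_set {..<2 ^ n}))"
  proof (intro bind_spmf_cong refl map_spmf_cong)
    fix x and y :: nat assume "y \<in> set_spmf (spmf_of_set {..<2 ^ n})"
    then have y: "y < 2 ^ n" by simp
    have "(?s x)(2 := 1, 3 := ?s x 3 * 2 ^ n + y) = rs(2 := 1, 3 := rs 3 * 2 ^ Suc n + (of_bool x * 2 ^ n + y))"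
      by (simp add: fun_eq_iff algebra_simps)
    moreover have "t (of_bool x * 2 ^ n + y) = acost ?g ?m + u x + T x y"
      using y by (cases x) (simp_all add: t_def)
    ultimately show "(mem xs ((?s x)(2 := 1, 3 := ?s x 3 * 2 ^ n + y)) lb tb, acost ?g ?m + u x + T x y) =
       ?f (of_bool x * 2 ^ n + y)" by simp
  qed
  also have "\<dots> = map_spmf ?f (spmf_of_set {..<2 ^ Suc n})"
    by (rule spmf_of_set_double)
  finally have "?loop ?m = map_spmf ?f (spmf_of_set {..<2 ^ Suc n})" .
  moreover have "t z \<le> (5 * Suc n + 1) * C" for z
    using acost_cheap[OF Suc.prems(1), of ?g] u(1)[of "2 ^ n \<le> z"] T(1)[of "z mod 2 ^ n" "2 ^ n \<le> z"]
    by (simp add: t_def algebra_simps)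
  ultimately show ?case by (intro exI[of _ t]) blast
qed

end

subsection \<open>Filling the tables\<close>

definition update_e :: "nat \<Rightarrow> aexp" where
  "update_e ty = (if ty = 0 then introduce_e else if ty = 1 then union_e else if ty = 2 then relabel_e else join_e)"

lemma less_5_cases: "d < 5 \<Longrightarrow> d = 0 \<or> d = 1 \<or> d = 2 \<or> d = 3 \<or> d = (4::nat)"
  by linarith

lemma aval_allows_e:
  assumes "aval e m = d" "d < 5" "a \<in> {1,2,3}"
  shows "aval (allows_e e a) m = of_bool (allows d a)"
  using less_5_cases[OF assms(2)] assms(3)
  by (elim disjE insertE emptyE) (simp_all add: allows_e_def allows_def assms(1))

lemma aval_meet_e:
  assumes "aval e m = d" "d < 5" "a \<in> {1,2,3}"
  shows "aval (meet_e e a) m = meet d a"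
  using assms(3) by (auto simp: meet_e_def aval_allows_e[OF assms] allows_def meet_def)

lemma meet_le: "a \<in> {1,2,3} \<Longrightarrow> meet d a \<le> d"
  by (auto simp: meet_def)

text \<open>The stack holds at most one table per processed node, so
  \<open>length xs * 5 ^ card \<Lambda>\<close> bounds its height; \<open>P ^ W\<close> bounds the
  power of \<open>P\<close> computed at a node.\<close>

locale tables = machine +
  fixes \<Lambda> :: "nat set" and r lb :: "nat \<Rightarrow> nat" and N P W :: nat
  assumes pv: "place_values \<Lambda> r lb"
    and N_pos: "0 < N" and P_pos: "0 < P"
    and pow_le: "P ^ W \<le> B" and W_le: "W \<le> B" and len_le: "length xs < B"
    and Q_le: "length xs * 5 ^ card \<Lambda> \<le> B" and xs_ne: "xs \<noteq> []"
begin

definition Q :: nat where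
  "Q = 5 ^ card \<Lambda>"

text \<open>The default 0 for labels outside \<open>\<Lambda>\<close> is harmless:
  \<open>iterate_main\<close> assumes \<open>labels t \<subseteq> \<Lambda>\<close>, so they have no
  vertices.\<close>

definition state_of :: "nat \<Rightarrow> nat \<Rightarrow> nat" where
  "state_of S l = (if l \<in> \<Lambda> then digit 5 (r l) S else 0)"

lemma r_less: "l \<in> \<Lambda> \<Longrightarrow> r l < card \<Lambda>"
  using pv by (auto simp: place_values_def)

lemma r_inj: "i \<in> \<Lambda> \<Longrightarrow> j \<in> \<Lambda> \<Longrightarrow> r i = r j \<longleftrightarrow> i = j"
  using pv by (auto simp: place_values_def dest: inj_onD)

lemma lb_eq: "l \<in> \<Lambda> \<Longrightarrow> lb l = 5 ^ r l"
  using pv by (simp add: place_values_def)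

lemma Q_le_B: "Q \<le> B"
proof -
  have "1 * Q \<le> length xs * Q"
    using xs_ne by (intro mult_le_mono1) (simp add: Suc_le_eq)
  then show ?thesis using Q_le unfolding Q_def by linarith
qed

lemma state_of_less: "state_of S l < 5"
  by (simp add: state_of_def digit_less)

lemma state_of_eq: "l \<in> \<Lambda> \<Longrightarrow> S div 5 ^ r l mod 5 = state_of S l"
  by (simp add: state_of_def digit_def)

lemma state_of_set_digit:
  "l \<in> \<Lambda> \<Longrightarrow> a < 5 \<Longrightarrow> state_of (set_digit 5 (r l) a S) = (state_of S)(l := a)"
  by (auto simp: fun_eq_iff state_of_def digit_set_digit r_inj)

lemma set_digit_less_Q: "l \<in> \<Lambda> \<Longrightarrow> a < 5 \<Longrightarrow> S < Q \<Longrightarrow> set_digit 5 (r l) a S < Q"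
  unfolding Q_def by (intro set_digit_less r_less) auto

lemma set_digit_state: "l \<in> \<Lambda> \<Longrightarrow> S - state_of S l * 5 ^ r l + a * 5 ^ r l = set_digit 5 (r l) a S"
  by (simp add: set_digit_def state_of_def)

text \<open>\<open>V\<close> is the table at offset \<open>u\<close> after a node of type \<open>ty\<close>. The table is overwritten in place, from
  the last state to the first one.\<close>

definition writes :: "nat \<Rightarrow> nat \<Rightarrow> nat \<Rightarrow> nat \<Rightarrow> nat \<Rightarrow> (nat \<Rightarrow> nat) \<Rightarrow> (nat \<Rightarrow> nat) \<Rightarrow> bool" where
  "writes ty u i j e tb V \<longleftrightarrow> (\<forall>S rs' tb'. S < Q \<longrightarrow> rs' 6 = Q \<longrightarrow> rs' 7 = ty \<longrightarrow> rs' 8 = 5 ^ r i \<longrightarrow> rs' 9 = 5 ^ r j \<longrightarrow>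
     rs' 11 = e \<longrightarrow> rs' 12 = u + Q \<longrightarrow> rs' 13 = S \<longrightarrow> rs' 14 = state_of S i \<longrightarrow> rs' 15 = state_of S j \<longrightarrow>
     (\<forall>a. tb' a = (if u + S < a \<and> a < u + Q then V (a - u) else tb a)) \<longrightarrow>
     aval (update_e ty) (mem xs rs' lb tb') = V S \<and> V S \<le> B)"

lemma run_update:
  assumes "ok rs lb' tb" "aval (update_e (rs 7)) (mem xs rs lb' tb) = v" "v \<le> B"
    and "aval (Add target (reg 13)) (mem xs rs lb' tb) = a" "R rs lb' (tb(a := v))"
  shows "run update 4 R rs lb' tb"
proof -
  have st: "run (store (update_e (rs 7))) n R rs lb' tb" if "1 \<le> n" for n
    unfolding store_def
  proof (rule run_conseq[where Q = R and n = 1])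
    show "run (set_tab (Add target (reg 13)) (update_e (rs 7))) 1 R rs lb' tb"
      by (rule run_set_tab[where v = v and i = a]) (fact assms | simp add: update_e_def)+
  qed (use that in auto)
  have "run update (Suc (Suc (Suc 1))) R rs lb' tb"
    unfolding update_def
  proof (rule run_If[OF assms(1)], simp, rule run_If[OF assms(1)], simp, rule run_If[OF assms(1)], simp)
    assume *: "aval (reg 7) (mem xs rs lb' tb) \<noteq> 0" "aval (Sub (reg 7) (Const 1)) (mem xs rs lb' tb) \<noteq> 0"
      "aval (Sub (reg 7) (Const 2)) (mem xs rs lb' tb) \<noteq> 0"
    have "update_e (rs 7) = join_e" using * by (simp add: update_e_def)
    then show "run (store join_e) 1 R rs lb' tb" using st[of 1] by simp
  next
    assume *: "aval (reg 7) (mem xs rs lb' tb) \<noteq> 0" "aval (Sub (reg 7) (Const 1)) (mem xs rs lb' tb) \<noteq> 0"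
      "aval (Sub (reg 7) (Const 2)) (mem xs rs lb' tb) = 0"
    then have "rs 7 = 2" by simp
    then show "run (store relabel_e) 1 R rs lb' tb" using st[of 1] by (simp add: update_e_def)
  next
    assume *: "aval (reg 7) (mem xs rs lb' tb) \<noteq> 0" "aval (Sub (reg 7) (Const 1)) (mem xs rs lb' tb) = 0"
    then have "rs 7 = 1" by simp
    then show "run (store union_e) (Suc 1) R rs lb' tb" using st[of "Suc 1"] by (simp add: update_e_def)
  next
    assume "aval (reg 7) (mem xs rs lb' tb) = 0"
    then show "run (store introduce_e) (Suc (Suc 1)) R rs lb' tb" using st[of "Suc (Suc 1)"] by (simp add: update_e_def)
  qed
  then show ?thesis by (rule run_conseq) simp_all
qed

lemma run_state_loop:
  assumes ok: "ok rs lb tb" and ij: "i \<in> \<Lambda>" "j \<in> \<Lambda>"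
    and rs: "rs 6 = Q" "rs 7 = ty" "rs 8 = 5 ^ r i" "rs 9 = 5 ^ r j" "rs 11 = e" "rs 12 = u + Q" "rs 13 = Q"
    and V: "writes ty u i j e tb V"
  shows "run (While (reg 13) state_step) (Suc (Q * Suc 7)) (\<lambda>rs' lb' tb'. lb' = lb \<and>
    (\<forall>c. c \<notin> {13,14,15} \<longrightarrow> rs' c = rs c) \<and> tb' = (\<lambda>a. if u \<le> a \<and> a < u + Q then V (a - u) else tb a)) rs lb tb"
proof -
  let ?I = "\<lambda>n rs' lb' tb'. lb' = lb \<and> rs' 13 = Q - n \<and>
    (\<forall>c. c \<notin> {13,14,15} \<longrightarrow> rs' c = rs c) \<and> tb' = (\<lambda>a. if u + (Q - n) \<le> a \<and> a < u + Q then V (a - u) else tb a)"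
  show ?thesis
  proof (rule run_While_invariant[OF ok, where I = ?I])
    fix n rs1 lb1 tb1
    assume n: "n < Q" and I: "?I n rs1 lb1 tb1" and ok1: "ok rs1 lb1 tb1"
    show "aval (reg 13) (mem xs rs1 lb1 tb1) \<noteq> 0" using n I by simp
    define S where "S = Q - Suc n"
    have S: "S < Q" "Q - n = Suc S" using n by (auto simp: S_def)
    have rs1: "rs1 6 = Q" "rs1 7 = ty" "rs1 8 = 5 ^ r i" "rs1 9 = 5 ^ r j" "rs1 11 = e" "rs1 12 = u + Q"
      using I rs by simp_all
    have small: "state_of S l \<le> B" for l
    proof -
      have "state_of S l \<le> digit 5 (r l) S" by (simp add: state_of_def)
      also have "\<dots> \<le> S" 
        unfolding digit_def by (metis div_le_dividend le_trans mod_less_eq_dividend)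
      finally show ?thesis using S Q_le_B by linarith
    qed
    let ?rs = "rs1(13 := S, 14 := state_of S i, 15 := state_of S j)"
    have v: "aval (update_e ty) (mem xs ?rs lb tb1) = V S \<and> V S \<le> B"
      using V[unfolded writes_def, rule_format, of S ?rs tb1] S rs1 I by (auto simp: Suc_le_eq)
    have "run state_step (Suc (Suc (Suc 4))) (?I (Suc n)) rs1 lb1 tb1"
      unfolding state_step_def
    proof (rule run_set_reg_Seq[OF ok1, where v = S], goal_cases)
      case 5
      show ?case
      proof (rule run_set_reg_Seq[OF 5, where v = "state_of S i"], goal_cases)
        case 5
        show ?case
        proof (rule run_set_reg_Seq[OF 5, where v = "state_of S j"], goal_cases)
          case 5
          show ?case
          proof (rule run_update[OF 5, where v = "V S" and a = "u + S"], goal_cases)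
            case 4
            have "(\<lambda>a. if u + (Q - n) \<le> a \<and> a < u + Q then V (a - u) else tb a)(u + S := V S) =
                (\<lambda>a. if u + (Q - Suc n) \<le> a \<and> a < u + Q then V (a - u) else tb a)"
              using S by (auto simp: fun_eq_iff S_def[symmetric])
            then show ?case using I by (simp add: S_def)
          qed (use v rs1 I in \<open>auto simp: target_def\<close>)
        qed (use ij rs1 small in \<open>auto simp: state_of_eq\<close>)
      qed (use ij rs1 small in \<open>auto simp: state_of_eq\<close>)
    qed (use S I Q_le_B in auto)
    then show "run state_step 7 (?I (Suc n)) rs1 lb1 tb1"
      by (rule run_conseq) simp_all
  qed (use rs in auto)
qed

lemma run_power_loop:
  assumes "ok rs lb' tb" "rs 1 = P" "rs 10 \<le> W"
  shows "run power_loop (Suc (Suc (W * 3))) (\<lambda>rs' lb'' tb'. lb'' = lb' \<and> tb' = tb \<and> rs' 11 = P ^ rs 10 \<and>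
    (\<forall>c. c \<notin> {10,11} \<longrightarrow> rs' c = rs c)) rs lb' tb" (is "run _ _ ?R _ _ _")
proof -
  have le: "P ^ n \<le> B" if "n \<le> rs 10" for n
    using power_increasing[of n W P] that assms(3) P_pos pow_le by simp
  let ?I = "\<lambda>n rs' lb'' tb'. lb'' = lb' \<and> tb' = tb \<and> rs' 11 = P ^ n \<and> rs' 10 = rs 10 - n \<and>
    (\<forall>c. c \<notin> {10,11} \<longrightarrow> rs' c = rs c)"
  have "run power_loop (Suc (Suc (rs 10 * Suc 2))) ?R rs lb' tb"
    unfolding power_loop_def
  proof (rule run_set_reg_Seq[OF assms(1), where v = 1], goal_cases)
    case 5
    then show ?case
    proof (rule run_While_invariant[where I = ?I])
      fix n rs1 lb1 tb1 assume n: "n < rs 10" and I: "?I n rs1 lb1 tb1" and ok1: "ok rs1 lb1 tb1"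
      show "aval (reg 10) (mem xs rs1 lb1 tb1) \<noteq> 0" using n I by simp
      have "P ^ Suc n \<le> B" using le[of "Suc n"] n by simp
      moreover have "rs 10 - Suc n \<le> B" using okD(1)[OF assms(1), of 10] by simp
      ultimately have "run (set_reg 11 (Mul (reg 11) (reg 1)) ;; set_reg 10 (Sub (reg 10) (Const 1))) (Suc 1) (?I (Suc n)) rs1 lb1 tb1"
        using I assms(2)
        by (intro run_set_reg_Seq[OF ok1, where v = "P ^ Suc n"] run_set_reg[where v = "rs 10 - Suc n"])
          (auto simp: mult.commute)
      then show "run (set_reg 11 (Mul (reg 11) (reg 1)) ;; set_reg 10 (Sub (reg 10) (Const 1))) 2 (?I (Suc n)) rs1 lb1 tb1"
        by (simp add: numeral_2_eq_2)
    qed auto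
  qed (use le[of 0] in auto)
  then show ?thesis
    by (rule run_conseq) (use assms(3) in auto)
qed

lemma run_main_node:
  assumes x: "xs = pre @ [ty, f1, f2, f3] @ post" and 5: "rs 5 = Suc (length pre)"
    and ok: "ok rs lb tb" and rs: "rs 0 = N" "rs 1 = P" "rs 6 = Q"
    and f: "f1 \<in> \<Lambda>" "j = (if ty = 0 then 0 else f2)" "j \<in> \<Lambda>"
    and w: "w = f3 * (N * length xs) + rs 3 mod N" "w \<le> W"
    and top: "u + Q = rs 12 + Q * (1 - ty) - Q * (1 - ((ty - 1) + (1 - ty)))" "u + Q \<le> B"
    and V: "writes ty u f1 j (P ^ w) tb V"
  shows "run main_node (11 + 3 * W + 8 * Q) (\<lambda>rs' lb' tb'. lb' = lb \<and> rs' 0 = N \<and> rs' 1 = P \<and> rs' 3 = rs 3 div N \<and>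
    rs' 5 = Suc (length pre + 4) \<and> rs' 6 = Q \<and> rs' 12 = u + Q \<and>
    tb' = (\<lambda>a. if u \<le> a \<and> a < u + Q then V (a - u) else tb a)) rs lb tb" (is "run _ _ ?R _ _ _")
proof -
  note nf = node_fields[OF x]
  have k: "lb f1 \<le> B" "lb j \<le> B" using okD(2)[OF ok] by auto
  have dw: "aval digit_weight (mem xs s lb tb) = w" if "s 5 = Suc (length pre)" "s 0 = N" "s 3 = rs 3" for s
    unfolding digit_weight_def using nf(4)[of s, OF that(1)] that w by simp
  have Zd: "rs 3 div N \<le> B" using okD(1)[OF ok, of 3] div_le_dividend[of "rs 3" N] by linarith
  have "run main_node (Suc (Suc (Suc (Suc (Suc (Suc (Suc (Suc (W * 3)) + Suc (Suc (Suc (Q * Suc 7)))))))))) ?R rs lb tb"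
    unfolding main_node_def
  proof (rule run_set_reg_Seq[OF ok, where v = ty], goal_cases)
    case 5
    show ?case
    proof (rule run_set_reg_Seq[OF 5, where v = "lb f1"], goal_cases)
      case 5
      show ?case
      proof (rule run_set_reg_Seq[OF 5, where v = "lb j"], goal_cases)
        case 5
        show ?case
        proof (rule run_set_reg_Seq[OF 5, where v = w], goal_cases)
          case 5
          show ?case
          proof (rule run_set_reg_Seq[OF 5, where v = "rs 3 div N"], goal_cases)
            case 5
            show ?case
            proof (rule run_set_reg_Seq[OF 5, where v = "Suc (length pre + 4)"], goal_cases)
              case 5
              show ?case
              proof (rule run_Seq'[OF run_power_loop[OF 5]], goal_cases)
                case (3 rs1 lb1 tb1)
                then have 1: "lb1 = lb" "tb1 = tb" "rs1 11 = P ^ w" "rs1 0 = N" "rs1 1 = P" "rs1 3 = rs 3 div N"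
                  "rs1 5 = Suc (length pre + 4)" "rs1 6 = Q" "rs1 7 = ty" "rs1 8 = lb f1" "rs1 9 = lb j" "rs1 12 = rs 12"
                  using rs by auto
                have mt: "aval move_top (mem xs rs1 lb1 tb1) = u + Q"
                  unfolding top(1) move_top_def using 1 by simp
                show ?case
                proof (rule run_set_reg_Seq[OF 3(1), where v = "u + Q"], goal_cases)
                  case 5
                  show ?case
                  proof (rule run_set_reg_Seq[OF 5, where v = Q], goal_cases)
                    case 5
                    then show ?case
                      unfolding 1(1,2)
                      by (rule run_conseq[OF run_state_loop[where i = f1 and j = j and V = V and e = "P ^ w" and u = u and ty = ty]])
                        (use 1 f V in \<open>auto simp: lb_eq\<close>)
                  qed (use 1 Q_le_B in auto)
                qed (simp_all add: mt top(2))
              qed (use rs w in auto)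
            qed (use 5 len_le nf(7)[of rs] assms(2) in auto)
          qed (use rs Zd in auto)
        qed (use assms(2) rs w(2) W_le in \<open>simp_all add: dw\<close>)
      qed (use nf(3) assms(2) f k in auto)
    qed (use nf(2) assms(2) k in auto)
  qed (use nf(1,6) assms(2) in auto)
  then show ?thesis
    by (rule run_conseq) auto
qed

end

text \<open>The program divides the random number by \<open>N\<close> once per node, so a vertex
  receives the digit whose position is the number of its introduce node in postfix order. Distinct
  positions make \<open>\<rho>\<close> injective, as the isolation lemma requires.\<close>

primrec placed :: "('v \<Rightarrow> nat) \<Rightarrow> nat \<Rightarrow> 'v cexp \<Rightarrow> bool" where
  "placed \<rho> n (Introduce l v) \<longleftrightarrow> \<rho> v = n"
| "placed \<rho> n (DUnion t u) \<longleftrightarrow> placed \<rho> n t \<and> placed \<rho> (n + node_count t) u"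
| "placed \<rho> n (Relabel i j t) \<longleftrightarrow> placed \<rho> n t"
| "placed \<rho> n (Join i j t) \<longleftrightarrow> placed \<rho> n t"

lemma placed_range: "placed \<rho> n t \<Longrightarrow> v \<in> verts t \<Longrightarrow> n \<le> \<rho> v \<and> \<rho> v < n + node_count t"
  by (induction t arbitrary: n) force+

lemma placed_inj: "placed \<rho> n t \<Longrightarrow> inj_on \<rho> (verts t)"
proof (induction t arbitrary: n)
  case (DUnion t u)
  have "\<rho> a \<noteq> \<rho> b" if "a \<in> verts t" "b \<in> verts u" for a b
    using placed_range[of \<rho> n t a] placed_range[of \<rho> "n + node_count t" u b] that DUnion.prems by auto
  then have "\<rho> ` (verts t - verts u) \<inter> \<rho> ` (verts u - verts t) = {}" by force
  moreover have "inj_on \<rho> (verts t)" "inj_on \<rho> (verts u)"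
    using DUnion by auto
  ultimately show ?case by (simp add: inj_on_Un)
qed auto

lemma placed_cong: "(\<And>v. v \<in> verts t \<Longrightarrow> \<rho> v = \<rho>' v) \<Longrightarrow> placed \<rho> n t = placed \<rho>' n t"
  by (induction t arbitrary: n) auto

lemma placed_exists: "k_expression k t \<Longrightarrow> \<exists>\<rho>. placed \<rho> n t"
proof (induction t arbitrary: n)
  case (Introduce l v)
  show ?case by (auto intro: exI[of _ "\<lambda>_. n"])
next
  case (DUnion t u)
  then obtain \<rho> \<rho>' where p: "placed \<rho> n t" "placed \<rho>' (n + node_count t) u" by fastforce
  let ?\<rho> = "\<lambda>v. if v \<in> verts t then \<rho> v else \<rho>' v"
  have "placed ?\<rho> n t" using p(1) placed_cong[of t ?\<rho> \<rho>] by simp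
  moreover have "v \<in> verts u \<Longrightarrow> v \<notin> verts t" for v using DUnion.prems by auto
  then have "placed ?\<rho> (n + node_count t) u" using p(2) placed_cong[of u ?\<rho> \<rho>'] by simp
  ultimately show ?case by auto
qed auto

lemma node_count_pos: "1 \<le> node_count t"
  by (induction t) auto

lemma card_verts: "card (verts t) \<le> node_count t"
proof (induction t)
  case (DUnion t u)
  then show ?case using card_Un_le[of "verts t" "verts u"] by simp
qed auto

lemma div_power_Suc: "Z div N ^ n div N = Z div (N :: nat) ^ Suc n"
  by (simp only: power_Suc2 div_mult2_eq)

context tables
begin

section \<open>Correctness of the table updates in place\<close>

lemma writes_introduce:
  assumes "l \<in> \<Lambda>" "\<And>S. dp P w (Introduce l v) (state_of S) \<le> B"
  shows "writes 0 u l j (P ^ w v) tb (\<lambda>S. dp P w (Introduce l v) (state_of S))"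
  unfolding writes_def
proof (intro allI impI conjI assms(2), goal_cases)
  case (1 S rs' tb')
  then have "aval (reg 14) (mem xs rs' lb tb') = state_of S l" by simp
  from aval_allows_e[OF this state_of_less]
  have "aval introduce_e (mem xs rs' lb tb') = 1 + (of_bool (allows (state_of S l) 1) * P ^ w v +
      (of_bool (allows (state_of S l) 2) * P ^ w v + of_bool (allows (state_of S l) 3) * 3))"
    using 1 by (simp add: introduce_e_def)
  moreover have "{0..3} = {0, 1, 2, 3::nat}" by auto
  ultimately show ?case
    by (simp add: update_e_def color_weight_def allows_def)
qed

text \<open>The second table lies above the region being overwritten, and entry \<open>S\<close> of
  the first is still intact when it is read.\<close>

lemma writes_union:
  assumes "\<And>S. S < Q \<Longrightarrow> tb (u + S) = f S" "\<And>S. S < Q \<Longrightarrow> tb (u + Q + S) = g S" "\<And>S. f S * g S \<le> B"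
  shows "writes 1 u i j e tb (\<lambda>S. f S * g S)"
  unfolding writes_def
proof (intro allI impI conjI assms(3), goal_cases)
  case (1 S rs' tb')
  have "tb' (u + S) = f S" "tb' (u + Q + S) = g S"
    using 1(11) assms(1,2)[OF 1(1)] by simp_all
  then show ?case
    using 1 by (simp add: update_e_def union_e_def target_def)
qed

text \<open>The entry read may lie above \<open>S\<close> and be overwritten already. This does no
  harm: its state gives \<open>i\<close> and \<open>j\<close> the same value, so the relabelling
  sends it to itself and its old and new contents agree.\<close>

lemma writes_relabel:
  assumes "i \<in> \<Lambda>" "\<And>S. S < Q \<Longrightarrow> tb (u + S) = dp P w t (state_of S)"
    and "\<And>s. dp P w t s \<le> B"
  shows "writes 2 u i j e tb (\<lambda>S. dp P w (Relabel i j t) (state_of S))"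
  unfolding writes_def
proof (intro allI impI conjI, goal_cases)
  case (1 S rs' tb')
  let ?S = "set_digit 5 (r i) (state_of S j) S"
  have S: "?S < Q" using set_digit_less_Q[OF assms(1) state_of_less 1(1)] .
  have st: "state_of ?S = (state_of S)(i := state_of S j)"
    by (rule state_of_set_digit[OF assms(1) state_of_less])
  have "S - state_of S i * 5 ^ r i + state_of S j * 5 ^ r i = ?S"
    by (rule set_digit_state[OF assms(1)])
  then have "aval relabel_e (mem xs rs' lb tb') = tb' (u + ?S)"
    using 1 by (simp add: relabel_e_def target_def)
  also have "\<dots> = dp P w (Relabel i j t) (state_of S)"
    using 1(11) S assms(2)[OF S] st by simp
  finally show ?case by (simp add: update_e_def)
next
  case (2 S rs' tb')
  then show ?case using assms(3) by simp
qed

text \<open>All entries consulted arise from \<open>S\<close> by lowering the digits of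
  \<open>i\<close> and \<open>j\<close>. Their indices are at most \<open>S\<close>, so they still
  hold the old values.\<close>

lemma writes_join:
  assumes "i \<in> \<Lambda>" "j \<in> \<Lambda>" "i \<noteq> j" "\<And>S. S < Q \<Longrightarrow> tb (u + S) = dp P w t (state_of S)"
    and "\<And>S. dp P w (Join i j t) (state_of S) \<le> B"
  shows "writes 3 u i j e tb (\<lambda>S. dp P w (Join i j t) (state_of S))"
  unfolding writes_def
proof (intro allI impI conjI assms(5), goal_cases)
  case (1 S rs' tb')
  let ?m = "mem xs rs' lb tb'" and ?s = "state_of S i" and ?t = "state_of S j"
  let ?f = "\<lambda>a b. dp P w t ((state_of S)(i := a, j := b))"
  have look: "aval (look ea eb) ?m = ?f a b"
    if ab: "aval ea ?m = a" "aval eb ?m = b" "a \<le> ?s" "b \<le> ?t" for ea eb a b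
  proof -
    have a: "a < 5" "b < 5" using that state_of_less[of S i] state_of_less[of S j] by linarith+
    let ?S1 = "set_digit 5 (r i) a S"
    let ?S2 = "set_digit 5 (r j) b ?S1"
    have S1: "state_of ?S1 = (state_of S)(i := a)" by (rule state_of_set_digit[OF assms(1) a(1)])
    have S2: "state_of ?S2 = (state_of S)(i := a, j := b)"
      using state_of_set_digit[OF assms(2) a(2), of ?S1] S1 by simp
    have d: "digit 5 (r i) S = ?s" "digit 5 (r j) ?S1 = ?t"
      using assms(1,2,3) fun_cong[OF S1, of j] by (simp_all add: state_of_def)
    have "?S2 \<le> ?S1" "?S1 \<le> S"
      using set_digit_mono[of a 5 "r i" S] set_digit_mono[of b 5 "r j" ?S1] ab d by simp_all
    then have le: "?S2 \<le> S" "?S2 < Q" using 1(1) by linarith+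
    have "?S1 - ?t * 5 ^ r j + b * 5 ^ r j = ?S2"
      using d(2) by (simp add: set_digit_def)
    then have "aval (look ea eb) ?m = tb' (u + ?S2)"
      using 1 ab(1,2) set_digit_state[OF assms(1), of S a]
      by (simp add: look_def target_def)
    also have "\<dots> = ?f a b"
      using 1(11) le assms(4)[OF le(2)] S2 by simp
    finally show ?thesis .
  qed
  have r: "aval (reg 14) ?m = ?s" "aval (reg 15) ?m = ?t" "aval (Const 0) ?m = 0" using 1 by simp_all
  note m = aval_meet_e[OF r(1) state_of_less] aval_meet_e[OF r(2) state_of_less]
  have jt: "aval (join_term a) ?m = ?f (meet ?s a) (meet ?t a) + 3 * (?f 0 (meet ?t a) + ?f (meet ?s a) 0)"
    if "a \<in> {1,2,3}" for a
    using look[OF m(1)[OF that] m(2)[OF that] meet_le[OF that] meet_le[OF that]]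
      look[OF r(3) m(2)[OF that] _ meet_le[OF that]] look[OF m(1)[OF that] r(3) meet_le[OF that]]
    by (simp add: join_term_def)
  have "aval join_e ?m = ?f 0 ?t + ?f ?s 0 + 2 * ?f 0 0 +
      (aval (join_term 1) ?m + (aval (join_term 2) ?m + aval (join_term 3) ?m))"
    using look[OF r(3,2)] look[OF r(1,3)] look[OF r(3,3)] by (simp add: join_e_def)
  also have "\<dots> = join_sum ?f ?s ?t"
    by (simp add: jt join_sum_def)
  finally show ?case by (simp add: update_e_def)
qed

text \<open>\<open>at_node Z n u\<close>: the first \<open>n\<close> nodes have been processed, and the table stack ends at \<open>u\<close>.
  \<open>computed\<close> says that the topmost table holds \<open>f\<close> and that the tables below are those of \<open>tb0\<close>.\<close>

definition at_node :: "nat \<Rightarrow> nat \<Rightarrow> nat \<Rightarrow> (nat \<Rightarrow> nat) \<Rightarrow> (nat \<Rightarrow> nat) \<Rightarrow> bool" where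
  "at_node Z n u rs lb' \<longleftrightarrow> lb' = lb \<and> rs 0 = N \<and> rs 1 = P \<and> rs 6 = Q \<and> rs 3 = Z div N ^ n \<and> rs 5 = Suc (Suc (4 * n)) \<and> rs 12 = u"

definition computed :: "nat \<Rightarrow> nat \<Rightarrow> nat \<Rightarrow> (nat \<Rightarrow> nat) \<Rightarrow> ((nat \<Rightarrow> nat) \<Rightarrow> nat) \<Rightarrow>
    (nat \<Rightarrow> nat) \<Rightarrow> (nat \<Rightarrow> nat) \<Rightarrow> (nat \<Rightarrow> nat) \<Rightarrow> bool" where
  "computed Z n u tb0 f rs lb' tb \<longleftrightarrow> at_node Z n (u + Q) rs lb' \<and> (\<forall>a<u. tb a = tb0 a) \<and> (\<forall>S<Q. tb (u + S) = f (state_of S))"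

text \<open>\<open>u \<le> n * Q\<close> expresses that each of the first \<open>n\<close> nodes has
  pushed at most one table; it keeps the stack within \<open>B\<close>.\<close>

lemma iterate_main_node:
  assumes x: "xs = pre @ [ty, f1, f2, f3] @ post" and l: "length pre = Suc (4 * n)"
    and ok: "ok rs lb tb" and at: "at_node Z n v rs lb"
    and v: "v = (if ty = 0 then u else if ty = 1 then u + Q + Q else u + Q)" and u: "u \<le> n * Q"
    and f: "f1 \<in> \<Lambda>" "j = (if ty = 0 then 0 else f2)" "j \<in> \<Lambda>"
    and w: "w = f3 * (N * length xs) + digit N n Z" "w \<le> W"
    and V: "writes ty u f1 j (P ^ w) tb (\<lambda>S. f (state_of S))" and tb0: "\<And>a. a < u \<Longrightarrow> tb a = tb0 a"
  shows "iterate nodes_left main_node (12 + 3 * W + 8 * Q) (computed Z (Suc n) u tb0 f) rs lb tb"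
proof -
  have s5: "rs 5 = Suc (length pre)" using at l by (simp add: at_node_def)
  have "n + 1 \<le> length xs" using x l by simp
  then have "(n + 1) * Q \<le> length xs * Q" by (rule mult_le_mono1)
  then have "u + Q \<le> B" using u Q_le by (simp add: Q_def)
  moreover have "u + Q = rs 12 + Q * (1 - ty) - Q * (1 - ((ty - 1) + (1 - ty)))"
    using at v by (auto simp: at_node_def)
  ultimately have r: "run main_node (11 + 3 * W + 8 * Q) (\<lambda>rs' lb' tb'. lb' = lb \<and> rs' 0 = N \<and> rs' 1 = P \<and> rs' 3 = rs 3 div N \<and>
    rs' 5 = Suc (length pre + 4) \<and> rs' 6 = Q \<and> rs' 12 = u + Q \<and>
    tb' = (\<lambda>a. if u \<le> a \<and> a < u + Q then f (state_of (a - u)) else tb a)) rs lb tb"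
    by (intro run_main_node[OF x s5 ok, where j = j and w = w]) (use at f w V in \<open>auto simp: at_node_def digit_def\<close>)
  show ?thesis
    by (rule iterate_conseq[OF iterate_step[OF ok _ node_fields(5)[OF x, of rs, OF s5] r]])
      (use at l tb0 in \<open>auto simp: computed_def at_node_def div_power_Suc simp del: power_Suc\<close>)
qed

lemma iterate_main_unary:
  assumes IH: "iterate nodes_left main_node m (computed Z n u tb f) rs lb tb"
    and x: "xs = pre @ [ty, i, j, 0] @ post" "length pre = Suc (4 * n)" and ty: "ty \<noteq> 0" "ty \<noteq> 1"
    and u: "u \<le> n * Q" and ij: "i \<in> \<Lambda>" "j \<in> \<Lambda>" and N: "N \<le> W"
    and V: "\<And>e tb. (\<And>S. S < Q \<Longrightarrow> tb (u + S) = f (state_of S)) \<Longrightarrow> writes ty u i j e tb (\<lambda>S. g (state_of S))"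
  shows "iterate nodes_left main_node (m + (12 + 3 * W + 8 * Q)) (computed Z (Suc n) u tb g) rs lb tb"
proof (rule iterate_trans'[OF IH], goal_cases)
  case (1 rs1 lb1 tb1)
  note h = 1[unfolded computed_def]
  have lb1: "lb1 = lb" using h by (simp add: at_node_def)
  have "digit N n Z \<le> W" using N digit_less[OF N_pos, of n Z] by linarith
  moreover have "writes ty u i j (P ^ digit N n Z) tb1 (\<lambda>S. g (state_of S))"
    by (rule V) (use h in simp)
  ultimately show ?case
    unfolding lb1
    by (intro iterate_main_node[where pre = pre and post = post and ty = ty and v = "u + Q" and w = "digit N n Z" and j = j])
      (use x ty u ij h lb1 in auto)
qed

text \<open>As in any postfix evaluation, a subexpression pushes exactly one result and preserves
  the stack below it, so the table of the left operand of a union survives the evaluation of the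
  right one.\<close>

lemma iterate_main:
  assumes "xs = pre @ encode_cexp c t @ post" "length pre = Suc (4 * n)" "placed \<rho> n t" "labels t \<subseteq> \<Lambda>" "k_expression k t"
    and "ok rs lb tb" "at_node Z n u rs lb" "u \<le> n * Q"
    and "\<And>v. v \<in> verts t \<Longrightarrow> w v = c v * (N * length xs) + digit N (\<rho> v) Z" "\<And>v. v \<in> verts t \<Longrightarrow> w v \<le> W" "N \<le> W"
    and "25 ^ node_count t * P ^ sum w (verts t) \<le> B"
  shows "iterate nodes_left main_node (node_count t * (12 + 3 * W + 8 * Q))
    (computed Z (n + node_count t) u tb (dp P w t)) rs lb tb"
  using assms
proof (induction t arbitrary: pre post n rs tb u)
  case (Introduce l v)
  note pr = Introduce.prems
  have le: "dp P w (Introduce l v) s \<le> B" for s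
    using dp_le[OF pr(5), of P w s] P_pos pr(12) by simp
  have "iterate nodes_left main_node (12 + 3 * W + 8 * Q) (computed Z (Suc n) u tb (dp P w (Introduce l v))) rs lb tb"
    by (rule iterate_main_node[where pre = pre and j = 0 and w = "w v" and v = u and ty = 0 and post = post])
      (use pr writes_introduce[of l w v u 0 tb, OF _ le] in auto)
  then show ?case by (simp del: dp.simps)
next
  case (DUnion t t')
  note pr = DUnion.prems
  have kt: "k_expression k t" "k_expression k t'" using pr(5) by auto
  have sum: "sum w (verts (DUnion t t')) = sum w (verts t) + sum w (verts t')"
    using pr(5) by (simp add: sum.union_disjoint)
  have P1: "1 \<le> P" using P_pos by simp
  have "25 ^ a * P ^ b \<le> B" if "a \<le> node_count (DUnion t t')" "b \<le> sum w (verts (DUnion t t'))" for a b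
  proof -
    have "25 ^ a * P ^ b \<le> 25 ^ node_count (DUnion t t') * P ^ sum w (verts (DUnion t t'))"
      by (intro mult_le_mono power_increasing that P1) simp
    then show ?thesis using pr(12) by (rule le_trans)
  qed
  then have le: "25 ^ node_count t * P ^ sum w (verts t) \<le> B" "25 ^ node_count t' * P ^ sum w (verts t') \<le> B"
    by (simp_all only: sum node_count.simps)
  have led: "dp P w t s * dp P w t' s \<le> B" for s
    using dp_le[OF pr(5), of P w s] P1 pr(12) by simp
  let ?n1 = "n + node_count t" and ?n2 = "n + node_count t + node_count t'"
  have u1: "u + Q \<le> ?n1 * Q"
    using pr(8) mult_le_mono1[OF node_count_pos[of t], of Q] unfolding add_mult_distrib by linarith
  have u2: "u \<le> ?n2 * Q" using u1 unfolding add_mult_distrib by linarith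
  have "iterate nodes_left main_node (node_count t * (12 + 3 * W + 8 * Q) +
      (node_count t' * (12 + 3 * W + 8 * Q) + (12 + 3 * W + 8 * Q))) (computed Z (Suc ?n2) u tb (dp P w (DUnion t t'))) rs lb tb"
  proof (rule iterate_trans'[OF DUnion.IH(1)[of pre "encode_cexp c t' @ [1, 0, 0, 0] @ post" n rs tb u]], goal_cases)
    case (13 rs1 lb1 tb1)
    note h1 = 13[unfolded computed_def]
    have lb1: "lb1 = lb" using h1 by (simp add: at_node_def)
    show ?case
      unfolding lb1
    proof (rule iterate_trans'[OF DUnion.IH(2)[of "pre @ encode_cexp c t" "[1, 0, 0, 0] @ post" ?n1 rs1 tb1 "u + Q"]], goal_cases)
      case (13 rs2 lb2 tb2)
      note h2 = 13[unfolded computed_def]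
      have lb2: "lb2 = lb" using h2 by (simp add: at_node_def)
      have tb2: "tb2 (u + S) = dp P w t (state_of S)" "tb2 (u + Q + S) = dp P w t' (state_of S)" if "S < Q" for S
        using h1 h2 that by simp_all
      have "digit N ?n2 Z \<le> W" using pr(11) digit_less[OF N_pos, of ?n2 Z] by linarith
      moreover have "writes 1 u 0 0 (P ^ digit N ?n2 Z) tb2 (\<lambda>S. dp P w (DUnion t t') (state_of S))"
        unfolding dp.simps by (rule writes_union) (use tb2 led in auto)
      ultimately show ?case
        unfolding lb2
        by (intro iterate_main_node[where pre = "pre @ encode_cexp c t @ encode_cexp c t'" and post = post and ty = 1
              and v = "u + Q + Q" and w = "digit N ?n2 Z" and j = 0])
          (use pr h1 h2 lb2 u2 in auto)
    qed (use pr kt h1 lb1 le u1 in auto)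
  qed (use pr kt le in auto)
  then show ?case by (rule iterate_conseq) (auto simp: add_mult_distrib add.assoc)
next
  case (Relabel i j t)
  note pr = Relabel.prems
  have le: "25 ^ node_count t * P ^ sum w (verts t) \<le> B" using pr(12) by simp
  have led: "dp P w t s \<le> B" for s
    using dp_le[of k t P w s] P_pos le pr(5) by simp
  have "iterate nodes_left main_node (node_count t * (12 + 3 * W + 8 * Q) + (12 + 3 * W + 8 * Q))
      (computed Z (Suc (n + node_count t)) u tb (dp P w (Relabel i j t))) rs lb tb"
  proof (rule iterate_main_unary[where ty = 2 and i = i and j = j and pre = "pre @ encode_cexp c t" and post = post, OF Relabel.IH[of pre "[2, i, j, 0] @ post" n]], goal_cases)
    case (21 e tb')
    then show ?case by (intro writes_relabel) (use pr(4) led in auto)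
  qed (use pr le in \<open>auto simp: add_mult_distrib\<close>)
  then show ?case by (rule iterate_conseq) auto
next
  case (Join i j t)
  note pr = Join.prems
  have le: "25 ^ node_count t * P ^ sum w (verts t) \<le> B" using pr(12) by simp
  have led: "dp P w (Join i j t) s \<le> B" for s
    using dp_le[OF pr(5), of P w s] P_pos pr(12) by simp
  have "iterate nodes_left main_node (node_count t * (12 + 3 * W + 8 * Q) + (12 + 3 * W + 8 * Q))
      (computed Z (Suc (n + node_count t)) u tb (dp P w (Join i j t))) rs lb tb"
  proof (rule iterate_main_unary[where ty = 3 and i = i and j = j and pre = "pre @ encode_cexp c t" and post = post, OF Join.IH[of pre "[3, i, j, 0] @ post" n]], goal_cases)
    case (21 e tb')
    then show ?case by (intro writes_join) (use pr(4,5) led in auto)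
  qed (use pr le in \<open>auto simp: add_mult_distrib\<close>)
  then show ?case by (rule iterate_conseq) (auto simp del: dp.simps)
qed

end

subsection \<open>Reading off the answer\<close>

definition odd_weight :: "nat cexp \<Rightarrow> (nat \<Rightarrow> nat) \<Rightarrow> nat \<Rightarrow> bool" where
  "odd_weight t w m \<longleftrightarrow> odd (card {X. connected_dominating_set (verts t) (edges t) X \<and> sum w X = m})"

lemma digit_pred_power: "i < n \<Longrightarrow> digit 5 i (5 ^ n - 1) = 4"
proof -
  assume "i < n"
  then obtain d where d: "n = i + Suc d" using less_iff_Suc_add by auto
  have "(5::nat) ^ n - 1 = (5 ^ Suc d - 1) * 5 ^ i + (5 ^ i - 1)"
    by (simp add: d power_add algebra_simps)
  also have "\<dots> div 5 ^ i = 5 ^ Suc d - 1"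
  proof -
    have "(x * M + y) div M = x" if "y < M" for x y M :: nat
      using that by simp
    then show ?thesis by (simp only: diff_less zero_less_power zero_less_numeral zero_less_one)
  qed
  also have "(5 ^ Suc d - 1) mod 5 = (4 :: nat)"
  proof -
    obtain e where "(5::nat) ^ d = Suc e" by (metis Suc_pred zero_less_numeral zero_less_power)
    then have "(5::nat) ^ Suc d - 1 = 4 + 5 * e" by simp
    then show ?thesis by simp
  qed
  finally show ?thesis by (simp add: digit_def)
qed

lemma label_class_labels: "label_class t l \<noteq> {} \<Longrightarrow> l \<in> labels t"
  by (induction t arbitrary: l) (auto split: if_splits)

lemma labels_le: "k_expression k t \<Longrightarrow> labels t \<subseteq> {0..k}"
  by (induction t) auto

context machine
begin

text \<open>The number \<open>b\<close> of coefficients of interest may be exponential in the input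
  size, since the budget is written in binary. The loop also stops when no digits remain, hence
  within \<open>D\<close> rounds; the digits left unread by then are 0.\<close>

lemma run_final_loop:
  assumes ok: "ok rs lb tb" and rs: "rs 1 = P" "rs 11 = V" "rs 10 = b" "rs 7 = 0" and V: "V < P ^ D" and B: "1 \<le> B"
  shows "run (While (Mul (reg 11) (reg 10)) final_step) (Suc (D * 5))
    (\<lambda>rs' lb' tb'. rs' 7 \<noteq> 0 \<longleftrightarrow> (\<exists>n<b. digit P n V mod 4 \<noteq> 0)) rs lb tb" (is "run _ _ ?R _ _ _")
proof -
  define k where "k = (LEAST j. V div P ^ j * (b - j) = 0)"
  have D0: "V div P ^ D * (b - D) = 0" and b0: "V div P ^ b * (b - b) = 0" using V by simp_all
  have k: "V div P ^ k * (b - k) = 0" "k \<le> D" "k \<le> b"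
    unfolding k_def
    using LeastI[of "\<lambda>j. V div P ^ j * (b - j) = 0", OF D0] Least_le[of "\<lambda>j. V div P ^ j * (b - j) = 0", OF D0]
      Least_le[of "\<lambda>j. V div P ^ j * (b - j) = 0", OF b0] by - assumption+
  have less: "V div P ^ j * (b - j) \<noteq> 0" if "j < k" for j
    using not_less_Least[of j "\<lambda>j. V div P ^ j * (b - j) = 0"] that by (simp add: k_def)
  let ?I = "\<lambda>j rs' lb' tb'. rs' 1 = P \<and> rs' 11 = V div P ^ j \<and> rs' 10 = b - j \<and> (rs' 7 \<noteq> 0 \<longleftrightarrow> (\<exists>n<j. digit P n V mod 4 \<noteq> 0))"
  have "run (While (Mul (reg 11) (reg 10)) final_step) (Suc (k * Suc 4)) ?R rs lb tb"
  proof (rule run_While_invariant[OF ok, where I = ?I])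
    fix j and rs1 lb1 tb1 :: "nat \<Rightarrow> nat"
    assume j: "j < k" and I: "?I j rs1 lb1 tb1" and ok1: "ok rs1 lb1 tb1"
    show "aval (Mul (reg 11) (reg 10)) (mem xs rs1 lb1 tb1) \<noteq> 0" using less[OF j] I by simp
    have "V div P ^ j div P = V div P ^ Suc j" by (rule div_power_Suc)
    moreover have "V div P ^ Suc j \<le> B" "b - Suc j \<le> B"
      using okD(1)[OF ok, of 11] okD(1)[OF ok, of 10] rs div_le_dividend[of V "P ^ Suc j"] by linarith+
    moreover have d: "digit P j V = V div P ^ j mod P" by (simp add: digit_def)
    ultimately have rest: "run (set_reg 11 (Div (reg 11) (reg 1)) ;; set_reg 10 (Sub (reg 10) (Const 1))) (Suc 1) (?I (Suc j)) s lb1 tb1"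
      if "ok s lb1 tb1" "s 1 = P" "s 11 = V div P ^ j" "s 10 = b - j" "s 7 \<noteq> 0 \<longleftrightarrow> (\<exists>n<Suc j. digit P n V mod 4 \<noteq> 0)" for s
      using that
      by (intro run_set_reg_Seq[OF that(1), where v = "V div P ^ Suc j"] run_set_reg[where v = "b - Suc j"])
        (auto simp del: power_Suc)
    let ?J = "\<lambda>s lb' tb'. lb' = lb1 \<and> tb' = tb1 \<and> s 1 = P \<and> s 11 = V div P ^ j \<and> s 10 = b - j \<and>
        (s 7 \<noteq> 0 \<longleftrightarrow> (\<exists>n<Suc j. digit P n V mod 4 \<noteq> 0))"
    have "run (If (Mod (Mod (reg 11) (reg 1)) (Const 4)) (set_reg 7 (Const 1)) Skip) (Suc 1) ?J rs1 lb1 tb1"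
    proof (rule run_If[OF ok1])
      assume "aval (Mod (Mod (reg 11) (reg 1)) (Const 4)) (mem xs rs1 lb1 tb1) \<noteq> 0"
      then have "digit P j V mod 4 \<noteq> 0" using I d by simp
      then show "run (set_reg 7 (Const 1)) 1 ?J rs1 lb1 tb1"
        using I B by (intro run_set_reg[OF ok1, where v = 1]) auto
    next
      assume "aval (Mod (Mod (reg 11) (reg 1)) (Const 4)) (mem xs rs1 lb1 tb1) = 0"
      then have "digit P j V mod 4 = 0" using I d by simp
      then have e: "(\<exists>n<Suc j. digit P n V mod 4 \<noteq> 0) \<longleftrightarrow> (\<exists>n<j. digit P n V mod 4 \<noteq> 0)"
        by (auto simp: less_Suc_eq)
      show "run Skip 1 ?J rs1 lb1 tb1"
        unfolding e using I by (intro run_Skip[OF ok1]) simp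
    qed simp
    then have "run final_step (Suc 1 + Suc 1) (?I (Suc j)) rs1 lb1 tb1"
      unfolding final_step_def by (rule run_Seq') (use rest in blast)
    then show "run final_step 4 (?I (Suc j)) rs1 lb1 tb1"
      by (rule run_conseq) simp_all
  next
    fix rs1 lb1 tb1 :: "nat \<Rightarrow> nat"
    assume I: "?I k rs1 lb1 tb1"
    show "aval (Mul (reg 11) (reg 10)) (mem xs rs1 lb1 tb1) = 0" using I k(1) by simp
    have "n < k" if "n < b" "digit P n V mod 4 \<noteq> 0" for n
    proof (rule ccontr)
      assume "\<not> n < k"
      then have "P ^ n = P ^ k * P ^ (n - k)" by (simp flip: power_add)
      then have "V div P ^ n = V div P ^ k div P ^ (n - k)" by (simp add: div_mult2_eq)
      moreover have "V div P ^ k = 0" using k(1) that(1) \<open>\<not> n < k\<close> by simp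
      ultimately show False using that(2) by (simp add: digit_def)
    qed
    then show "?R rs1 lb1 tb1" using I k(3) by (meson less_le_trans)
  qed (use rs in auto)
  then show ?thesis by (rule run_conseq) (use k(2) in auto)
qed

lemma run_after_toss:
  fixes \<mu> :: "nat cexp"
  defines "n \<equiv> node_count \<mu>"
  assumes xs: "xs = encode_instance \<mu> c b" and k: "k_expression k \<mu>" and \<rho>: "placed \<rho> 0 \<mu>"
    and ok: "ok rs (\<lambda>_. 0) tb" and rs: "rs 0 = N" "rs 1 = P" "rs 3 = Z"
    and P: "P = N ^ length xs" and N: "32 \<le> N" "N \<le> W"
    and w: "\<And>v. w v = c v * (N * length xs) + digit N (\<rho> v) Z" "\<And>v. v \<in> verts \<mu> \<Longrightarrow> w v \<le> W"
    and B: "length xs < B" "length xs * 5 ^ (2 * n) \<le> B" "P ^ W \<le> B" "W \<le> B"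
      "25 ^ n * P ^ sum w (verts \<mu>) \<le> B" "(b + 1) * (N * length xs) \<le> B"
  shows "run after_toss (19 + 9 * n + n * (12 + 3 * W + 40 * 5 ^ k) + 5 * sum w (verts \<mu>))
    (\<lambda>rs' lb' tb'. rs' 7 \<noteq> 0 \<longleftrightarrow> (\<exists>m<(b + 1) * (N * length xs).
      odd_weight \<mu> w m)) rs (\<lambda>_. 0) tb"
    (is "run _ _ ?R _ _ _")
proof -
  have len: "length xs = 4 * n + 1" by (simp add: xs encode_instance_def n_def)
  have n1: "1 \<le> n" unfolding n_def by (rule node_count_pos)
  have x1: "xs = [b] @ encode_cexp c \<mu> @ []" by (simp add: xs encode_instance_def)
  have P1: "1 \<le> P" using N by (simp add: P)
  have five: "5 ^ (card {} + 2 * node_count \<mu>) \<le> B"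
    using mult_le_mono1[of 1 "length xs" "5 ^ (2 * n)"] B(2) len by (simp add: n_def)
  let ?\<Lambda> = "labels \<mu>" and ?D = "sum w (verts \<mu>) + 1"
  define Q where "Q = (5::nat) ^ card ?\<Lambda>"
  have card\<Lambda>: "card ?\<Lambda> \<le> 2 * n" by (simp add: n_def card_labels)
  have Qk: "Q \<le> 5 * 5 ^ k"
  proof -
    have "card ?\<Lambda> \<le> card {0..k}" by (rule card_mono[OF _ labels_le[OF k]]) simp
    then have "Q \<le> 5 ^ Suc k" unfolding Q_def by (intro power_increasing) auto
    then show ?thesis by simp
  qed
  have QB: "length xs * 5 ^ card ?\<Lambda> \<le> B"
    by (rule le_trans[OF mult_le_mono2[OF power_increasing[OF card\<Lambda>]] B(2)]) simp
  have Q1: "1 \<le> Q" by (simp add: Q_def)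
  \<comment> \<open>A coefficient is at most the value at 1, thus at most
    \<open>25 ^ n < 32 ^ n \<le> P\<close>; here the lower bound 32 on the base \<open>N\<close> is
    used.\<close>
  have coeff_less: "coeff (dp (monom 1 1) w \<mu> s) i < P" for s i
  proof -
    have "coeff (dp (monom 1 1) w \<mu> s) i \<le> (dp 1 w \<mu> s :: nat)"
      by (rule order_trans[OF coeff_le_poly_1]) (simp only: poly_dp poly_monom power_one_right mult_1 order_refl)
    also have "\<dots> \<le> 25 ^ n" using dp_le[OF k, of 1 w s] by (simp add: n_def)
    also have "(25::nat) ^ n < 32 ^ n" using n1 by (intro power_strict_mono) auto
    also have "(32::nat) ^ n \<le> 32 ^ length xs" by (rule power_increasing) (auto simp: len)
    also have "\<dots> \<le> P" unfolding P by (rule power_mono) (use N in auto)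
    finally show ?thesis .
  qed
  have V_less: "dp P w \<mu> s < P ^ ?D" for s
  proof -
    have "(25::nat) ^ n < 32 ^ n" using n1 by (intro power_strict_mono) auto
    also have "(32::nat) ^ n \<le> 32 ^ length xs" by (rule power_increasing) (auto simp: len)
    also have "\<dots> \<le> P" unfolding P by (rule power_mono) (use N in auto)
    finally have "25 ^ n * P ^ sum w (verts \<mu>) < P * P ^ sum w (verts \<mu>)"
      using P1 by (intro mult_strict_right_mono) auto
    also have "\<dots> = P ^ ?D" by simp
    finally show ?thesis by (rule le_less_trans[OF dp_le[OF k P1, of w s, folded n_def]])
  qed
  have digit_dp: "digit P m (dp P w \<mu> s) = coeff (dp (monom 1 1) w \<mu> s) m" for s m
    using digit_poly[of "dp (monom 1 1) w \<mu> s" P m, OF coeff_less]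
    by (simp only: poly_dp poly_monom power_one_right mult_1)
  have nl: "aval nodes_left (mem xs s lb' tb') = length xs - s 5" for s lb' tb'
    by (simp add: nodes_left_def)
  have "run after_toss (Suc (Suc (Suc (9 * n) + Suc (Suc (Suc (n * (12 + 3 * W + 8 * Q)) +
      Suc (Suc (Suc (Suc (?D * 5))))))))) ?R rs (\<lambda>_. 0) tb"
    unfolding after_toss_def
  proof (rule run_set_reg_Seq[OF ok, where v = 1], goal_cases)
    case 5
    show ?case
    proof (rule run_set_reg_Seq[OF 5, where v = 2], goal_cases)
      case 5
      let ?rs = "rs(6 := 1, 5 := 2)"
      have it: "iterate nodes_left label_node (9 * node_count \<mu>)
          (labels_read ({} \<union> labels \<mu>) (length [b] + 4 * node_count \<mu>) ?rs) ?rs (\<lambda>_. 0) tb"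
        by (rule iterate_labels[OF x1]) (use 5 five B(1) in \<open>auto simp: labels_read_def place_values_def\<close>)
      show ?case
      proof (rule run_Seq'[where ?Q1.0 = "\<lambda>rs' lb' tb'. (\<exists>r'. place_values ?\<Lambda> r' lb') \<and>
           rs' 6 = Q \<and> rs' 0 = N \<and> rs' 1 = P \<and> rs' 3 = Z"], goal_cases)
        case 1
        show ?case
          by (rule run_While, rule iterate_conseq[OF it])
            (use rs len in \<open>auto simp: nl Q_def n_def labels_read_def\<close>)
      next
        case (2 rs1 lb1 tb1)
        then obtain r where pv: "place_values ?\<Lambda> r lb1" by auto
        note h = 2
        interpret T: tables xs B ?\<Lambda> r lb1 N P W
          by unfold_locales (use pv N P1 B QB len in auto)
        have QQ: "T.Q = Q" by (simp only: T.Q_def Q_def)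
        have top: "T.state_of (Q - 1) l = 4" if "label_class \<mu> l \<noteq> {}" for l
        proof -
          have "l \<in> ?\<Lambda>" using label_class_labels[OF that] .
          then show ?thesis
            unfolding Q_def by (simp only: T.state_of_def digit_pred_power[OF T.r_less] if_True)
        qed
        let ?V = "dp P w \<mu> (T.state_of (Q - 1))" and ?b = "(b + 1) * (N * length xs)"
        have odd: "digit P m ?V mod 4 \<noteq> 0 \<longleftrightarrow>
          odd_weight \<mu> w m" for m
        proof -
          have "[coeff (dp (monom 1 1) w \<mu> (T.state_of (Q - 1))) m =
            2 * card {X. connected_dominating_set (verts \<mu>) (edges \<mu>) X \<and> sum w X = m}] (mod 4)"
            by (rule coeff_dp_mod_4[OF k]) (rule top)
          then show ?thesis unfolding digit_dp cong_def odd_weight_def by presburger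
        qed
        show ?case
        proof (rule run_set_reg_Seq[OF h(1), where v = 2], goal_cases)
          case 5
          show ?case
          proof (rule run_set_reg_Seq[OF 5, where v = 0], goal_cases)
            case 5
            let ?rs1 = "rs1(5 := 2, 12 := 0)"
            have it2: "iterate nodes_left main_node (node_count \<mu> * (12 + 3 * W + 8 * T.Q))
                (T.computed Z (0 + node_count \<mu>) 0 tb1 (dp P w \<mu>)) ?rs1 lb1 tb1"
              by (rule T.iterate_main[OF x1, where rs = ?rs1 and \<rho> = \<rho> and k = k])
                (use 5 h QQ \<rho> k w N B in \<open>auto simp: n_def T.at_node_def\<close>)
            show ?case
            proof (rule run_Seq'[where ?Q1.0 = "\<lambda>rs' lb' tb'. rs' 0 = N \<and> rs' 1 = P \<and> rs' 6 = Q \<and> tb' (Q - 1) = ?V"], goal_cases)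
              case 1
              show ?case
                by (rule run_While, rule iterate_conseq[OF it2])
                  (use Q1 len QQ in \<open>auto simp: nl n_def T.computed_def T.at_node_def\<close>)
            next
              case (2 rs2 lb2 tb2)
              have VB: "?V \<le> B" using okD(3)[OF 2(1), of "Q - 1"] 2(2) by simp
              have inp: "aval (inp (Const 1)) (mem xs s lb2 tb2) = b" for s
                by (subst aval_inp[where i = 0]) (use len in \<open>auto simp: x1\<close>)
              show ?case
              proof (rule run_set_reg_Seq[OF 2(1), where v = ?V], goal_cases)
                case 5
                show ?case
                proof (rule run_set_reg_Seq[OF 5, where v = ?b], goal_cases)
                  case 5
                  show ?case
                  proof (rule run_set_reg_Seq[OF 5, where v = 0], goal_cases)
                    case 5
                    show ?case
                      unfolding odd[symmetric]
                      by (rule run_final_loop[OF 5]) (use 2 V_less B(1) in auto)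
                  qed auto
                qed (use 2 inp B(6) in auto)
              qed (use 2 VB in auto)
            qed
          qed (use B(1) in auto)
        qed (use B(1) len n1 in auto)
      qed
    qed (use B(1) len n1 in auto)
  qed (use B(1) len in auto)
  then show ?thesis
  proof (rule run_conseq)
    have "n * (8 * Q) \<le> n * (40 * 5 ^ k)" using Qk by (intro mult_le_mono2) linarith
    moreover have "Suc (Suc (Suc (9 * n) + Suc (Suc (Suc (n * 12 + z + x) + Suc (Suc (Suc (Suc ((s + 1) * 5)))))))) \<le>
        19 + 9 * n + (n * 12 + z + y) + 5 * s" if "x \<le> y" for x y z s :: nat
      using that by simp
    ultimately show "Suc (Suc (Suc (9 * n) + Suc (Suc (Suc (n * (12 + 3 * W + 8 * Q)) +
      Suc (Suc (Suc (Suc (?D * 5)))))))) \<le> 19 + 9 * n + n * (12 + 3 * W + 40 * 5 ^ k) + 5 * sum w (verts \<mu>)"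
      unfolding distrib_left by blast
  qed
qed

end

lemma le_power_two: "n \<le> 2 ^ n" for n :: nat
  using less_exp[of n] by linarith

context machine
begin

lemma run_before_toss:
  assumes ok: "ok rs lb tb" and B: "32 + 2 * length xs \<le> B" "(32 + 2 * length xs) ^ length xs \<le> B"
  shows "run before_toss (6 * length xs + 11) (\<lambda>rs' lb' tb'. lb' = lb \<and> length xs \<le> rs' 0 \<and> (\<exists>d. rs' 0 = 32 * 2 ^ d) \<and>
    rs' 0 \<le> 32 + 2 * length xs \<and> rs' 1 = rs' 0 ^ length xs \<and> rs' 2 = rs' 1 \<and> rs' 3 = 0 \<and> rs' 4 = 0) rs lb tb"
    (is "run _ _ ?R _ _ _")
proof -
  have "run before_toss ((3 * length xs + 5) + ((3 * length xs + 3) + Suc (Suc 1))) ?R rs lb tb"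
    unfolding before_toss_def
  proof (rule run_Seq'[OF run_find_base[OF ok]], goal_cases)
    case (3 rs1 lb1 tb1)
    then have "rs1 0 ^ length xs \<le> (32 + 2 * length xs) ^ length xs"
      by (intro power_mono) auto
    then have P: "rs1 0 ^ length xs \<le> B" using B(2) by linarith
    have pos: "0 < rs1 0" using 3 by auto
    show ?case
    proof (rule run_Seq'[OF run_find_point[OF 3(1) P pos]], goal_cases)
      case (2 rs2 lb2 tb2)
      note h = 2
      show ?case
      proof (rule run_set_reg_Seq[OF h(1), where v = "rs2 1"], goal_cases)
        case 5
        show ?case
        proof (rule run_set_reg_Seq[OF 5, where v = 0], goal_cases)
          case 5
          then show ?case by (rule run_set_reg[where v = 0]) (use h 3 in auto)
        qed auto
      qed (use okD(1)[OF h(1)] in auto)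
    qed (use B(1) in auto)
  qed (use B(1) in auto)
  then show ?thesis by (rule run_conseq) auto
qed

text \<open>\<open>M\<close> bounds the base \<open>N\<close> found by the program, and
  \<open>W\<close> the weight of a vertex for every outcome \<open>Z\<close> of the tosses, so that
  one \<open>B\<close> works for all outcomes.\<close>

lemma exec_cds_prog:
  fixes \<mu> :: "nat cexp" and q :: nat
  defines "n \<equiv> node_count \<mu>" and "M \<equiv> 32 + 2 * length xs"
  defines "W \<equiv> q * (M * length xs) + M"
  assumes xs: "xs = encode_instance \<mu> c b" and k: "k_expression k \<mu>" and \<rho>: "placed \<rho> 0 \<mu>"
    and c: "\<And>v. v \<in> verts \<mu> \<Longrightarrow> c v \<le> q"
    and B: "W \<le> B" "length xs * 5 ^ (2 * n) \<le> B" "M ^ (length xs * W) \<le> B"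
      "25 ^ n * M ^ (length xs * (n * W)) \<le> B" "(b + 1) * (M * length xs) \<le> B"
  shows "\<exists>N f t. length xs \<le> N \<and> exec cds_prog (init_memory xs) =
      map_spmf (\<lambda>Z. (f Z, t Z)) (spmf_of_set {..<N ^ length xs}) \<and>
    (\<forall>Z<N ^ length xs. t Z \<le> (32 + 6 * length xs + 5 * (M * length xs) + 9 * n + n * (12 + 3 * W + 40 * 5 ^ k) + 5 * (n * W)) * C \<and>
      (f Z 0 \<noteq> 0 \<longleftrightarrow> (\<exists>m<(b + 1) * (N * length xs). odd_weight \<mu> (\<lambda>v. c v * (N * length xs) + digit N (\<rho> v) Z) m)))"
proof -
  let ?l = "length xs"
  have len: "?l = 4 * n + 1" by (simp add: xs encode_instance_def n_def)
  have n1: "1 \<le> n" unfolding n_def by (rule node_count_pos)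
  have W: "M \<le> W" "1 \<le> W" by (simp_all add: W_def M_def)
  have MB: "M \<le> B" using W B(1) by linarith
  have lB: "?l < B" using MB by (simp add: M_def)
  have "M ^ ?l \<le> M ^ (?l * W)" by (rule power_increasing) (use W in \<open>auto simp: M_def\<close>)
  then have MlB: "M ^ ?l \<le> B" using B(3) by linarith
  have ok0: "ok (\<lambda>_. 0) (\<lambda>_. 0) (\<lambda>_. 0)" by (simp add: ok_def)
  obtain t0 rs tb where t0: "t0 \<le> (6 * ?l + 11) * C" "exec before_toss (init_memory xs) = return_spmf (mem xs rs (\<lambda>_. 0) tb, t0)"
    and ok: "ok rs (\<lambda>_. 0) tb" and rs: "?l \<le> rs 0" "\<exists>d. rs 0 = 32 * 2 ^ d" "rs 0 \<le> M" "rs 1 = rs 0 ^ ?l" "rs 2 = rs 1" "rs 3 = 0" "rs 4 = 0"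
    using run_before_toss[OF ok0 MB[unfolded M_def] MlB[unfolded M_def]]
    unfolding run_def init_memory_mem M_def by blast
  define N where "N = rs 0"
  define P where "P = N ^ ?l"
  obtain d where d: "N = 32 * 2 ^ d" using rs(2) by (auto simp: N_def)
  have N: "32 \<le> N" "N \<le> M" "?l \<le> N" using rs(1,3) by (simp_all add: d N_def[symmetric])
  have Nd: "N = 2 ^ (5 + d)" by (simp add: d power_add)
  have PB: "P \<le> B" using power_mono[OF N(2), of ?l] MlB by (simp add: P_def)
  define m where "m = (5 + d) * ?l"
  have Pm: "P = 2 ^ m" by (simp add: P_def m_def Nd power_mult)
  \<comment> \<open>A crude bound on the number of tosses, from
    \<open>5 + d \<le> 2 ^ (5 + d) = N\<close>.\<close>
  have m: "m \<le> M * ?l"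
    unfolding m_def using le_power_two[of "5 + d"] N(2)[unfolded Nd] by (intro mult_le_mono1) linarith
  let ?g = "Sub (reg 2) (Const 1)"
  let ?rs = "\<lambda>Z. rs(2 := 1, 3 := Z)"
  have rs2: "rs 2 = 2 ^ m" using rs(4,5) by (simp only: N_def[symmetric] P_def[symmetric] Pm)
  have "(rs 3 + 1) * 2 ^ m \<le> B" using rs(6) PB by (simp add: Pm)
  from toss_loop[OF ok rs2 rs(7) this] obtain t1 where t1: "\<forall>Z<2 ^ m. t1 Z \<le> (5 * m + 1) * C"
    "exec (While ?g toss) (mem xs rs (\<lambda>_. 0) tb) =
      map_spmf (\<lambda>Z. (mem xs (rs(2 := 1, 3 := rs 3 * 2 ^ m + Z)) (\<lambda>_. 0) tb, t1 Z)) (spmf_of_set {..<2 ^ m})"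
    by blast
  have t1: "\<And>Z. Z < P \<Longrightarrow> t1 Z \<le> (5 * m + 1) * C"
    "exec (While ?g toss) (mem xs rs (\<lambda>_. 0) tb) = map_spmf (\<lambda>Z. (mem xs (?rs Z) (\<lambda>_. 0) tb, t1 Z)) (spmf_of_set {..<P})"
    using t1 by (simp_all only: rs(6) mult_0 add_0 Pm)
  define wt where "wt Z v = c v * (N * ?l) + digit N (\<rho> v) Z" for Z v
  define good where "good Z \<longleftrightarrow> (\<exists>m<(b + 1) * (N * ?l). odd_weight \<mu> (wt Z) m)" for Z
  define T2 where "T2 = 19 + 9 * n + n * (12 + 3 * W + 40 * 5 ^ k) + 5 * (n * W) + 1"
  have after: "\<exists>r. snd r \<le> T2 * C \<and> exec (after_toss ;; Assign (Const 0) (reg 7)) (mem xs (?rs Z) (\<lambda>_. 0) tb) = return_spmf r \<and>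
      (fst r 0 \<noteq> 0 \<longleftrightarrow> good Z)" if Z: "Z < P" for Z
  proof -
    have wtW: "wt Z v \<le> W" if "v \<in> verts \<mu>" for v
    proof -
      have "c v * (N * ?l) \<le> q * (M * ?l)" using c[OF that] N by (intro mult_le_mono) auto
      moreover have "digit N (\<rho> v) Z < N" using N by (intro digit_less) auto
      ultimately show ?thesis using N(2) unfolding wt_def W_def by linarith
    qed
    have sumW: "sum (wt Z) (verts \<mu>) \<le> n * W"
    proof -
      have "sum (wt Z) (verts \<mu>) \<le> card (verts \<mu>) * W"
        using sum_bounded_above[of "verts \<mu>" "wt Z" W] wtW by simp
      also have "\<dots> \<le> n * W" unfolding n_def by (intro mult_le_mono1 card_verts)
      finally show ?thesis .
    qed
    have PM: "P ^ a \<le> M ^ (?l * a)" for a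
      using power_mono[OF power_mono[OF N(2), of ?l], of a] by (simp add: P_def power_mult)
    have "ok (?rs Z) (\<lambda>_. 0) tb" using ok Z PB lB by (intro ok_upd) auto
    moreover have "P ^ W \<le> B" using PM[of W] B(3) by linarith
    moreover have "25 ^ node_count \<mu> * P ^ sum (wt Z) (verts \<mu>) \<le> B"
    proof -
      have "P ^ sum (wt Z) (verts \<mu>) \<le> P ^ (n * W)"
        using sumW N by (intro power_increasing) (auto simp: P_def)
      also have "\<dots> \<le> M ^ (?l * (n * W))" by (rule PM)
      finally have "25 ^ n * P ^ sum (wt Z) (verts \<mu>) \<le> 25 ^ n * M ^ (?l * (n * W))" by (rule mult_le_mono2)
      then show ?thesis using B(4) unfolding n_def by (rule le_trans)
    qed
    moreover have "(b + 1) * (N * ?l) \<le> B"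
    proof -
      have "(b + 1) * (N * ?l) \<le> (b + 1) * (M * ?l)" using N by (intro mult_le_mono) auto
      then show ?thesis using B(5) by linarith
    qed
    ultimately have "run after_toss (19 + 9 * node_count \<mu> + node_count \<mu> * (12 + 3 * W + 40 * 5 ^ k) + 5 * sum (wt Z) (verts \<mu>))
      (\<lambda>rs' lb' tb'. rs' 7 \<noteq> 0 \<longleftrightarrow> (\<exists>m<(b + 1) * (N * length xs).odd_weight \<mu> (wt Z) m)) (?rs Z) (\<lambda>_. 0) tb"
      by (intro run_after_toss[OF xs k \<rho>, where P = P and Z = Z])
        (use rs N W wtW lB B in \<open>auto simp: N_def[symmetric] P_def wt_def n_def\<close>)
    then obtain t2 rs' lb' tb' where t2: "t2 \<le> (19 + 9 * n + n * (12 + 3 * W + 40 * 5 ^ k) + 5 * sum (wt Z) (verts \<mu>)) * C"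
      "exec after_toss (mem xs (?rs Z) (\<lambda>_. 0) tb) = return_spmf (mem xs rs' lb' tb', t2)" "ok rs' lb' tb'"
      "rs' 7 \<noteq> 0 \<longleftrightarrow> good Z"
      unfolding run_def good_def n_def by blast
    define m' where "m' = mem xs rs' lb' tb'"
    define t3 where "t3 = acost (Const 0) m' + acost (reg 7) m' + size_nat (aval (Const 0) m') + size_nat (aval (reg 7) m')"
    have "t3 \<le> C" unfolding t3_def m'_def
      by (rule Assign_cost[OF t2(3)]) (simp_all add: size_nat_def compute_floorlog)
    moreover have "t2 \<le> (19 + 9 * n + n * (12 + 3 * W + 40 * 5 ^ k) + 5 * (n * W)) * C"
      by (rule le_trans[OF t2(1)]) (use sumW in \<open>intro mult_le_mono1\<close>, simp)
    ultimately have "t2 + t3 \<le> T2 * C" by (simp add: T2_def add_mult_distrib)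
    moreover have "exec (after_toss ;; Assign (Const 0) (reg 7)) (mem xs (?rs Z) (\<lambda>_. 0) tb) =
       return_spmf (m'(0 := rs' 7), t2 + t3)"
      by (simp only: exec.simps t2(2) return_bind_spmf fst_conv snd_conv) (simp add: t3_def m'_def)
    ultimately show ?thesis using t2(4) by (intro exI[of _ "(m'(0 := rs' 7), t2 + t3)"]) simp
  qed
  then have "\<forall>Z\<in>{..<P}. \<exists>r. snd r \<le> T2 * C \<and> exec (after_toss ;; Assign (Const 0) (reg 7)) (mem xs (?rs Z) (\<lambda>_. 0) tb) = return_spmf r \<and>
      (fst r 0 \<noteq> 0 \<longleftrightarrow> good Z)" by blast
  from bchoice[OF this] obtain r where
    "\<forall>Z\<in>{..<P}. snd (r Z) \<le> T2 * C \<and> exec (after_toss ;; Assign (Const 0) (reg 7)) (mem xs (?rs Z) (\<lambda>_. 0) tb) = return_spmf (r Z) \<and>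
      (fst (r Z) 0 \<noteq> 0 \<longleftrightarrow> good Z)" ..
  then have r: "snd (r Z) \<le> T2 * C" "exec (after_toss ;; Assign (Const 0) (reg 7)) (mem xs (?rs Z) (\<lambda>_. 0) tb) = return_spmf (r Z)"
    "fst (r Z) 0 \<noteq> 0 \<longleftrightarrow> good Z" if "Z < P" for Z using that by auto
  define t where "t Z = t0 + (t1 Z + snd (r Z))" for Z
  have "exec cds_prog (init_memory xs) = bind_spmf (spmf_of_set {..<P}) (\<lambda>Z.
      bind_spmf (exec (after_toss ;; Assign (Const 0) (reg 7)) (mem xs (?rs Z) (\<lambda>_. 0) tb)) (\<lambda>r. return_spmf (fst r, t0 + (t1 Z + snd r))))"
    unfolding cds_prog_def exec.simps(4)[of before_toss] exec.simps(4)[of "While ?g toss"]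
    by (simp only: t0(2) t1(2) map_spmf_conv_bind_spmf bind_spmf_assoc return_bind_spmf fst_conv snd_conv)
  also have "\<dots> = bind_spmf (spmf_of_set {..<P}) (\<lambda>Z. return_spmf (fst (r Z), t Z))"
    by (intro bind_spmf_cong refl) (simp only: set_spmf_of_set_finite finite_lessThan lessThan_iff r(2) return_bind_spmf t_def)
  finally have ex: "exec cds_prog (init_memory xs) = map_spmf (\<lambda>Z. (fst (r Z), t Z)) (spmf_of_set {..<P})"
    by (simp only: map_spmf_conv_bind_spmf)
  let ?T = "32 + 6 * ?l + 5 * (M * ?l) + 9 * n + n * (12 + 3 * W + 40 * 5 ^ k) + 5 * (n * W)"
  have "t Z \<le> ?T * C" if "Z < P" for Z
  proof -
    have "t Z \<le> ((6 * ?l + 11) + (5 * m + 1) + T2) * C"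
      using t0(1) t1(1)[OF that] r(1)[OF that] unfolding t_def add_mult_distrib by linarith
    also have "\<dots> \<le> ?T * C"
      by (intro mult_le_mono1) (use m in \<open>simp add: T2_def\<close>)
    finally show ?thesis .
  qed
  then show ?thesis
    using ex r(3) N(3) unfolding P_def good_def wt_def
    by (intro exI[of _ N] exI[of _ "\<lambda>Z. fst (r Z)"] exI[of _ t]) blast
qed

end

subsection \<open>Time bound and error probability\<close>

lemma spmf_map_spmf_of_set:
  fixes P :: nat
  shows "spmf (map_spmf f (spmf_of_set {..<P})) x = real (card {Z. Z < P \<and> f Z = x}) / real P"
proof -
  have "{..<P} \<inter> f -` {x} = {Z. Z < P \<and> f Z = x}" by auto
  then show ?thesis
    unfolding spmf_map measure_spmf_of_set by simp
qed

text \<open>Lets the time bound be recognised as a polynomial by closure properties, without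
  expanding it.\<close>

definition poly_fun :: "(nat \<Rightarrow> nat) \<Rightarrow> bool" where
  "poly_fun f \<longleftrightarrow> (\<exists>p. \<forall>x. f x = poly p x)"

lemma poly_fun_const: "poly_fun (\<lambda>_. a)"
  unfolding poly_fun_def by (rule exI[of _ "[:a:]"]) simp

lemma poly_fun_id: "poly_fun (\<lambda>x. x)"
  unfolding poly_fun_def by (rule exI[of _ "[:0, 1:]"]) simp

lemma poly_fun_poly: "poly_fun (\<lambda>x. poly q x)"
  unfolding poly_fun_def by blast

lemma poly_fun_add: "poly_fun f \<Longrightarrow> poly_fun g \<Longrightarrow> poly_fun (\<lambda>x. f x + g x)"
  unfolding poly_fun_def by (metis poly_add)

lemma poly_fun_mult: "poly_fun f \<Longrightarrow> poly_fun g \<Longrightarrow> poly_fun (\<lambda>x. f x * g x)"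
  unfolding poly_fun_def by (metis poly_mult)

lemma poly_fun_power: "poly_fun f \<Longrightarrow> poly_fun (\<lambda>x. f x ^ n)"
  unfolding poly_fun_def by (metis poly_power)

lemmas poly_fun_intros = poly_fun_const poly_fun_id poly_fun_poly poly_fun_add poly_fun_mult poly_fun_power

definition weight_bound :: "nat poly \<Rightarrow> nat \<Rightarrow> nat" where
  "weight_bound q x = poly q x * ((32 + 2 * x) * x) + (32 + 2 * x)"

text \<open>The binary logarithm of the bound \<open>B\<close>. The last product pays for the powers
  of \<open>P\<close> in the tables, by \<open>M \<le> 2 ^ M\<close>; the term \<open>15 * x\<close>
  covers the input, \<open>25 ^ n\<close> and \<open>length xs * 5 ^ (2 * n)\<close>.\<close>

definition memory_bits :: "nat poly \<Rightarrow> nat \<Rightarrow> nat" where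
  "memory_bits q x = 15 * x + 32 + weight_bound q x + (32 + 2 * x) * (x * ((x + 1) * weight_bound q x))"

text \<open>A step count from which \<open>5 ^ k\<close> has been pulled out, times the unit cost
  \<open>C\<close> for a \<open>B\<close> of bit length \<open>memory_bits q x + 2\<close>.\<close>

definition time_bound :: "nat poly \<Rightarrow> nat \<Rightarrow> nat" where
  "time_bound q x = (32 + 6 * x + 5 * ((32 + 2 * x) * x) + 9 * x + x * (12 + 3 * weight_bound q x + 40) +
     5 * (x * weight_bound q x)) * (100000 * (memory_bits q x + 2)\<^sup>2)"

lemma time_bound_poly: "\<exists>p. \<forall>x. time_bound q x = poly p x"
  unfolding poly_fun_def[symmetric] time_bound_def memory_bits_def weight_bound_def
  by (intro poly_fun_intros)

lemma length_le_word_size: "length xs \<le> word_size xs"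
proof (induction xs)
  case (Cons x xs)
  then show ?case using size_nat_pos[of x] by (simp add: word_size_def)
qed simp

lemma less_word_size: "x \<in> set xs \<Longrightarrow> x < 2 ^ word_size xs"
proof -
  assume "x \<in> set xs"
  then have "size_nat x \<le> word_size xs"
    unfolding word_size_def by (induction xs) auto
  then have "(2::nat) ^ (size_nat x - 1) \<le> 2 ^ word_size xs" by (intro power_increasing) auto
  then show ?thesis using less_two_power_size[of x] by linarith
qed

lemma size_nat_power_two: "size_nat (2 ^ L) = L + 2"
proof -
  have "size_nat (2 ^ L) \<le> Suc (L + 1)" by (subst size_nat_le_iff) simp
  moreover have "\<not> size_nat (2 ^ L) \<le> Suc L" by (subst size_nat_le_iff) simp
  ultimately show ?thesis by simp
qed

lemma cds_prog_uniform:
  fixes \<mu> :: "nat cexp" and c :: "nat \<Rightarrow> nat" and b :: nat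
  defines "xs \<equiv> encode_instance \<mu> c b"
  assumes k: "k_expression k \<mu>" and \<rho>: "placed \<rho> 0 \<mu>"
    and c: "\<And>v. v \<in> verts \<mu> \<Longrightarrow> c v \<le> poly q (word_size xs)"
  shows "\<exists>N f t. length xs \<le> N \<and> exec cds_prog (init_memory xs) =
      map_spmf (\<lambda>Z. (f Z, t Z)) (spmf_of_set {..<N ^ length xs}) \<and>
    (\<forall>Z<N ^ length xs. t Z \<le> time_bound q (word_size xs) * 5 ^ k \<and>
      (f Z 0 \<noteq> 0 \<longleftrightarrow> (\<exists>m<(b + 1) * (N * length xs). odd_weight \<mu> (\<lambda>v. c v * (N * length xs) + digit N (\<rho> v) Z) m)))"
proof -
  let ?l = "length xs" and ?x = "word_size xs" and ?q = "poly q (word_size xs)" and ?n = "node_count \<mu>"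
  define M where "M = 32 + 2 * ?l"
  define W where "W = ?q * (M * ?l) + M"
  define B where "B = (2::nat) ^ memory_bits q ?x"
  have lx: "?l \<le> ?x" by (rule length_le_word_size)
  have l: "?l = 4 * ?n + 1" by (simp add: xs_def encode_instance_def)
  have nl: "?n \<le> ?l" using l by simp
  define M' where "M' = 32 + 2 * ?x"
  have MM: "M \<le> M'" using lx by (simp add: M_def M'_def)
  have WW: "W \<le> weight_bound q ?x"
    unfolding W_def weight_bound_def M'_def[symmetric] by (intro add_mono mult_le_mono MM lx order_refl)
  have bits: "memory_bits q ?x = 15 * ?x + 32 + weight_bound q ?x + M' * (?x * ((?x + 1) * weight_bound q ?x))"
    by (simp add: memory_bits_def M'_def)
  have M2: "M ^ a \<le> 2 ^ (M' * a)" for a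
  proof -
    have "M ^ a \<le> (2 ^ M') ^ a"
      by (intro power_mono order_trans[OF MM le_power_two]) simp
    then show ?thesis by (simp add: power_mult)
  qed
  have two: "2 ^ a \<le> B" if "a \<le> memory_bits q ?x" for a
    unfolding B_def using that by (intro power_increasing) auto
  have B1: "W \<le> B"
    by (rule order_trans[OF le_power_two two]) (use WW in \<open>simp add: bits\<close>)
  have B2: "?l * 5 ^ (2 * ?n) \<le> B"
  proof -
    have "(5::nat) ^ (2 * ?n) \<le> 8 ^ (2 * ?n)" by (rule power_mono) auto
    also have "(8::nat) ^ (2 * ?n) = 2 ^ (6 * ?n)"
      using power_mult[of "2::nat" 3 "2 * ?n"] by simp
    finally have "?l * 5 ^ (2 * ?n) \<le> 2 ^ ?l * 2 ^ (6 * ?n)"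
      by (intro mult_le_mono le_power_two)
    also have "\<dots> = 2 ^ (?l + 6 * ?n)" by (simp add: power_add)
    also have "\<dots> \<le> B" by (rule two) (use nl lx in \<open>simp add: bits\<close>)
    finally show ?thesis .
  qed
  have lW: "?l * (a * W) \<le> ?x * ((?x + 1) * weight_bound q ?x)" if "a \<le> ?x + 1" for a
    using that by (intro mult_le_mono WW lx)
  have B3: "M ^ (?l * W) \<le> B"
  proof (rule order_trans[OF M2 two])
    have "M' * (?l * W) \<le> M' * (?x * ((?x + 1) * weight_bound q ?x))"
      using lW[of 1] by (intro mult_le_mono2) simp
    then show "M' * (?l * W) \<le> memory_bits q ?x" unfolding bits by linarith
  qed
  have B4: "25 ^ ?n * M ^ (?l * (?n * W)) \<le> B"
  proof -
    have "(25::nat) ^ ?n \<le> 32 ^ ?n" by (rule power_mono) auto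
    also have "(32::nat) ^ ?n = 2 ^ (5 * ?n)"
      by (simp add: power_mult)
    finally have "25 ^ ?n * M ^ (?l * (?n * W)) \<le> 2 ^ (5 * ?n) * 2 ^ (M' * (?l * (?n * W)))"
      by (intro mult_le_mono M2)
    also have "\<dots> = 2 ^ (5 * ?n + M' * (?l * (?n * W)))" by (simp add: power_add)
    also have "\<dots> \<le> B"
    proof (rule two)
      have "M' * (?l * (?n * W)) \<le> M' * (?x * ((?x + 1) * weight_bound q ?x))"
        using lW[of ?n] nl lx by (intro mult_le_mono2) simp
      moreover have "5 * ?n \<le> 15 * ?x" using nl lx by linarith
      ultimately show "5 * ?n + M' * (?l * (?n * W)) \<le> memory_bits q ?x" unfolding bits by linarith
    qed
    finally show ?thesis .
  qed
  have inp: "y < 2 ^ ?x" if "y \<in> set xs" for y using less_word_size[OF that] .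
  have B5: "(b + 1) * (M * ?l) \<le> B"
  proof -
    have "b \<in> set xs" by (simp add: xs_def encode_instance_def)
    then have "b + 1 \<le> 2 ^ ?x" using inp by fastforce
    then have "(b + 1) * (M * ?l) \<le> 2 ^ ?x * (2 ^ M * 2 ^ ?l)"
      by (intro mult_le_mono le_power_two)
    also have "\<dots> = 2 ^ (?x + (M + ?l))" by (simp add: power_add)
    also have "\<dots> \<le> B" by (rule two) (use lx in \<open>simp add: bits M_def\<close>)
    finally show ?thesis .
  qed
  interpret machine xs B
  proof
    show "?l \<le> B" by (rule order_trans[OF le_power_two two]) (use lx in \<open>simp add: bits\<close>)
    show "y \<le> B" if "y \<in> set xs" for y
      by (rule order_trans[OF less_imp_le[OF inp[OF that]] two]) (simp add: bits)
  qed
  have C: "C = 100000 * (memory_bits q ?x + 2)\<^sup>2"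
    unfolding C_def by (simp only: B_def size_nat_power_two)
  let ?T = "32 + 6 * ?l + 5 * (M * ?l) + 9 * ?n + ?n * (12 + 3 * W + 40 * 5 ^ k) + 5 * (?n * W)"
  have T: "?T * C \<le> time_bound q ?x * 5 ^ k"
  proof -
    let ?W = "weight_bound q ?x"
    have five: "1 \<le> (5::nat) ^ k" by simp
    have nx: "?n \<le> ?x" using nl lx by linarith
    have "?T \<le> 32 + 6 * ?x + 5 * (M' * ?x) + 9 * ?x + ?x * (12 + 3 * ?W + 40 * 5 ^ k) + 5 * (?x * ?W)"
      by (intro add_mono mult_le_mono order_refl lx nx MM WW)
    also have "\<dots> \<le> (32 + 6 * ?x + 5 * (M' * ?x) + 9 * ?x + ?x * (12 + 3 * ?W + 40) + 5 * (?x * ?W)) * 5 ^ k"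
    proof -
      have g: "a \<le> a * 5 ^ k" for a :: nat by simp
      have "?x * (12 + 3 * ?W + 40 * 5 ^ k) \<le> ?x * (12 + 3 * ?W + 40) * 5 ^ k"
        unfolding mult.assoc by (intro mult_le_mono2) (use g[of "12 + 3 * ?W"] in \<open>simp only: add_mult_distrib\<close>)
      then show ?thesis
        unfolding add_mult_distrib[of _ _ "5 ^ k"] by (intro add_mono g)
    qed
    finally have "?T * C \<le> (32 + 6 * ?x + 5 * (M' * ?x) + 9 * ?x + ?x * (12 + 3 * ?W + 40) + 5 * (?x * ?W)) * 5 ^ k * C"
      by (rule mult_le_mono1)
    also have "\<dots> = time_bound q ?x * 5 ^ k"
      unfolding time_bound_def C M'_def by (simp only: ac_simps)
    finally show ?thesis .
  qed
  obtain N f t where 1: "?l \<le> N" "exec cds_prog (init_memory xs) = map_spmf (\<lambda>Z. (f Z, t Z)) (spmf_of_set {..<N ^ ?l})"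
    and 2: "\<And>Z. Z < N ^ ?l \<Longrightarrow> t Z \<le> ?T * C" "\<And>Z. Z < N ^ ?l \<Longrightarrow>
      f Z 0 \<noteq> 0 \<longleftrightarrow> (\<exists>m<(b + 1) * (N * length xs). odd_weight \<mu> (\<lambda>v. c v * (N * length xs) + digit N (\<rho> v) Z) m)"
    using exec_cds_prog[OF _ k \<rho>, of c b ?q] B1 B2 B3 B4 B5 c unfolding xs_def[symmetric] M_def[symmetric] W_def[symmetric]
    by blast
  have "t Z \<le> time_bound q ?x * 5 ^ k" if "Z < N ^ ?l" for Z
    using 2(1)[OF that] T by (rule order_trans)
  then show ?thesis using 1 2(2) by blast
qed

theorem theorem28:
  shows "\<exists>A :: prog. \<forall>q :: nat poly. \<exists>p :: nat poly.
    \<forall>(k :: nat) (\<mu> :: nat cexp) (V :: nat set) (E :: nat set set) (c :: nat \<Rightarrow> nat) (b :: nat).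
      k_expression k \<mu> \<longrightarrow> nice \<mu> \<longrightarrow> V = verts \<mu> \<longrightarrow> E = edges \<mu> \<longrightarrow>
      connected_graph V E \<longrightarrow> 2 \<le> card V \<longrightarrow>
      (\<forall>v\<in>V. 0 < c v \<and> c v \<le> poly q (word_size (encode_instance \<mu> c b))) \<longrightarrow>
        runs_in_time A (encode_instance \<mu> c b)
          (poly p (word_size (encode_instance \<mu> c b)) * 5 ^ k) \<and>
        (\<not> CDS V E c b \<longrightarrow> spmf (answer A (encode_instance \<mu> c b)) True = 0) \<and>
        (CDS V E c b \<longrightarrow> spmf (answer A (encode_instance \<mu> c b)) False \<le> 1 / 2)"
proof (rule exI[of _ cds_prog], rule allI, goal_cases)
  case (1 q)
  obtain p where p: "\<And>x. time_bound q x = poly p x" using time_bound_poly by blast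
  show ?case
  proof (rule exI[of _ p], intro allI impI, goal_cases)
    case (1 k \<mu> V E c b)
    then have k: "k_expression k \<mu>" and V: "V = verts \<mu>" and E: "E = edges \<mu>" and card2: "2 \<le> card V"
      and c: "\<forall>v\<in>V. 0 < c v \<and> c v \<le> poly q (word_size (encode_instance \<mu> c b))"
      by auto
    define xs where "xs = encode_instance \<mu> c b"
    let ?l = "length xs"
    obtain \<rho> where \<rho>: "placed \<rho> 0 \<mu>" using placed_exists[OF k] by blast
    have "v \<in> verts \<mu> \<Longrightarrow> c v \<le> poly q (word_size (encode_instance \<mu> c b))" for v using c V by simp
    from cds_prog_uniform[OF k \<rho> this] obtain N f t where lN: "?l \<le> N"
      and ex: "exec cds_prog (init_memory xs) = map_spmf (\<lambda>Z. (f Z, t Z)) (spmf_of_set {..<N ^ ?l})"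
      and t: "\<And>Z. Z < N ^ ?l \<Longrightarrow> t Z \<le> time_bound q (word_size xs) * 5 ^ k"
      and f: "\<And>Z. Z < N ^ ?l \<Longrightarrow> f Z 0 \<noteq> 0 \<longleftrightarrow> (\<exists>m<(b + 1) * (N * ?l). odd_weight \<mu> (\<lambda>v. c v * (N * ?l) + digit N (\<rho> v) Z) m)"
      unfolding xs_def by blast
    define w where "w Z v = c v * (N * ?l) + digit N (\<rho> v) Z" for Z v
    define F where "F = {X. connected_dominating_set V E X}"
    have l: "?l = 4 * node_count \<mu> + 1" by (simp add: xs_def encode_instance_def)
    have N0: "0 < N" using lN l by linarith
    let ?P = "N ^ ?l"
    have P0: "0 < ?P" using N0 by simp
    have finV: "finite V" by (simp add: V)
    have FV: "F \<subseteq> Pow V" by (auto simp: F_def connected_dominating_set_def)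
    have finF: "finite F" using FV finV finite_subset by blast
    have sum_w: "sum (w Z) X = sum c X * (N * ?l) + (\<Sum>v\<in>X. digit N (\<rho> v) Z)" for Z X
      by (simp add: w_def sum.distrib sum_distrib_right)
    have f': "f Z 0 \<noteq> 0 \<longleftrightarrow> (\<exists>m<(b + 1) * (N * ?l). odd (card {X\<in>F. sum (w Z) X = m}))" if "Z < ?P" for Z
      using f[OF that] by (simp add: F_def w_def[abs_def] odd_weight_def V E)
    have ans: "answer cds_prog xs = map_spmf (\<lambda>Z. f Z 0 \<noteq> 0) (spmf_of_set {..<?P})"
      unfolding answer_def ex by (simp add: spmf.map_comp o_def)
    have "runs_in_time cds_prog xs (poly p (word_size xs) * 5 ^ k)"
    proof -
      have "{..<?P} \<noteq> {}" using P0 by blast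
      then show ?thesis
        unfolding runs_in_time_def ex using t by (auto simp: p[symmetric])
    qed
    moreover have "spmf (answer cds_prog xs) True = 0" if no: "\<not> CDS V E c b"
    proof -
      have "\<not> f Z 0 \<noteq> 0" if Z: "Z < ?P" for Z
      proof
        assume "f Z 0 \<noteq> 0"
        then obtain m where m: "m < (b + 1) * (N * ?l)" "odd (card {X\<in>F. sum (w Z) X = m})"
          using f'[OF Z] by blast
        then have "{X\<in>F. sum (w Z) X = m} \<noteq> {}" by (metis card.empty even_zero)
        then obtain X where X: "X \<in> F" "sum (w Z) X = m" by blast
        \<comment> \<open>The digits only add to the scaled cost, so a weight below the limit forces
          cost at most \<open>b\<close>. This holds for every \<open>Z\<close>, hence there are no
          false positives.\<close>
        have "sum c X * (N * ?l) < (b + 1) * (N * ?l)" using X(2) m(1) unfolding sum_w by linarith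
        then have "sum c X < b + 1" by (simp only: mult_less_cancel2)
        then have "sum c X \<le> b" by simp
        then show False using no X(1) by (auto simp: CDS_def F_def)
      qed
      then have "{Z. Z < ?P \<and> (f Z 0 \<noteq> 0) = True} = {}" by blast
      then show ?thesis unfolding ans spmf_map_spmf_of_set by simp
    qed
    moreover have "spmf (answer cds_prog xs) False \<le> 1 / 2" if yes: "CDS V E c b"
    proof -
      obtain X0 where X0: "X0 \<in> F" "sum c X0 \<le> b" using yes by (auto simp: CDS_def F_def)
      let ?bad = "{Z\<in>{..<?P}. \<exists>X Y. min_weight (w Z) F X \<and> min_weight (w Z) F Y \<and> X \<noteq> Y}"
      have good: "f Z 0 \<noteq> 0" if Z: "Z < ?P" "Z \<notin> ?bad" for Z
      proof -
        obtain X where X: "min_weight (w Z) F X"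
          using ex_min_if_finite[of "sum (w Z) ` F"] finF X0(1) unfolding min_weight_def
          by (metis (no_types, lifting) arg_min_if_finite(1) arg_min_if_finite(2) empty_iff linorder_not_le)
        \<comment> \<open>Isolation enters here: the minimum is attained once, so the number of sets
          at this weight is odd.\<close>
        have "{Y\<in>F. sum (w Z) Y = sum (w Z) X} = {X}"
        proof -
          have "Y = X" if "Y \<in> F" "sum (w Z) Y = sum (w Z) X" for Y
          proof -
            have "min_weight (w Z) F Y" using X that by (simp add: min_weight_def)
            then show ?thesis using Z X by auto
          qed
          then show ?thesis using X by (auto simp: min_weight_def)
        qed
        then have "odd (card {Y\<in>F. sum (w Z) Y = sum (w Z) X})" by simp
        \<comment> \<open>The minimum is compared with \<open>X0\<close>, whose scaled cost is at
          most \<open>b * (N * ?l)\<close> and whose digits add up to less than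
          \<open>N * ?l\<close>.\<close>
        moreover have "sum (w Z) X < (b + 1) * (N * ?l)"
        proof -
          have "X0 \<subseteq> V" using X0 FV by auto
          then have "card X0 \<le> card V" using finV card_mono by blast
          also have "card V \<le> node_count \<mu>"
            unfolding V by (rule card_verts)
          also have "\<dots> < ?l" using l by simp
          finally have "card X0 < ?l" .
          have "(\<Sum>v\<in>X0. digit N (\<rho> v) Z) \<le> card X0 * N"
            by (rule order_trans[OF sum_bounded_above[where K = N]]) (auto intro: less_imp_le digit_less N0)
          also have "\<dots> < ?l * N" using \<open>card X0 < ?l\<close> N0 by simp
          finally have "(\<Sum>v\<in>X0. digit N (\<rho> v) Z) < N * ?l" by (simp add: mult.commute)
          moreover have "sum c X0 * (N * ?l) \<le> b * (N * ?l)" using X0(2) by (rule mult_le_mono1)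
          moreover have "sum (w Z) X \<le> sum (w Z) X0" using X X0(1) by (simp add: min_weight_def)
          ultimately show ?thesis unfolding sum_w[of Z X0] add_mult_distrib by linarith
        qed
        ultimately show ?thesis using f'[OF Z(1)] by blast
      qed
      have "\<rho> ` V \<subseteq> {..<?l}" using placed_range[OF \<rho>] l by (force simp: V)
      then have iso: "N * card ?bad \<le> card V * ?P"
        using isolation[OF finV FV _ _ N0, of \<rho> ?l "\<lambda>v. c v * (N * ?l)"] placed_inj[OF \<rho>] unfolding w_def V by blast
      \<comment> \<open>Each node occupies four cells, so \<open>N\<close> exceeds
        \<open>4 * card V\<close>; the union bound \<open>card V / N\<close> is therefore at most
        one half.\<close>
      have "2 * card V \<le> N"
        using lN l card_verts[of \<mu>] unfolding V by linarith
      then have "card V * (2 * card ?bad) \<le> N * card ?bad"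
        using mult_le_mono1[of "2 * card V" N "card ?bad"] by (simp add: ac_simps)
      then have "card V * (2 * card ?bad) \<le> card V * ?P" using iso by linarith
      then have half: "2 * card ?bad \<le> ?P" using card2 by simp
      have "{Z. Z < ?P \<and> (f Z 0 \<noteq> 0) = False} \<subseteq> ?bad"
        using good by blast
      then have "card {Z. Z < ?P \<and> (f Z 0 \<noteq> 0) = False} \<le> card ?bad"
        by (rule card_mono[rotated]) simp
      then have "real (card {Z. Z < ?P \<and> (f Z 0 \<noteq> 0) = False}) \<le> real ?P / 2"
        using half by linarith
      then show ?thesis unfolding ans spmf_map_spmf_of_set using P0 by (simp add: field_simps)
    qed
    ultimately show ?case
      unfolding xs_def by blast
  qed
qed

end
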